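(* On the Bryant--Salamon $G_2$-manifold $\mathbb{R}^4\times S^3$, consider the $SU(2)^3$-invariant $G_2$-instanton $$A^{\lim}=A_1x\sum_{i=1}^3T_i\otimes\eta_i^++B_1y\sum_{i=1}^3T_i\otimes\eta_i^-$$ with gauge group $SU(2)$, defined near the singular orbit $\{0\}\times S^3$ and extending smoothly over it on $P_{\mathrm{id}}$, which is the unique such instanton satisfying $x(t)=\frac2t+O(t)$ and $y(0)=0$ (i.e. the member with $y_0=0$ of the local one-parameter family of such instantons parametrized by $y_0=y(0)\in\mathbb{R}$). Then $$x(t)=\frac{A_1(t)}{\frac12\left(B_1^2(t)-\frac13\right)},\qquad y(t)=0 ,$$ and $A^{\lim}$ extends as a $G_2$-instanton to the whole of $\mathbb{R}^4\times S^3$.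
   Context: Conventions: $SU(2)$ is identified with the unit quaternions; $\{T_i\}_{i=1}^3$ is a basis of $\mathfrak{su}(2)$ with $[T_i,T_j]=2\epsilon_{ijk}T_k$; $T_i^{\pm}=(T_i,\pm T_i)$; $\{\eta_i^{\pm}\}$ are the left-invariant 1-forms on $SU(2)^2$ dual to $\{T_i^{\pm}\}$. Manifold: $\mathbb{R}^4\times S^3\subset\mathbb{H}\times\mathbb{H}$ with $SU(2)^2$ acting by $(a_1,a_2)\cdot(p,q)=(a_1p,a_1q\bar a_2)$; the complement of the singular orbit $\{0\}\times S^3\cong SU(2)^2/\Delta SU(2)$ is identified with $\mathbb{R}^+_t\times SU(2)^2$ via $(t,a_1,a_2)\mapsto(ta_1,a_1\bar a_2)$. $SU(2)^3$ acts on $SU(2)^2$ by $(h_1,h_2,h_3)\cdot(g_1,g_2)=(h_1g_1h_3^{-1},h_2g_2h_3^{-1})$. Bryant--Salamon structure: define $r\in[1,\infty)$ by $t(r)=\int_1^r(1-s^{-3})^{-1/2}ds$ and $A_1=A_2=A_3=\frac r3\sqrt{1-r^{-3}}$, $B_1=B_2=B_3=\frac{r}{\sqrt3}$. With $\omega=4\sum_iA_iB_i\eta_i^-\wedge\eta_i^+$, $\Omega_1=8B_1B_2B_3\eta_{123}^--4\sum\epsilon_{ijk}A_iA_jB_k\eta_i^+\wedge\eta_j^+\wedge\eta_k^-$, $\Omega_2=-8A_1A_2A_3\eta_{123}^++4\sum\epsilon_{ijk}B_iB_jA_k\eta_i^-\wedge\eta_j^-\wedge\eta_k^+$, the $G_2$-structure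 is $\varphi=dt\wedge\omega+\Omega_1$, $\psi=*\varphi=\frac12\omega^2-dt\wedge\Omega_2$. A $G_2$-instanton is a connection with $F_A\wedge\psi=0$; for connections of the displayed form this is the ODE system $\dot x=\frac{\dot A_1}{A_1}x+y^2-x^2$, $\dot y=\frac{2\dot A_1-3}{A_1}y+2xy$. $P_{\mathrm{id}}=SU(2)^2\times_{(\Delta SU(2),\mathrm{id})}SU(2)$, with identity isotropy homomorphism, is a homogeneous bundle over $S^3=SU(2)^2/\Delta SU(2)$, pulled back to $\mathbb{R}^4\times S^3$; its pullback to $\mathbb{R}^+\times SU(2)^2$ is canonically trivial, and connections are written there as $\mathfrak{su}(2)$-valued 1-forms. *)

theory Defs
  imports "HOL-Analysis.Analysis" "HOL-Library.Landau_Symbols"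
begin

unbundle no cross3_syntax

text \<open>A quaternion is a pair (real part, imaginary part); the Euclidean structure of the product type
  is the usual one. SU(2) is the group of unit quaternions and su(2) is the space of imaginary
  quaternions, identified with \<open>real^3\<close>.\<close>

type_synonym quat = "real \<times> (real^3)"

definition qmul :: "quat \<Rightarrow> quat \<Rightarrow> quat" (infixl "\<odot>" 70) where
  "a \<odot> b = (fst a * fst b - snd a \<bullet> snd b,
             fst a *\<^sub>R snd b + fst b *\<^sub>R snd a + cross3 (snd a) (snd b))"

definition qcnj :: "quat \<Rightarrow> quat" where
  "qcnj a = (fst a, - snd a)"

definition SU2 :: "quat set" where
  "SU2 = sphere 0 1"

definition imq :: "real^3 \<Rightarrow> quat" where
  "imq \<xi> = (0, \<xi>)"

definition lie :: "real^3 \<Rightarrow> real^3 \<Rightarrow> real^3" where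
  "lie \<xi> \<zeta> = snd (imq \<xi> \<odot> imq \<zeta> - imq \<zeta> \<odot> imq \<xi>)"

definition Ad :: "quat \<Rightarrow> real^3 \<Rightarrow> real^3" where
  "Ad h \<xi> = snd (h \<odot> imq \<xi> \<odot> qcnj h)"

definition T :: "3 \<Rightarrow> real^3" where
  "T i = axis i 1"

definition eps :: "3 \<Rightarrow> 3 \<Rightarrow> 3 \<Rightarrow> real" where
  "eps i j k = cross3 (T i) (T j) $ k"

lemma eps_values:
  "eps 1 2 3 = 1" "eps 2 3 1 = 1" "eps 3 1 2 = 1"
  "eps 2 1 3 = -1" "eps 3 2 1 = -1" "eps 1 3 2 = -1"
  "eps i i k = 0" "eps i k k = 0" "eps k i k = 0"
  using exhaust_3[of i] exhaust_3[of k]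
  by (auto simp: eps_def T_def cross3_simps axis_def)

lemma lie_T: "lie (T i) (T j) = (\<Sum>k\<in>UNIV. (2 * eps i j k) *\<^sub>R T k)"
  by (auto simp: lie_def qmul_def imq_def eps_def T_def cross3_simps axis_def vec_eq_iff forall_3)

text \<open>\<open>Ck_on k W f\<close> is meant for open \<open>W\<close> in a finite-dimensional space.\<close>

primrec Ck_on :: "nat \<Rightarrow> 'a::euclidean_space set \<Rightarrow> ('a \<Rightarrow> 'b::euclidean_space) \<Rightarrow> bool" where
  "Ck_on 0 W f \<longleftrightarrow> continuous_on W f"
| "Ck_on (Suc k) W f \<longleftrightarrow>
     (\<forall>x\<in>W. f differentiable (at x)) \<and> (\<forall>v. Ck_on k W (\<lambda>x. frechet_derivative f (at x) v))"

definition smooth_on :: "'a::euclidean_space set \<Rightarrow> ('a \<Rightarrow> 'b::euclidean_space) \<Rightarrow> bool" where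
  "smooth_on W f \<longleftrightarrow> (\<forall>k. Ck_on k W f)"

text \<open>A form at a point is a function on lists of tangent vectors which vanishes on lists whose
  length is not the degree. \<open>unshuffles vs\<close> lists all ways to split \<open>vs\<close> into two subsequences
  \<open>xs\<close>, \<open>ys\<close>, together with the sign of the permutation from \<open>vs\<close> to \<open>xs @ ys\<close>; so the wedge
  product below is the usual one, normalised by
  (a wedge b)(u, v) = a(u) b(v) - a(v) b(u) on 1-forms.\<close>

fun unshuffles :: "'v list \<Rightarrow> (real \<times> 'v list \<times> 'v list) list" where
  "unshuffles [] = [(1, [], [])]"
| "unshuffles (v # vs) =
     map (\<lambda>(s, xs, ys). (s, v # xs, ys)) (unshuffles vs) @
     map (\<lambda>(s, xs, ys). ((- 1) ^ length xs * s, xs, v # ys)) (unshuffles vs)"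

definition wedge :: "('v list \<Rightarrow> 'b::real_vector) \<Rightarrow> ('v list \<Rightarrow> real) \<Rightarrow> 'v list \<Rightarrow> 'b"
    (infixr "\<and>\<^sub>w" 75) where
  "(\<alpha> \<and>\<^sub>w \<beta>) vs = (\<Sum>(s, xs, ys) \<leftarrow> unshuffles vs. (s * \<beta> ys) *\<^sub>R \<alpha> xs)"

definition covec :: "('v \<Rightarrow> real) \<Rightarrow> 'v list \<Rightarrow> real" where
  "covec a vs = (case vs of [v] \<Rightarrow> a v | _ \<Rightarrow> 0)"

lemma wedge_covec: "(covec a \<and>\<^sub>w covec b) [u, v] = a u * b v - a v * b u"
  by (simp add: wedge_def covec_def)

definition pullback ::
    "('p::real_normed_vector \<Rightarrow> 'q::real_normed_vector) \<Rightarrow> ('q \<Rightarrow> 'q list \<Rightarrow> 'b) \<Rightarrow> 'p \<Rightarrow> 'p list \<Rightarrow> 'b" where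
  "pullback f \<omega> x vs = \<omega> (f x) (map (frechet_derivative f (at x)) vs)"

text \<open>At the end point \<open>s = 1\<close> the integrand is a division by zero, hence 0, which does not affect
  the integral.\<close>

definition t_of_r :: "real \<Rightarrow> real" where
  "t_of_r r = integral {1..r} (\<lambda>s. 1 / sqrt (1 - 1 / s ^ 3))"

definition r_of_t :: "real \<Rightarrow> real" where
  "r_of_t = inv_into {1..} t_of_r"

definition bsA :: "real \<Rightarrow> real" where
  "bsA t = r_of_t t / 3 * sqrt (1 - 1 / r_of_t t ^ 3)"

definition bsB :: "real \<Rightarrow> real" where
  "bsB t = r_of_t t / sqrt 3"

type_synonym cyl = "real \<times> quat \<times> quat"

definition Cyl :: "cyl set" where
  "Cyl = {(t, g1, g2). t > 0 \<and> g1 \<in> SU2 \<and> g2 \<in> SU2}"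

definition T_Cyl :: "cyl \<Rightarrow> cyl set" where
  "T_Cyl = (\<lambda>(t, g1, g2). {(\<tau>, v1, v2). g1 \<bullet> v1 = 0 \<and> g2 \<bullet> v2 = 0})"

text \<open>\<open>mc g\<close> is the left-invariant Maurer--Cartan form of SU(2) at \<open>g\<close>. As \<open>mc\<close> of the two factors
  takes the values \<open>T i\<close> and \<open>\<plusminus> T i\<close> on the left-invariant field of (T i, \<open>\<plusminus>\<close> T i), the coframe
  dual to these fields is half the sum and half the difference (lemma \<open>eta_dual\<close>).\<close>

definition mc :: "quat \<Rightarrow> quat \<Rightarrow> real^3" where
  "mc g v = snd (qcnj g \<odot> v)"

definition eta_plus :: "3 \<Rightarrow> cyl \<Rightarrow> cyl \<Rightarrow> real" where
  "eta_plus i = (\<lambda>(t, g1, g2) (\<tau>, v1, v2). (mc g1 v1 $ i + mc g2 v2 $ i) / 2)"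

definition eta_minus :: "3 \<Rightarrow> cyl \<Rightarrow> cyl \<Rightarrow> real" where
  "eta_minus i = (\<lambda>(t, g1, g2) (\<tau>, v1, v2). (mc g1 v1 $ i - mc g2 v2 $ i) / 2)"

lemma mc_left_invariant: "g \<in> SU2 \<Longrightarrow> mc g (g \<odot> imq \<xi>) = \<xi>"
proof -
  assume "g \<in> SU2"
  then have "fst g * fst g + snd g \<bullet> snd g = 1"
    by (simp add: SU2_def norm_prod_def real_sqrt_eq_1_iff power2_eq_square
        flip: power2_norm_eq_inner)
  then have *: "(fst g * fst g + snd g \<bullet> snd g) *\<^sub>R \<xi> = \<xi>" by simp
  have "mc g (g \<odot> imq \<xi>) = (fst g * fst g + snd g \<bullet> snd g) *\<^sub>R \<xi>"
    by (simp add: mc_def qmul_def qcnj_def imq_def vec_eq_iff forall_3 cross3_simps)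
  with * show ?thesis by simp
qed

lemma eta_dual:
  assumes "g1 \<in> SU2" "g2 \<in> SU2"
  shows "eta_plus i (t, g1, g2) (0, g1 \<odot> imq (T j), g2 \<odot> imq (T j)) = (if i = j then 1 else 0)"
    and "eta_plus i (t, g1, g2) (0, g1 \<odot> imq (T j), g2 \<odot> imq (- T j)) = 0"
    and "eta_minus i (t, g1, g2) (0, g1 \<odot> imq (T j), g2 \<odot> imq (T j)) = 0"
    and "eta_minus i (t, g1, g2) (0, g1 \<odot> imq (T j), g2 \<odot> imq (- T j)) = (if i = j then 1 else 0)"
  using assms by (auto simp: eta_plus_def eta_minus_def mc_left_invariant T_def axis_def)

definition bs_omega :: "cyl \<Rightarrow> cyl list \<Rightarrow> real" where
  "bs_omega n vs = 4 * (\<Sum>i\<in>UNIV. bsA (fst n) * bsB (fst n) *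
     (covec (eta_minus i n) \<and>\<^sub>w covec (eta_plus i n)) vs)"

definition bs_Omega2 :: "cyl \<Rightarrow> cyl list \<Rightarrow> real" where
  "bs_Omega2 n vs =
     - 8 * bsA (fst n) ^ 3 *
       (covec (eta_plus 1 n) \<and>\<^sub>w covec (eta_plus 2 n) \<and>\<^sub>w covec (eta_plus 3 n)) vs
     + 4 * (\<Sum>i\<in>UNIV. \<Sum>j\<in>UNIV. \<Sum>k\<in>UNIV. eps i j k * bsB (fst n) ^ 2 * bsA (fst n) *
       (covec (eta_minus i n) \<and>\<^sub>w covec (eta_minus j n) \<and>\<^sub>w covec (eta_plus k n)) vs)"

definition bs_psi :: "cyl \<Rightarrow> cyl list \<Rightarrow> real" where
  "bs_psi n vs = 1 / 2 * (bs_omega n \<and>\<^sub>w bs_omega n) vs - (covec fst \<and>\<^sub>w bs_Omega2 n) vs"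

text \<open>\<open>M\<close> is the product of R^4 and the 3-sphere. \<open>Phi\<close> identifies \<open>Cyl\<close> with the complement of the
  singular orbit \<open>p = 0\<close>, and \<open>Phi_inv\<close> is its inverse (lemmas \<open>Phi_inv_Phi\<close>, \<open>Phi_Phi_inv\<close>).
  The formula for \<open>Phi_inv\<close> is smooth on an open neighbourhood of that complement in the ambient
  vector space, so that its ambient derivative can be used on tangent vectors.\<close>

definition M :: "(quat \<times> quat) set" where
  "M = {(p, q). q \<in> SU2}"

definition tube :: "real \<Rightarrow> (quat \<times> quat) set" where
  "tube \<epsilon> = {(p, q). norm p < \<epsilon> \<and> q \<in> SU2}"

definition Phi :: "cyl \<Rightarrow> quat \<times> quat" where
  "Phi = (\<lambda>(t, g1, g2). (t *\<^sub>R g1, g1 \<odot> qcnj g2))"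

definition Phi_inv :: "quat \<times> quat \<Rightarrow> cyl" where
  "Phi_inv = (\<lambda>(p, q). (norm p, p /\<^sub>R norm p, qcnj q \<odot> (p /\<^sub>R norm p)))"

text \<open>The form psi on \<open>M\<close>: transported by \<open>Phi\<close> off the singular orbit and extended over it by
  continuity. The tangent space of \<open>M\<close> at \<open>(p, q)\<close> does not depend on \<open>p\<close>, so the limit is taken
  with \<open>q\<close> and the tangent vectors \<open>vs\<close> fixed.\<close>

definition psi :: "quat \<times> quat \<Rightarrow> (quat \<times> quat) list \<Rightarrow> real" where
  "psi = (\<lambda>(p, q) vs.
     if p \<noteq> 0 then pullback Phi_inv bs_psi (p, q) vs
     else Lim (at 0) (\<lambda>p'. pullback Phi_inv bs_psi (p', q) vs))"

text \<open>The principal SU(2)-bundle associated to SU(2)^2 -> SU(2)^2 / Delta SU(2) by the identity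
  homomorphism is SU(2)^2 itself, with the diagonal right action, via
  [(a1, a2), g] |-> (a1 g, a2 g). Its pullback to \<open>M\<close> has total space
  \<open>{(p, a1, a2). a1, a2 \<in> SU2}\<close>, projection \<open>pr\<close> and right action \<open>ract\<close>;
  \<open>fund \<xi>\<close> is the fundamental vector field of \<open>\<xi>\<close>.\<close>

type_synonym tot = "quat \<times> quat \<times> quat"

definition pr :: "tot \<Rightarrow> quat \<times> quat" where
  "pr = (\<lambda>(p, a1, a2). (p, a1 \<odot> qcnj a2))"

definition P_id :: "(quat \<times> quat) set \<Rightarrow> tot set" where
  "P_id V = {x. fst (snd x) \<in> SU2 \<and> snd (snd x) \<in> SU2 \<and> pr x \<in> V}"

definition T_P :: "tot \<Rightarrow> tot set" where
  "T_P = (\<lambda>(p, a1, a2). {(v, w1, w2). a1 \<bullet> w1 = 0 \<and> a2 \<bullet> w2 = 0})"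

definition ract :: "quat \<Rightarrow> tot \<Rightarrow> tot" where
  "ract h = (\<lambda>(p, a1, a2). (p, a1 \<odot> h, a2 \<odot> h))"

definition fund :: "real^3 \<Rightarrow> tot \<Rightarrow> tot" where
  "fund \<xi> = (\<lambda>(p, a1, a2). (0, a1 \<odot> imq \<xi>, a2 \<odot> imq \<xi>))"

text \<open>Forms on the total space, a submanifold of a vector space, are pulled back along the retraction
  \<open>retr\<close> to the open subset \<open>retr -` P_id V\<close> of that vector space. A form is smooth iff this
  extension is, and its exterior derivative is the restriction of the exterior derivative of the
  extension. \<open>retr\<close> restricts to the identity on the total space, and its derivative at a point
  of it is the orthogonal projection to the tangent space, so \<open>ext A\<close> depends only on the values
  of \<open>A\<close> on tangent vectors.\<close>

definition retr :: "tot \<Rightarrow> tot" where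
  "retr = (\<lambda>(p, a1, a2). (p, a1 /\<^sub>R norm a1, a2 /\<^sub>R norm a2))"

definition ext :: "(tot \<Rightarrow> tot \<Rightarrow> real^3) \<Rightarrow> tot \<Rightarrow> tot \<Rightarrow> real^3" where
  "ext A x v = A (retr x) (frechet_derivative retr (at x) v)"

definition smooth_one_form :: "(quat \<times> quat) set \<Rightarrow> (tot \<Rightarrow> tot \<Rightarrow> real^3) \<Rightarrow> bool" where
  "smooth_one_form V A \<longleftrightarrow>
     (\<forall>x\<in>P_id V. linear (ext A x)) \<and> (\<forall>v. smooth_on (retr -` P_id V) (\<lambda>x. ext A x v))"

definition ext_deriv :: "(tot \<Rightarrow> tot \<Rightarrow> real^3) \<Rightarrow> tot \<Rightarrow> tot \<Rightarrow> tot \<Rightarrow> real^3" where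
  "ext_deriv A x u v =
     frechet_derivative (\<lambda>z. ext A z v) (at x) u - frechet_derivative (\<lambda>z. ext A z u) (at x) v"

definition connection_on :: "(quat \<times> quat) set \<Rightarrow> (tot \<Rightarrow> tot \<Rightarrow> real^3) \<Rightarrow> bool" where
  "connection_on V A \<longleftrightarrow>
     smooth_one_form V A \<and>
     (\<forall>x\<in>P_id V. \<forall>\<xi>. A x (fund \<xi> x) = \<xi>) \<and>
     (\<forall>x\<in>P_id V. \<forall>v\<in>T_P x. \<forall>h\<in>SU2. A (ract h x) (ract h v) = Ad (qcnj h) (A x v))"

definition curvature :: "(tot \<Rightarrow> tot \<Rightarrow> real^3) \<Rightarrow> tot \<Rightarrow> tot list \<Rightarrow> real^3" where
  "curvature A x vs =
     (case vs of [u, v] \<Rightarrow> ext_deriv A x u v + lie (A x u) (A x v) | _ \<Rightarrow> 0)"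

text \<open>Forms on \<open>M\<close> with values in the adjoint bundle are identified with equivariant horizontal forms
  on the total space; real forms on \<open>M\<close> are pulled back along \<open>pr\<close>.\<close>

definition G2_instanton :: "(quat \<times> quat) set \<Rightarrow> (tot \<Rightarrow> tot \<Rightarrow> real^3) \<Rightarrow> bool" where
  "G2_instanton V A \<longleftrightarrow>
     connection_on V A \<and>
     (\<forall>x\<in>P_id V. \<forall>vs. set vs \<subseteq> T_P x \<longrightarrow> (curvature A x \<and>\<^sub>w pullback pr psi x) vs = 0)"

text \<open>The action of SU(2)^3 on the total space covers the one on \<open>M\<close> that corresponds under \<open>Phi\<close>
  to (g1, g2) |-> (h1 g1 h3^-1, h2 g2 h3^-1). It acts by linear maps.\<close>

definition act3 :: "quat \<Rightarrow> quat \<Rightarrow> quat \<Rightarrow> tot \<Rightarrow> tot" where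
  "act3 h1 h2 h3 = (\<lambda>(p, a1, a2). (h1 \<odot> p \<odot> qcnj h3, h1 \<odot> a1, h2 \<odot> a2))"

definition SU2_cubed_invariant :: "(quat \<times> quat) set \<Rightarrow> (tot \<Rightarrow> tot \<Rightarrow> real^3) \<Rightarrow> bool" where
  "SU2_cubed_invariant V A \<longleftrightarrow>
     (\<forall>h1\<in>SU2. \<forall>h2\<in>SU2. \<forall>h3\<in>SU2. \<forall>x\<in>P_id V. \<forall>v\<in>T_P x.
        A (act3 h1 h2 h3 x) (act3 h1 h2 h3 v) = A x v)"

text \<open>The canonical trivialisation over \<open>Cyl\<close>: the section given by [(g1, g2), 1] over \<open>Phi (t, g1, g2)\<close>.
  \<open>has_form V x y A\<close> says that in this trivialisation \<open>A\<close> is the displayed su(2)-valued 1-form.\<close>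

definition sec :: "cyl \<Rightarrow> tot" where
  "sec = (\<lambda>(t, g1, g2). (t *\<^sub>R g1, g1, g2))"

definition ansatz :: "(real \<Rightarrow> real) \<Rightarrow> (real \<Rightarrow> real) \<Rightarrow> cyl \<Rightarrow> cyl \<Rightarrow> real^3" where
  "ansatz x y n v =
     (bsA (fst n) * x (fst n)) *\<^sub>R (\<Sum>i\<in>UNIV. eta_plus i n v *\<^sub>R T i) +
     (bsB (fst n) * y (fst n)) *\<^sub>R (\<Sum>i\<in>UNIV. eta_minus i n v *\<^sub>R T i)"

definition has_form ::
    "(quat \<times> quat) set \<Rightarrow> (real \<Rightarrow> real) \<Rightarrow> (real \<Rightarrow> real) \<Rightarrow> (tot \<Rightarrow> tot \<Rightarrow> real^3) \<Rightarrow> bool" where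
  "has_form V x y A \<longleftrightarrow>
     (\<forall>n\<in>Cyl. Phi n \<in> V \<longrightarrow>
        (\<forall>v\<in>T_Cyl n. A (sec n) (frechet_derivative sec (at n) v) = ansatz x y n v))"

text \<open>\<open>A\<close> with coefficient functions \<open>x\<close>, \<open>y\<close> is the instanton of the local family, on the tube of
  radius \<open>\<epsilon>\<close> around the singular orbit, with initial value \<open>y(0) = 0\<close>. Only the values of
  \<open>x\<close> and \<open>y\<close> on \<open>{0<..<\<epsilon>}\<close> matter, so \<open>y(0)\<close> is the limit at 0.\<close>

definition is_A_lim ::
    "real \<Rightarrow> (real \<Rightarrow> real) \<Rightarrow> (real \<Rightarrow> real) \<Rightarrow> (tot \<Rightarrow> tot \<Rightarrow> real^3) \<Rightarrow> bool" where
  "is_A_lim \<epsilon> x y A \<longleftrightarrow>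
     \<epsilon> > 0 \<and> G2_instanton (tube \<epsilon>) A \<and> SU2_cubed_invariant (tube \<epsilon>) A \<and> has_form (tube \<epsilon>) x y A \<and>
     (\<lambda>t. x t - 2 / t) \<in> O[at_right 0](\<lambda>t. t) \<and> (y \<longlongrightarrow> 0) (at_right 0)"

lemma qmul_assoc: "(a \<odot> b) \<odot> c = a \<odot> (b \<odot> c)"
  by (simp add: qmul_def prod_eq_iff vec_eq_iff forall_3 cross3_simps)

lemma SU2_cancel:
  assumes "g \<in> SU2"
  shows "qcnj g \<odot> g = (1, 0)" "g \<odot> qcnj g = (1, 0)"
proof -
  have "fst g * fst g + snd g \<bullet> snd g = 1"
    using assms by (simp add: SU2_def norm_prod_def real_sqrt_eq_1_iff power2_eq_square
        flip: power2_norm_eq_inner)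
  then show "qcnj g \<odot> g = (1, 0)" "g \<odot> qcnj g = (1, 0)"
    by (simp_all add: qmul_def qcnj_def vec_eq_iff forall_3 cross3_simps)
qed

lemma qmul_one [simp]: "(1, 0) \<odot> a = a" "a \<odot> (1, 0) = a"
  by (simp_all add: qmul_def)

lemma qcnj_qmul: "qcnj (a \<odot> b) = qcnj b \<odot> qcnj a"
  by (simp add: qmul_def qcnj_def prod_eq_iff vec_eq_iff forall_3 cross3_simps)

lemma qcnj_qcnj [simp]: "qcnj (qcnj a) = a"
  by (simp add: qcnj_def)

lemma Phi_inv_Phi:
  assumes "n \<in> Cyl"
  shows "Phi_inv (Phi n) = n"
proof -
  obtain t g1 g2 where n: "n = (t, g1, g2)" by (cases n)
  with assms have t: "t > 0" and g: "g1 \<in> SU2" "g2 \<in> SU2" by (auto simp: Cyl_def)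
  have nrm: "norm (t *\<^sub>R g1) = t"
    using t g by (simp add: SU2_def del: scaleR_Pair)
  have "(t *\<^sub>R g1) /\<^sub>R t = g1" using t by simp
  moreover have "qcnj (g1 \<odot> qcnj g2) \<odot> g1 = g2"
    using g by (simp add: qcnj_qmul qmul_assoc SU2_cancel)
  ultimately show ?thesis
    unfolding n Phi_def Phi_inv_def prod.case nrm by simp
qed

lemma Phi_Phi_inv: "(p, q) \<in> M \<Longrightarrow> p \<noteq> 0 \<Longrightarrow> Phi (Phi_inv (p, q)) = (p, q)"
proof -
  assume "(p, q) \<in> M" "p \<noteq> 0"
  then have q: "q \<in> SU2" and u: "p /\<^sub>R norm p \<in> SU2"
    by (auto simp: M_def SU2_def)
  show ?thesis
    using SU2_cancel(2)[OF u] \<open>p \<noteq> 0\<close>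
    by (simp add: Phi_inv_def Phi_def qcnj_qmul flip: qmul_assoc)
qed

lemma pr_sec: "pr (sec n) = Phi n"
  by (simp add: pr_def sec_def Phi_def split: prod.splits)

end

theory Submission
  imports Defs
begin

text \<open>On the total space, write \<open>z = (p, a1, a2)\<close>, put \<open>h = qcnj p \<odot> a1\<close> and let \<open>\<mu>1, \<mu>2, \<mu>3\<close> be the
  Maurer--Cartan forms pulled back along \<open>a1\<close>, \<open>a2\<close> and \<open>h\<close>. With \<open>P = (\<mu>1 + \<mu>2)/2 - \<mu>3\<close> and
  \<open>N = (\<mu>1 - \<mu>2)/2\<close>, a connection of the displayed form is \<open>a P + b N + \<mu>3\<close>, where \<open>a = A x\<close> and
  \<open>b = B y\<close> are functions of \<open>t = |p|\<close>; the forms \<open>P\<close>, \<open>N\<close> are conjugate to the pull-backs of \<open>\<eta>\<^sup>+\<close>,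
  \<open>\<eta>\<^sup>-\<close>, so by invariance \<open>\<psi>\<close> has the same expression in \<open>dt, P, N\<close> as in \<open>dt, \<eta>\<^sup>+, \<eta>\<^sup>-\<close>. The
  Maurer--Cartan equation gives the curvature, and the instanton equation becomes
  \<open>a' = (a - a\<^sup>2)/A + A (b\<^sup>2 - a)/B\<^sup>2\<close>, \<open>b' = 2 (a - 1) b/A\<close>.

  If \<open>x - 2/t = O(t)\<close> then \<open>(a - 1)/A\<close> tends to 0, so the second equation is linear in \<open>b\<close> with bounded
  coefficient and forces \<open>b = 0\<close>. For two solutions \<open>a\<close>, \<open>a0\<close> of the first one with \<open>b = 0\<close>, the
  function \<open>A\<^sup>2 (a - a0)\<close> again solves a linear equation with bounded coefficient and tends to 0.

  The solution \<open>a0 = A\<^sup>2/((B\<^sup>2 - 1/3)/2)\<close> is of the form \<open>1 + t\<^sup>2 f(t\<^sup>2)\<close> with \<open>f\<close> smooth, whence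
  \<open>a0 P + \<mu>3 = (\<mu>1 + \<mu>2)/2 + f(|p|\<^sup>2) |p|\<^sup>2 P\<close> is smooth across \<open>p = 0\<close>. The form \<open>\<psi>\<close> has a limit there,
  because \<open>P = E/t - N\<close> with \<open>E\<close> bounded and the combinations \<open>E\<^sub>i \<and> E\<^sub>j + dt \<and> E\<^sub>k\<close> do not depend on \<open>p\<close>;
  so the instanton equation extends to \<open>p = 0\<close> by continuity.\<close>

section \<open>Calculus of smooth maps\<close>

text \<open>The profile comes from a Riccati equation. For x = a/A and y = 0 the equation reads x' =
  (A'/A) x - x^2, so x = u'/u with u' a multiple of A. As B B' = A, one may take u = (B^2 - c)/2,
  and the pole 2/t forces u to vanish at t = 0, that is c = B(0)^2 = 1/3.

  The obstacle to uniqueness is that the system is singular at t = 0, where 1/A has a pole. The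
  difference of two solutions obeys a linear equation with coefficient (1 - a - a0)/A - A/B^2, which
  behaves like -1/A; the logarithmic derivative of A^2 is 1/A - A/B^2, and so the factor A^2 removes
  the pole.

  The obstacle to smoothness is that |p| is not smooth at p = 0, so the radial functions entering
  the connection have to be exhibited as smooth functions of t^2. This rests on r - 1 being a smooth
  function of t^2, the inverse of \<open>bsU\<close>.

  The summand \<mu>3 is the flat connection of the canonical trivialisation: it vanishes on the
  section \<open>sec\<close> and reproduces fundamental vector fields, on which P and N
  vanish.\<close>

lemma Ck_on_imp_continuous_on: "Ck_on k W f \<Longrightarrow> continuous_on W f"
  by (cases k) (auto intro!: differentiable_imp_continuous_on
      simp: differentiable_on_def differentiable_at_withinI)

lemma Ck_on_SucD: "Ck_on (Suc k) W f \<Longrightarrow> Ck_on k W f"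
proof (induction k arbitrary: f)
  case 0
  then show ?case by (simp only: Ck_on_imp_continuous_on Ck_on.simps(1))
next
  case (Suc k)
  then show ?case unfolding Ck_on.simps(2)[of "Suc k"] by simp
qed

lemma Ck_on_SucE:
  assumes "Ck_on (Suc k) W f"
  shows "x \<in> W \<Longrightarrow> (f has_derivative frechet_derivative f (at x)) (at x)"
    and "Ck_on k W (\<lambda>x. frechet_derivative f (at x) v)"
  using assms by (auto simp: frechet_derivative_works)

text \<open>On an open set the derivative at a point sees only values inside the set. This is what
  permits replacing \<open>frechet_derivative\<close> by an explicit formula valid on
  \<open>W\<close> alone.\<close>

lemma Ck_on_cong:
  assumes "open W" "\<And>x. x \<in> W \<Longrightarrow> f x = g x" "Ck_on k W f"
  shows "Ck_on k W g"
  using assms(2,3)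
proof (induction k arbitrary: f g)
  case 0
  then show ?case by (simp cong: continuous_on_cong)
next
  case (Suc k)
  have *: "(g has_derivative frechet_derivative f (at x)) (at x)" if "x \<in> W" for x
  proof -
    have "(f has_derivative frechet_derivative f (at x)) (at x)"
      using Suc.prems that by (simp add: frechet_derivative_works)
    then show ?thesis
      by (rule has_derivative_transform_within_open[OF _ assms(1) that]) (use Suc.prems in auto)
  qed
  have eq: "frechet_derivative f (at x) v = frechet_derivative g (at x) v" if "x \<in> W" for x v
    by (rule fun_cong[OF frechet_derivative_at[OF *[OF that]]])
  have "Ck_on k W (\<lambda>x. frechet_derivative g (at x) v)" for v
    by (rule Suc.IH[OF eq Ck_on_SucE(2)[OF Suc.prems(2)]])
  then show ?case using * unfolding Ck_on.simps(2) differentiable_def by blast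
qed

lemma Ck_on_SucI:
  assumes "open W" "\<And>x. x \<in> W \<Longrightarrow> (f has_derivative D x) (at x)" "\<And>v. Ck_on k W (\<lambda>x. D x v)"
  shows "Ck_on (Suc k) W f"
proof -
  have "Ck_on k W (\<lambda>x. frechet_derivative f (at x) v)" for v
    by (rule Ck_on_cong[OF assms(1) _ assms(3)[of v]])
      (metis assms(2) frechet_derivative_at)
  then show ?thesis using assms(2) unfolding Ck_on.simps(2) differentiable_def by blast
qed

lemma Ck_on_const [simp]: "open W \<Longrightarrow> Ck_on k W (\<lambda>x. c)"
proof (induction k arbitrary: c)
  case (Suc k)
  show ?case by (rule Ck_on_SucI[where D = "\<lambda>x v. 0"]) (use Suc in auto)
qed simp

lemma Ck_on_linear:
  assumes "open W" "bounded_linear f"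
  shows "Ck_on k W f"
proof (cases k)
  case 0
  then show ?thesis using assms(2) by (simp add: linear_continuous_on)
next
  case (Suc j)
  show ?thesis unfolding Suc
    by (rule Ck_on_SucI[where D = "\<lambda>x. f"])
      (use assms in \<open>auto intro: bounded_linear_imp_has_derivative\<close>)
qed

lemma Ck_on_add:
  assumes "open W" "Ck_on k W f" "Ck_on k W g"
  shows "Ck_on k W (\<lambda>x. f x + g x)"
  using assms(2,3)
proof (induction k arbitrary: f g)
  case 0
  then show ?case by (auto intro: continuous_intros)
next
  case (Suc k)
  show ?case
    by (rule Ck_on_SucI[OF assms(1) has_derivative_add[OF Ck_on_SucE(1) Ck_on_SucE(1)]])
      (use Suc in \<open>auto\<close>)
qed

text \<open>By the product rule each directional derivative is again a sum of \<open>b\<close>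
  applied to functions of class one lower, so the induction runs over all \<open>f\<close> and
  \<open>g\<close> at once.\<close>

lemma Ck_on_bilinear:
  assumes "bounded_bilinear b" "open W" "Ck_on k W f" "Ck_on k W g"
  shows "Ck_on k W (\<lambda>x. b (f x) (g x))"
  using assms(3,4)
proof (induction k arbitrary: f g)
  case 0
  then show ?case using bounded_bilinear.continuous_on[OF assms(1)] by auto
next
  case (Suc k)
  note f = Ck_on_SucE[OF Suc.prems(1)] Ck_on_SucD[OF Suc.prems(1)]
  note g = Ck_on_SucE[OF Suc.prems(2)] Ck_on_SucD[OF Suc.prems(2)]
  show ?case
    by (rule Ck_on_SucI[OF assms(2) bounded_bilinear.FDERIV[OF assms(1) f(1) g(1)]])
      (auto intro!: Ck_on_add Suc.IH assms(2) f(2,3) g(2,3))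
qed

text \<open>With an outer function of one real variable the chain rule yields a scalar multiple of
  g' composed with f. The bilinear rule then closes the induction, in which \<open>g\<close> varies
  while \<open>f\<close> stays fixed.\<close>

lemma Ck_on_compose_real:
  fixes g :: "real \<Rightarrow> 'b::euclidean_space" and f :: "'a::euclidean_space \<Rightarrow> real"
  assumes "open W" "f ` W \<subseteq> S" "Ck_on k S g" "Ck_on k W f"
  shows "Ck_on k W (\<lambda>x. g (f x))"
  using assms(3,4)
proof (induction k arbitrary: g)
  case 0
  then show ?case using continuous_on_compose2[of S g W f] assms(2) by auto
next
  case (Suc k)
  note g = Ck_on_SucE[OF Suc.prems(1)]
  note f = Ck_on_SucE[OF Suc.prems(2)] Ck_on_SucD[OF Suc.prems(2)]
  have D: "((\<lambda>x. g (f x)) has_derivative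
      (\<lambda>v. frechet_derivative f (at x) v *\<^sub>R frechet_derivative g (at (f x)) 1)) (at x)" if "x \<in> W" for x
  proof -
    have fx: "f x \<in> S" using assms(2) that by auto
    have lin: "linear (frechet_derivative g (at (f x)))"
      using g(1)[OF fx] has_derivative_linear by blast
    have "frechet_derivative g (at (f x)) c = c *\<^sub>R frechet_derivative g (at (f x)) 1" for c
      using linear_scale[OF lin, of c 1] unfolding real_scaleR_def mult_1_right .
    then have eq: "(\<lambda>v. frechet_derivative g (at (f x)) (frechet_derivative f (at x) v)) =
        (\<lambda>v. frechet_derivative f (at x) v *\<^sub>R frechet_derivative g (at (f x)) 1)"
      by (rule ext)
    show ?thesis
      using has_derivative_compose[OF f(1)[OF that] g(1)[OF fx]] unfolding eq .
  qed
  show ?case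
    by (rule Ck_on_SucI[OF assms(1) D])
      (auto intro!: Ck_on_bilinear[OF bounded_bilinear_scaleR] assms(1) f(2,3) Suc.IH g(2))
qed

lemma Ck_on_SucI_real:
  fixes f :: "real \<Rightarrow> real"
  assumes "open W" "\<And>x. x \<in> W \<Longrightarrow> (f has_real_derivative f' x) (at x)" "Ck_on k W f'"
  shows "Ck_on (Suc k) W f"
  by (rule Ck_on_SucI[where D = "\<lambda>x v. f' x * v"])
    (use assms Ck_on_bilinear[OF bounded_bilinear_mult assms(1,3) Ck_on_const[OF assms(1)]]
      in \<open>auto simp: has_field_derivative_def\<close>)

section \<open>Closure properties of smooth maps\<close>

lemma smooth_onD: "smooth_on W f \<Longrightarrow> Ck_on k W f"
  by (simp add: smooth_on_def)

lemma smooth_onI: "(\<And>k. Ck_on k W f) \<Longrightarrow> smooth_on W f"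
  by (simp add: smooth_on_def)

lemma smooth_on_imp_continuous_on: "smooth_on W f \<Longrightarrow> continuous_on W f"
  using smooth_onD[of W f 0] by simp

lemma smooth_on_has_derivative:
  "smooth_on W f \<Longrightarrow> x \<in> W \<Longrightarrow> (f has_derivative frechet_derivative f (at x)) (at x)"
  by (rule Ck_on_SucE(1)[OF smooth_onD[where k = "Suc 0"]])

lemma smooth_on_frechet_derivative:
  "smooth_on W f \<Longrightarrow> smooth_on W (\<lambda>x. frechet_derivative f (at x) v)"
  by (rule smooth_onI, rule Ck_on_SucE(2)[OF smooth_onD])

lemma smooth_on_cong:
  assumes "open W" "\<And>x. x \<in> W \<Longrightarrow> f x = g x" "smooth_on W f"
  shows "smooth_on W g"
  by (rule smooth_onI, rule Ck_on_cong[OF assms(1,2) smooth_onD[OF assms(3)]])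

lemma smooth_on_const: "open W \<Longrightarrow> smooth_on W (\<lambda>x. c)"
  by (simp add: smooth_on_def)

lemma smooth_on_linear: "open W \<Longrightarrow> bounded_linear f \<Longrightarrow> smooth_on W f"
  by (simp add: smooth_on_def Ck_on_linear)

lemma smooth_on_add:
  "open W \<Longrightarrow> smooth_on W f \<Longrightarrow> smooth_on W g \<Longrightarrow> smooth_on W (\<lambda>x. f x + g x)"
  by (simp add: smooth_on_def Ck_on_add)

lemma smooth_on_bilinear:
  "bounded_bilinear b \<Longrightarrow> open W \<Longrightarrow> smooth_on W f \<Longrightarrow> smooth_on W g \<Longrightarrow>
    smooth_on W (\<lambda>x. b (f x) (g x))"
  by (simp add: smooth_on_def Ck_on_bilinear)

lemma smooth_on_compose_real:
  fixes g :: "real \<Rightarrow> 'b::euclidean_space" and f :: "'a::euclidean_space \<Rightarrow> real"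
  shows "open W \<Longrightarrow> f ` W \<subseteq> S \<Longrightarrow> smooth_on S g \<Longrightarrow> smooth_on W f \<Longrightarrow>
    smooth_on W (\<lambda>x. g (f x))"
  by (rule smooth_onI, rule Ck_on_compose_real) (assumption | erule smooth_onD)+

text \<open>The derivative is a polynomial in the function itself, so each class gives the next. The
  square root below is treated alike, its derivative being half the inverse of the root.\<close>

lemma smooth_on_inverse: "smooth_on (- {0::real}) inverse"
proof (rule smooth_onI)
  fix k
  show "Ck_on k (- {0::real}) inverse"
  proof (induction k)
    case 0
    show ?case unfolding Ck_on.simps(1)
      by (rule continuous_on_inverse[OF continuous_on_id]) simp
  next
    case (Suc k)
    have op: "open (- {0::real})" by auto
    have "Ck_on k (- {0::real}) (\<lambda>x. (inverse x * inverse x) * - 1)"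
      by (intro Ck_on_bilinear[OF bounded_bilinear_mult op] Suc Ck_on_const[OF op])
    moreover have "(inverse has_real_derivative (inverse x * inverse x) * - 1) (at x)"
      if "x \<in> - {0}" for x :: real
      using DERIV_inverse[of x UNIV] that by (simp add: numeral_2_eq_2)
    ultimately show ?case
      by (intro Ck_on_SucI_real[OF op])
  qed
qed

lemma smooth_on_sqrt: "smooth_on {0<..} sqrt"
proof (rule smooth_onI)
  fix k
  show "Ck_on k {0<..} sqrt"
  proof (induction k)
    case 0
    show ?case unfolding Ck_on.simps(1) by (rule continuous_on_real_sqrt[OF continuous_on_id])
  next
    case (Suc k)
    have op: "open {0::real<..}" by auto
    have "Ck_on k {0<..} (\<lambda>x. inverse (sqrt x))"
      by (rule Ck_on_compose_real[OF op _ smooth_onD[OF smooth_on_inverse] Suc]) auto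
    then have "Ck_on k {0<..} (\<lambda>x. inverse (sqrt x) * (1 / 2))"
      by (rule Ck_on_bilinear[OF bounded_bilinear_mult op _ Ck_on_const[OF op]])
    then show ?case
      by (rule Ck_on_SucI_real[OF op, rotated]) (use DERIV_real_sqrt in auto)
  qed
qed

lemmas smooth_on_mult = smooth_on_bilinear[OF bounded_bilinear_mult]

lemma smooth_on_divide:
  fixes f g :: "'a::euclidean_space \<Rightarrow> real"
  assumes "open W" "smooth_on W f" "smooth_on W g" "\<And>x. x \<in> W \<Longrightarrow> g x \<noteq> 0"
  shows "smooth_on W (\<lambda>x. f x / g x)"
  unfolding divide_inverse
  by (intro smooth_on_mult smooth_on_compose_real[OF _ _ smooth_on_inverse] assms)
    (use assms(4) in auto)

section \<open>Quaternions\<close>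

lemma bounded_bilinear_qmul: "bounded_bilinear (\<odot>)"
proof (rule bilinear_conv_bounded_bilinear[THEN iffD1])
  show "bilinear (\<odot>)"
    unfolding bilinear_def
    by (auto intro!: linearI simp: qmul_def vec_eq_iff forall_3 cross3_simps)
qed

interpretation qmul: bounded_bilinear "(\<odot>)"
  by (rule bounded_bilinear_qmul)

lemma bounded_linear_qcnj: "bounded_linear qcnj"
  unfolding linear_conv_bounded_linear[symmetric] by (rule linearI) (simp_all add: qcnj_def)

lemma qcnj_add: "qcnj (a + b) = qcnj a + qcnj b"
  and qcnj_diff: "qcnj (a - b) = qcnj a - qcnj b"
  and qcnj_minus: "qcnj (- a) = - qcnj a"
  and qcnj_scaleR: "qcnj (s *\<^sub>R a) = s *\<^sub>R qcnj a"
  by (simp_all add: qcnj_def prod_eq_iff)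

lemma norm_qcnj [simp]: "norm (qcnj a) = norm a"
  by (simp add: qcnj_def norm_prod_def)

lemma SU2_iff: "a \<in> SU2 \<longleftrightarrow> norm a = 1"
  by (simp add: SU2_def)

lemma qcnj_self: "qcnj a \<odot> a = ((norm a)\<^sup>2, 0)" "a \<odot> qcnj a = ((norm a)\<^sup>2, 0)"
  by (simp_all add: qmul_def qcnj_def power2_norm_eq_inner inner_prod_def
      cross_minus_left cross_minus_right cross_refl)

lemma fst_qcnj_qmul: "fst (qcnj a \<odot> b) = a \<bullet> b"
  by (simp add: qcnj_def qmul_def inner_prod_def)

lemma qmul_real: "(s, 0) \<odot> a = s *\<^sub>R a" "a \<odot> (s, 0) = s *\<^sub>R a"
  by (simp_all add: qmul_def prod_eq_iff cross_zero_left cross_zero_right)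

text \<open>The inner product is the real part of \<open>qcnj a \<odot> b\<close>, and the factor
  \<open>qcnj c \<odot> c\<close> that appears in the middle is a real scalar.\<close>

lemma inner_qmul_left: "(c \<odot> a) \<bullet> (c \<odot> b) = (norm c)\<^sup>2 * (a \<bullet> b)"
proof -
  have "(c \<odot> a) \<bullet> (c \<odot> b) = fst (qcnj a \<odot> (qcnj c \<odot> c) \<odot> b)"
    by (simp add: fst_qcnj_qmul[symmetric] qcnj_qmul qmul_assoc)
  also have "\<dots> = (norm c)\<^sup>2 * (a \<bullet> b)"
    by (simp add: qcnj_self qmul_real qmul.scaleR_left fst_qcnj_qmul)
  finally show ?thesis .
qed

lemma norm_qmul: "norm (a \<odot> b) = norm a * norm b"
proof (rule power2_eq_imp_eq)
  show "(norm (a \<odot> b))\<^sup>2 = (norm a * norm b)\<^sup>2"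
    unfolding power2_norm_eq_inner inner_qmul_left power_mult_distrib ..
qed simp_all

lemma inner_qcnj: "qcnj a \<bullet> qcnj b = a \<bullet> b"
  by (cases a; cases b) (simp add: qcnj_def inner_prod_def)

lemma inner_qmul_right: "(a \<odot> c) \<bullet> (b \<odot> c) = (norm c)\<^sup>2 * (a \<bullet> b)"
  using inner_qmul_left[of "qcnj c" "qcnj a" "qcnj b"] by (simp add: inner_qcnj flip: qcnj_qmul)

lemma fst_conj: "fst (qcnj c \<odot> a \<odot> c) = (norm c)\<^sup>2 * fst a"
proof -
  have "fst (qcnj c \<odot> a \<odot> c) = c \<bullet> (a \<odot> c)"
    by (simp add: qmul_assoc fst_qcnj_qmul)
  also have "\<dots> = ((1,0) \<odot> c) \<bullet> (a \<odot> c)" by simp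
  also have "\<dots> = (norm c)\<^sup>2 * ((1,0) \<bullet> a)" by (rule inner_qmul_right)
  finally show ?thesis by (simp add: inner_prod_def)
qed

text \<open>Conjugation keeps the real part of \<open>a\<close> real, so it does not contribute.
  Hence \<open>Ad\<close> can be computed from a full quaternion product without first showing that
  the product is imaginary.\<close>

lemma Ad_snd: "Ad h (snd a) = snd (h \<odot> a \<odot> qcnj h)"
proof -
  have "a = (fst a, 0) + imq (snd a)" by (simp add: imq_def prod_eq_iff)
  then have "h \<odot> a \<odot> qcnj h = h \<odot> (fst a, 0) \<odot> qcnj h + h \<odot> imq (snd a) \<odot> qcnj h"
    by (metis qmul.add_left qmul.add_right)
  also have "h \<odot> (fst a, 0) \<odot> qcnj h = (fst a * (norm h)\<^sup>2, 0)"
    by (simp add: qmul_real qmul.scaleR_left qcnj_self)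
  finally show ?thesis by (simp add: Ad_def)
qed

lemma Ad_qmul: "Ad (h \<odot> k) \<xi> = Ad h (Ad k \<xi>)"
  unfolding Ad_def[of k] Ad_snd unfolding Ad_def by (simp add: qcnj_qmul qmul_assoc)

lemma linear_Ad: "linear (Ad h)"
  by (rule linearI) (simp_all add: Ad_def imq_def qmul_def vec_eq_iff forall_3 cross3_simps qcnj_def)

lemma Ad_one [simp]: "Ad (1, 0) \<xi> = \<xi>"
  by (simp add: Ad_def imq_def qcnj_def)

lemma Ad_inverse:
  assumes "h \<in> SU2"
  shows "Ad (qcnj h) (Ad h \<xi>) = \<xi>" "Ad h (Ad (qcnj h) \<xi>) = \<xi>"
  using assms by (simp_all add: SU2_cancel flip: Ad_qmul)

lemma imq_Ad: "imq (Ad h \<xi>) = h \<odot> imq \<xi> \<odot> qcnj h"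
proof -
  have "fst (h \<odot> imq \<xi> \<odot> qcnj h) = 0"
    using fst_conj[of "qcnj h" "imq \<xi>"] by (simp add: imq_def)
  then show ?thesis by (simp add: Ad_def imq_def prod_eq_iff)
qed

lemma snd_imq_qmul: "snd (imq \<xi> \<odot> imq \<zeta>) = cross3 \<xi> \<zeta>" "fst (imq \<xi> \<odot> imq \<zeta>) = - (\<xi> \<bullet> \<zeta>)"
  by (simp_all add: imq_def qmul_def)

text \<open>Cross product and inner product are the imaginary part and minus the real part of one
  product of imaginary quaternions, and conjugation by a unit quaternion is an algebra
  automorphism.\<close>

lemma
  assumes "h \<in> SU2"
  shows Ad_cross3: "Ad h (cross3 \<xi> \<zeta>) = cross3 (Ad h \<xi>) (Ad h \<zeta>)"
    and Ad_inner: "Ad h \<xi> \<bullet> Ad h \<zeta> = \<xi> \<bullet> \<zeta>"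
proof -
  have *: "imq (Ad h \<xi>) \<odot> imq (Ad h \<zeta>) = h \<odot> (imq \<xi> \<odot> imq \<zeta>) \<odot> qcnj h"
  proof -
    have "imq (Ad h \<xi>) \<odot> imq (Ad h \<zeta>) = h \<odot> imq \<xi> \<odot> ((qcnj h \<odot> h) \<odot> (imq \<zeta> \<odot> qcnj h))"
      by (simp add: imq_Ad qmul_assoc)
    then show ?thesis by (simp add: SU2_cancel[OF assms] qmul_assoc)
  qed
  show "Ad h (cross3 \<xi> \<zeta>) = cross3 (Ad h \<xi>) (Ad h \<zeta>)"
    unfolding snd_imq_qmul[symmetric] * by (rule Ad_snd)
  have "fst (h \<odot> (imq \<xi> \<odot> imq \<zeta>) \<odot> qcnj h) = fst (imq \<xi> \<odot> imq \<zeta>)"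
    using fst_conj[of "qcnj h" "imq \<xi> \<odot> imq \<zeta>"] assms by (simp add: SU2_iff)
  then show "Ad h \<xi> \<bullet> Ad h \<zeta> = \<xi> \<bullet> \<zeta>"
    unfolding *[symmetric] by (simp add: snd_imq_qmul)
qed

lemma lie_eq_cross3: "lie \<xi> \<zeta> = 2 *\<^sub>R cross3 \<xi> \<zeta>"
  by (simp add: lie_def snd_imq_qmul cross_skew[of \<zeta> \<xi>] scaleR_2)

lemma snd_qcnj_qmul_swap: "snd (qcnj a \<odot> b) = - snd (qcnj b \<odot> a)"
  by (simp add: qcnj_def qmul_def cross_minus_left cross_skew[of "snd a" "snd b"])

text \<open>The imaginary part of the quotient c^-1 w, which is the pull-back of \<open>mc\<close>
  along c/|c| (see \<open>mcn_normalize\<close>). Being defined on all nonzero quaternions, it can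
  be differentiated in the ambient vector space.\<close>

definition mcn :: "quat \<Rightarrow> quat \<Rightarrow> real^3" where
  "mcn c w = snd (qcnj c \<odot> w) /\<^sub>R (norm c)\<^sup>2"

section \<open>Maurer--Cartan forms on the total space and the curvature\<close>

lemma mcn_eq_mc: "g \<in> SU2 \<Longrightarrow> mcn g v = mc g v"
  by (simp add: mcn_def mc_def SU2_iff)

lemma mcn_add: "mcn c (v + w) = mcn c v + mcn c w"
  and mcn_diff: "mcn c (v - w) = mcn c v - mcn c w"
  and mcn_minus: "mcn c (- v) = - mcn c v"
  and mcn_scaleR: "mcn c (s *\<^sub>R v) = s *\<^sub>R mcn c v"
  and mcn_zero [simp]: "mcn c 0 = 0"
  by (simp_all add: mcn_def qmul.add_right qmul.diff_right qmul.minus_right qmul.scaleR_right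
      qmul.zero_right scaleR_add_right scaleR_diff_right)

lemma mcn_self [simp]: "mcn c c = 0"
  by (simp add: mcn_def qcnj_self)

lemma mcn_homogeneous: "s \<noteq> 0 \<Longrightarrow> mcn (s *\<^sub>R c) w = mcn c w /\<^sub>R s"
  by (simp add: mcn_def qcnj_scaleR qmul.scaleR_left power_mult_distrib)
    (simp add: power2_eq_square field_simps)

lemma mcn_fundamental: "c \<noteq> 0 \<Longrightarrow> mcn c (c \<odot> imq \<xi>) = \<xi>"
  by (simp add: mcn_def qmul_assoc[symmetric] qcnj_self qmul_real) (simp add: imq_def)

lemma mcn_qmul_left: "h \<in> SU2 \<Longrightarrow> mcn (h \<odot> c) (h \<odot> w) = mcn c w"
proof -
  assume h: "h \<in> SU2"
  have "qcnj (h \<odot> c) \<odot> (h \<odot> w) = qcnj c \<odot> ((qcnj h \<odot> h) \<odot> w)"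
    by (simp add: qcnj_qmul qmul_assoc)
  then show ?thesis using h by (simp add: mcn_def norm_qmul SU2_iff qcnj_self)
qed

lemma mcn_qmul_right: "mcn (c \<odot> d) (w \<odot> d) = Ad (qcnj d) (mcn c w) /\<^sub>R (norm d)\<^sup>2"
proof -
  have "qcnj (c \<odot> d) \<odot> (w \<odot> d) = qcnj d \<odot> (qcnj c \<odot> w) \<odot> qcnj (qcnj d)"
    by (simp add: qcnj_qmul qmul_assoc)
  then show ?thesis
    by (simp add: mcn_def norm_qmul linear_scale[OF linear_Ad] power_mult_distrib Ad_snd mult.commute)
qed

lemma mcn_qmul_cancel: "c \<noteq> 0 \<Longrightarrow> mcn (c \<odot> d) (c \<odot> w) = mcn d w"
proof -
  assume c: "c \<noteq> 0"
  have "qcnj (c \<odot> d) \<odot> (c \<odot> w) = qcnj d \<odot> ((qcnj c \<odot> c) \<odot> w)"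
    by (simp add: qcnj_qmul qmul_assoc)
  then show ?thesis
    using c by (simp add: mcn_def norm_qmul qcnj_self qmul_real qmul.scaleR_right power_mult_distrib)
qed

lemma snd_qcnj_qmul:
  "snd (qcnj x \<odot> y) = fst x *\<^sub>R snd y - fst y *\<^sub>R snd x - cross3 (snd x) (snd y)"
  by (simp add: qcnj_def qmul_def cross_minus_left)

text \<open>The left side is the antisymmetrised derivative of \<open>mcn c\<close> in the
  directions \<open>x\<close> and \<open>y\<close>. Inserting \<open>c \<odot> qcnj c\<close>
  between \<open>qcnj x\<close> and \<open>y\<close> expresses it through the two quotients; the
  terms with real parts cancel against the derivative of |c|^-2, and the cross product is
  left.\<close>

lemma mcn_antisym:
  assumes "c \<noteq> 0"
  shows "(2 / (norm c)\<^sup>2) *\<^sub>R snd (qcnj x \<odot> y)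
       - (2 * (c \<bullet> x) / (norm c)\<^sup>2) *\<^sub>R mcn c y + (2 * (c \<bullet> y) / (norm c)\<^sup>2) *\<^sub>R mcn c x
     = - lie (mcn c x) (mcn c y)"
proof -
  define n where "n = (norm c)\<^sup>2"
  have n: "n \<noteq> 0" using assms by (simp add: n_def)
  have "qcnj (qcnj c \<odot> x) \<odot> (qcnj c \<odot> y) = n *\<^sub>R (qcnj x \<odot> y)"
  proof -
    have "qcnj (qcnj c \<odot> x) \<odot> (qcnj c \<odot> y) = qcnj x \<odot> ((c \<odot> qcnj c) \<odot> y)"
      by (simp add: qcnj_qmul qmul_assoc)
    then show ?thesis by (simp add: qcnj_self qmul_real qmul.scaleR_right n_def)
  qed
  then have "snd (qcnj x \<odot> y) = snd (qcnj (qcnj c \<odot> x) \<odot> (qcnj c \<odot> y)) /\<^sub>R n"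
    using n by simp
  also have "\<dots> = ((c \<bullet> x) *\<^sub>R snd (qcnj c \<odot> y) - (c \<bullet> y) *\<^sub>R snd (qcnj c \<odot> x)
      - cross3 (snd (qcnj c \<odot> x)) (snd (qcnj c \<odot> y))) /\<^sub>R n"
    by (simp only: snd_qcnj_qmul[of "qcnj c \<odot> x"] fst_qcnj_qmul)
  finally have *: "snd (qcnj x \<odot> y) = \<dots>" .
  show ?thesis
    using n unfolding * mcn_def n_def[symmetric] lie_eq_cross3 cross_mult_left cross_mult_right
    by (simp add: scaleR_diff_right scaleR_add_right divide_inverse mult_ac algebra_simps)
qed

lemma mcn_has_derivative:
  fixes c :: "'a::real_normed_vector \<Rightarrow> quat"
  assumes "(c has_derivative c') (at z)" "(w has_derivative w') (at z)" "c z \<noteq> 0"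
  shows "((\<lambda>y. mcn (c y) (w y)) has_derivative
    (\<lambda>h. (1 / (norm (c z))\<^sup>2) *\<^sub>R snd (qcnj (c' h) \<odot> w z) + mcn (c z) (w' h)
        - (2 * (c z \<bullet> c' h) / (norm (c z))\<^sup>2) *\<^sub>R mcn (c z) (w z))) (at z)"
proof -
  have num: "((\<lambda>y. snd (qcnj (c y) \<odot> w y)) has_derivative
      (\<lambda>h. snd (qcnj (c z) \<odot> w' h + qcnj (c' h) \<odot> w z))) (at z)"
    by (intro has_derivative_snd qmul.FDERIV bounded_linear.has_derivative[OF bounded_linear_qcnj] assms)
  have den: "((\<lambda>y. inverse (c y \<bullet> c y)) has_derivative
      (\<lambda>h. - (inverse (c z \<bullet> c z) * (c z \<bullet> c' h + c' h \<bullet> c z) * inverse (c z \<bullet> c z)))) (at z)"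
    using assms(3) by (intro Deriv.has_derivative_inverse has_derivative_inner assms) auto
  have eq: "(\<lambda>y. mcn (c y) (w y)) = (\<lambda>y. inverse (c y \<bullet> c y) *\<^sub>R snd (qcnj (c y) \<odot> w y))"
    by (simp add: mcn_def power2_norm_eq_inner)
  show ?thesis unfolding eq
    by (rule has_derivative_eq_rhs[OF has_derivative_scaleR[OF den num]])
      (use assms(3) in \<open>simp add: fun_eq_iff mcn_def power2_norm_eq_inner inner_commute
        scaleR_add_right divide_inverse mult_ac\<close>)
qed

text \<open>The Maurer--Cartan equation pulled back along an arbitrary map \<open>c\<close>. Here
  \<open>w v\<close> plays the part of the derivative of \<open>c\<close> in direction
  \<open>v\<close> near \<open>z\<close>; the condition on \<open>w'\<close> is the symmetry of the
  second derivative, whose contribution drops out on antisymmetrising.\<close>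

lemma mcn_maurer_cartan:
  fixes c :: "'a::real_normed_vector \<Rightarrow> quat"
  assumes "(c has_derivative c') (at z)" "c z \<noteq> 0"
    and "\<And>v. (w v has_derivative w' v) (at z)" "\<And>v. w v z = c' v" "\<And>u v. w' v u = w' u v"
  shows "\<exists>D. (\<forall>v. ((\<lambda>y. mcn (c y) (w v y)) has_derivative D v) (at z)) \<and>
    (\<forall>u v. D v u - D u v = - lie (mcn (c z) (c' u)) (mcn (c z) (c' v)))"
proof (intro exI conjI allI)
  fix v
  show "((\<lambda>y. mcn (c y) (w v y)) has_derivative
    (\<lambda>h. (1 / (norm (c z))\<^sup>2) *\<^sub>R snd (qcnj (c' h) \<odot> w v z) + mcn (c z) (w' v h)
        - (2 * (c z \<bullet> c' h) / (norm (c z))\<^sup>2) *\<^sub>R mcn (c z) (w v z))) (at z)"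
    by (rule mcn_has_derivative[OF assms(1) assms(3) assms(2)])
next
  fix u v
  show "(1 / (norm (c z))\<^sup>2) *\<^sub>R snd (qcnj (c' u) \<odot> w v z) + mcn (c z) (w' v u)
        - (2 * (c z \<bullet> c' u) / (norm (c z))\<^sup>2) *\<^sub>R mcn (c z) (w v z)
     - ((1 / (norm (c z))\<^sup>2) *\<^sub>R snd (qcnj (c' v) \<odot> w u z) + mcn (c z) (w' u v)
        - (2 * (c z \<bullet> c' v) / (norm (c z))\<^sup>2) *\<^sub>R mcn (c z) (w u z))
     = - lie (mcn (c z) (c' u)) (mcn (c z) (c' v))"
    unfolding mcn_antisym[OF assms(2), symmetric] assms(4) assms(5)[of v u]
      snd_qcnj_qmul_swap[of "c' v" "c' u"]
    by (simp add: vec_eq_iff)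
qed

section \<open>The invariant frame on the total space\<close>

definition mu1 :: "tot \<Rightarrow> tot \<Rightarrow> real^3" where
  "mu1 = (\<lambda>(p, a1, a2) (v, w1, w2). mcn a1 w1)"

definition mu2 :: "tot \<Rightarrow> tot \<Rightarrow> real^3" where
  "mu2 = (\<lambda>(p, a1, a2) (v, w1, w2). mcn a2 w2)"

definition mu3 :: "tot \<Rightarrow> tot \<Rightarrow> real^3" where
  "mu3 = (\<lambda>(p, a1, a2) (v, w1, w2). mcn (qcnj p \<odot> a1) (qcnj p \<odot> w1 + qcnj v \<odot> a1))"

definition frP :: "tot \<Rightarrow> tot \<Rightarrow> real^3" where
  "frP z v = (1 / 2) *\<^sub>R (mu1 z v + mu2 z v) - mu3 z v"

definition frN :: "tot \<Rightarrow> tot \<Rightarrow> real^3" where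
  "frN z v = (1 / 2) *\<^sub>R (mu1 z v - mu2 z v)"

definition frt :: "tot \<Rightarrow> tot \<Rightarrow> real" where
  "frt z v = (fst z \<bullet> fst v) / norm (fst z)"

lemma qmul_eq_0_iff: "a \<odot> b = 0 \<longleftrightarrow> a = 0 \<or> b = 0"
  by (metis norm_eq_zero norm_qmul mult_eq_0_iff)

lemma qcnj_eq_0_iff: "qcnj a = 0 \<longleftrightarrow> a = 0"
  by (metis norm_eq_zero norm_qcnj)

lemma bounded_bilinear_lie: "bounded_bilinear lie"
proof (rule bilinear_conv_bounded_bilinear[THEN iffD1])
  show "bilinear lie"
    unfolding bilinear_def lie_eq_cross3
    by (auto intro!: linearI simp: cross_add_left cross_add_right cross_mult_left cross_mult_right
        scaleR_add_right)
qed

interpretation lie: bounded_bilinear lie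
  by (rule bounded_bilinear_lie)

lemma mu1_maurer_cartan:
  assumes "fst (snd z) \<noteq> 0"
  shows "\<exists>D. (\<forall>v. ((\<lambda>y. mu1 y v) has_derivative D v) (at z)) \<and>
    (\<forall>u v. D v u - D u v = - lie (mu1 z u) (mu1 z v))"
proof -
  have "\<exists>D. (\<forall>v. ((\<lambda>y. mcn (fst (snd y)) (fst (snd v))) has_derivative D v) (at z)) \<and>
    (\<forall>u v. D v u - D u v = - lie (mcn (fst (snd z)) (fst (snd u))) (mcn (fst (snd z)) (fst (snd v))))"
    by (rule mcn_maurer_cartan[where w = "\<lambda>v y. fst (snd v)" and w' = "\<lambda>v u. 0"])
      (auto intro!: derivative_eq_intros assms)
  then show ?thesis by (simp add: mu1_def case_prod_unfold)
qed

lemma mu2_maurer_cartan: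
  assumes "snd (snd z) \<noteq> 0"
  shows "\<exists>D. (\<forall>v. ((\<lambda>y. mu2 y v) has_derivative D v) (at z)) \<and>
    (\<forall>u v. D v u - D u v = - lie (mu2 z u) (mu2 z v))"
proof -
  have "\<exists>D. (\<forall>v. ((\<lambda>y. mcn (snd (snd y)) (snd (snd v))) has_derivative D v) (at z)) \<and>
    (\<forall>u v. D v u - D u v = - lie (mcn (snd (snd z)) (snd (snd u))) (mcn (snd (snd z)) (snd (snd v))))"
    by (rule mcn_maurer_cartan[where w = "\<lambda>v y. snd (snd v)" and w' = "\<lambda>v u. 0"])
      (auto intro!: derivative_eq_intros assms)
  then show ?thesis by (simp add: mu2_def case_prod_unfold)
qed

lemmas has_derivative_qcnj = bounded_linear.has_derivative[OF bounded_linear_qcnj]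

lemma mu3_maurer_cartan:
  assumes "fst z \<noteq> 0" "fst (snd z) \<noteq> 0"
  shows "\<exists>D. (\<forall>v. ((\<lambda>y. mu3 y v) has_derivative D v) (at z)) \<and>
    (\<forall>u v. D v u - D u v = - lie (mu3 z u) (mu3 z v))"
proof -
  define c' :: "tot \<Rightarrow> tot \<Rightarrow> quat"
    where "c' y v = qcnj (fst y) \<odot> fst (snd v) + qcnj (fst v) \<odot> fst (snd y)" for y v
  have "\<exists>D. (\<forall>v. ((\<lambda>y. mcn (qcnj (fst y) \<odot> fst (snd y)) (c' y v)) has_derivative D v) (at z)) \<and>
    (\<forall>u v. D v u - D u v = - lie (mcn (qcnj (fst z) \<odot> fst (snd z)) (c' z u))
       (mcn (qcnj (fst z) \<odot> fst (snd z)) (c' z v)))"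
  \<comment> \<open>The map is bilinear in \<open>p\<close> and \<open>a1\<close>, so its second
    derivative is constant and visibly symmetric in \<open>u\<close> and \<open>v\<close>.\<close>
  proof (rule mcn_maurer_cartan[where w = "\<lambda>v y. c' y v"
        and w' = "\<lambda>v u. qcnj (fst u) \<odot> fst (snd v) + qcnj (fst v) \<odot> fst (snd u)"])
    show "((\<lambda>y. qcnj (fst y) \<odot> fst (snd y)) has_derivative c' z) (at z)"
      unfolding c'_def
      by (intro qmul.FDERIV has_derivative_qcnj has_derivative_fst has_derivative_snd has_derivative_ident)
    show "((\<lambda>y. c' y v) has_derivative (\<lambda>u. qcnj (fst u) \<odot> fst (snd v) + qcnj (fst v) \<odot> fst (snd u))) (at z)" for v
      unfolding c'_def
      by (intro has_derivative_add
          bounded_linear.has_derivative[OF qmul.bounded_linear_left] bounded_linear.has_derivative[OF qmul.bounded_linear_right]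
          has_derivative_qcnj has_derivative_fst has_derivative_snd has_derivative_ident)
  qed (auto simp: assms qmul_eq_0_iff qcnj_eq_0_iff)
  then show ?thesis by (simp add: mu3_def c'_def case_prod_unfold)
qed

text \<open>Since \<open>frP\<close> and \<open>frN\<close> vanish on fundamental fields and
  \<open>mu3\<close> reproduces them, this has the form of a connection for any \<open>a\<close>,
  \<open>b\<close>; on the canonical section \<open>mu3\<close> drops out (see
  \<open>gen_sec\<close>).\<close>

definition gen :: "(real \<Rightarrow> real) \<Rightarrow> (real \<Rightarrow> real) \<Rightarrow> tot \<Rightarrow> tot \<Rightarrow> real^3" where
  "gen a b z v = a (norm (fst z)) *\<^sub>R frP z v + b (norm (fst z)) *\<^sub>R frN z v + mu3 z v"

text \<open>All brackets with \<open>m3u\<close> or \<open>m3v\<close> cancel, because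
  \<open>mu3\<close> is flat. What remains involves only \<open>P\<close> and \<open>N\<close>,
  hence is horizontal.\<close>

lemma curvature_algebra:
  fixes a b :: real
  assumes "m1u = Pu + Nu + m3u" "m2u = Pu - Nu + m3u" "m1v = Pv + Nv + m3v" "m2v = Pv - Nv + m3v"
  shows "a *\<^sub>R ((1 / 2) *\<^sub>R (- lie m1u m1v - lie m2u m2v) + lie m3u m3v)
    + b *\<^sub>R ((1 / 2) *\<^sub>R (- lie m1u m1v + lie m2u m2v)) - lie m3u m3v
    + lie (a *\<^sub>R Pu + b *\<^sub>R Nu + m3u) (a *\<^sub>R Pv + b *\<^sub>R Nv + m3v)
    = (a\<^sup>2 - a) *\<^sub>R lie Pu Pv + (b\<^sup>2 - a) *\<^sub>R lie Nu Nv + (a * b - b) *\<^sub>R (lie Pu Nv + lie Nu Pv)"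
proof -
  have 1: "(1 / 2) *\<^sub>R (- lie m1u m1v - lie m2u m2v) = - lie (Pu + m3u) (Pv + m3v) - lie Nu Nv"
    unfolding assms lie.add_left lie.add_right lie.diff_left lie.diff_right
    by (simp add: algebra_simps flip: scaleR_2) (simp add: vec_eq_iff)
  have 2: "(1 / 2) *\<^sub>R (- lie m1u m1v + lie m2u m2v) = - lie (Pu + m3u) Nv - lie Nu (Pv + m3v)"
    unfolding assms lie.add_left lie.add_right lie.diff_left lie.diff_right
    by (simp add: algebra_simps flip: scaleR_2) (simp add: vec_eq_iff)
  show ?thesis unfolding 1 2 lie.add_left lie.add_right lie.scaleR_left lie.scaleR_right
    by (simp add: vec_eq_iff power2_eq_square algebra_simps)
qed

text \<open>Kept abstract in \<open>e\<close>, \<open>P\<close>, \<open>N\<close>, so that a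
  rotation of su(2) can later be applied to \<open>P\<close> and \<open>N\<close>
  simultaneously.\<close>

definition frame_curvature :: "real \<Rightarrow> real \<Rightarrow> real \<Rightarrow> real \<Rightarrow> ('v \<Rightarrow> real) \<Rightarrow> ('v \<Rightarrow> real^3) \<Rightarrow> ('v \<Rightarrow> real^3) \<Rightarrow> 'v \<Rightarrow> 'v \<Rightarrow> real^3" where
  "frame_curvature a a' b b' e P N u v =
     a' *\<^sub>R (e u *\<^sub>R P v - e v *\<^sub>R P u) + b' *\<^sub>R (e u *\<^sub>R N v - e v *\<^sub>R N u)
     + (a\<^sup>2 - a) *\<^sub>R lie (P u) (P v) + (b\<^sup>2 - a) *\<^sub>R lie (N u) (N v)
     + (a * b - b) *\<^sub>R (lie (P u) (N v) + lie (N u) (P v))"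

text \<open>The exterior derivative differentiates \<open>ext A\<close> in ambient directions, hence
  the agreement with \<open>gen\<close> on an open set; the bracket term uses \<open>A\<close>
  itself at \<open>z\<close>, hence the two equations for \<open>u\<close> and
  \<open>v\<close>.\<close>

lemma curvature_gen:
  assumes "open W" "z \<in> W" "\<And>y v. y \<in> W \<Longrightarrow> ext A y v = gen a b y v"
    and A: "A z u = ext A z u" "A z v = ext A z v"
    and nz: "fst z \<noteq> 0" "fst (snd z) \<noteq> 0" "snd (snd z) \<noteq> 0"
    and a: "(a has_real_derivative a') (at (norm (fst z)))"
    and b: "(b has_real_derivative b') (at (norm (fst z)))"
  shows "curvature A z [u, v] = frame_curvature (a (norm (fst z))) a' (b (norm (fst z))) b' (frt z) (frP z) (frN z) u v"
proof -
  obtain D1 where D1: "\<And>v. ((\<lambda>y. mu1 y v) has_derivative D1 v) (at z)"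
    and d1: "\<And>u v. D1 v u - D1 u v = - lie (mu1 z u) (mu1 z v)"
    using mu1_maurer_cartan[OF nz(2)] by metis
  obtain D2 where D2: "\<And>v. ((\<lambda>y. mu2 y v) has_derivative D2 v) (at z)"
    and d2: "\<And>u v. D2 v u - D2 u v = - lie (mu2 z u) (mu2 z v)"
    using mu2_maurer_cartan[OF nz(3)] by metis
  obtain D3 where D3: "\<And>v. ((\<lambda>y. mu3 y v) has_derivative D3 v) (at z)"
    and d3: "\<And>u v. D3 v u - D3 u v = - lie (mu3 z u) (mu3 z v)"
    using mu3_maurer_cartan[OF nz(1,2)] by metis
  let ?t = "norm (fst z)"
  have t: "((\<lambda>y. norm (fst y)) has_derivative frt z) (at z)"
    by (rule has_derivative_eq_rhs[OF has_derivative_compose[OF has_derivative_fst[OF has_derivative_ident]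
          has_derivative_norm]])
      (use nz in \<open>auto simp: frt_def fun_eq_iff sgn_div_norm inner_commute divide_inverse\<close>)
  have a_t: "((\<lambda>y. a (norm (fst y))) has_derivative (\<lambda>h. a' * frt z h)) (at z)"
    using has_derivative_compose[OF t a[unfolded has_field_derivative_def]] .
  have b_t: "((\<lambda>y. b (norm (fst y))) has_derivative (\<lambda>h. b' * frt z h)) (at z)"
    using has_derivative_compose[OF t b[unfolded has_field_derivative_def]] .
  define G where "G v h = (a ?t *\<^sub>R ((1 / 2) *\<^sub>R (D1 v h + D2 v h) - D3 v h) + (a' * frt z h) *\<^sub>R frP z v)
      + (b ?t *\<^sub>R ((1 / 2) *\<^sub>R (D1 v h - D2 v h)) + (b' * frt z h) *\<^sub>R frN z v) + D3 v h" for v h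
  have gen: "(gen' has_derivative G v) (at z)" if "gen' = (\<lambda>y. gen a b y v)" for v gen'
    unfolding that gen_def G_def unfolding frP_def[abs_def] frN_def[abs_def]
    by (intro has_derivative_add has_derivative_diff has_derivative_scaleR a_t b_t
        bounded_linear.has_derivative[OF bounded_linear_scaleR_right] D1 D2 D3)
  have fd: "frechet_derivative (\<lambda>y. ext A y v) (at z) = G v" for v
    by (rule frechet_derivative_at[symmetric, OF has_derivative_transform_within_open[OF gen[OF refl] assms(1,2)]])
      (simp add: assms(3))
  have A': "A z u = a ?t *\<^sub>R frP z u + b ?t *\<^sub>R frN z u + mu3 z u"
    "A z v = a ?t *\<^sub>R frP z v + b ?t *\<^sub>R frN z v + mu3 z v"
    by (simp_all add: A assms(2,3) gen_def)
  have m1: "mu1 z w = frP z w + frN z w + mu3 z w" and m2: "mu2 z w = frP z w - frN z w + mu3 z w" for w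
    by (simp_all add: frP_def frN_def vec_eq_iff field_simps)
  \<comment> \<open>Regrouped so that \<open>D1\<close>, \<open>D2\<close>, \<open>D3\<close> enter
    only through their antisymmetrisations, where the Maurer--Cartan equations apply.\<close>
  have e: "G v u - G u v = a' *\<^sub>R (frt z u *\<^sub>R frP z v - frt z v *\<^sub>R frP z u)
     + b' *\<^sub>R (frt z u *\<^sub>R frN z v - frt z v *\<^sub>R frN z u)
     + (a ?t *\<^sub>R ((1 / 2) *\<^sub>R ((D1 v u - D1 u v) + (D2 v u - D2 u v)) - (D3 v u - D3 u v))
     + b ?t *\<^sub>R ((1 / 2) *\<^sub>R ((D1 v u - D1 u v) - (D2 v u - D2 u v))) + (D3 v u - D3 u v))"
    unfolding G_def by (simp add: vec_eq_iff algebra_simps)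
  have "curvature A z [u, v] = a' *\<^sub>R (frt z u *\<^sub>R frP z v - frt z v *\<^sub>R frP z u)
     + b' *\<^sub>R (frt z u *\<^sub>R frN z v - frt z v *\<^sub>R frN z u)
     + (a ?t *\<^sub>R ((1 / 2) *\<^sub>R (- lie (mu1 z u) (mu1 z v) - lie (mu2 z u) (mu2 z v)) + lie (mu3 z u) (mu3 z v))
      + b ?t *\<^sub>R ((1 / 2) *\<^sub>R (- lie (mu1 z u) (mu1 z v) + lie (mu2 z u) (mu2 z v))) - lie (mu3 z u) (mu3 z v)
      + lie (a ?t *\<^sub>R frP z u + b ?t *\<^sub>R frN z u + mu3 z u) (a ?t *\<^sub>R frP z v + b ?t *\<^sub>R frN z v + mu3 z v))"
    by (simp add: curvature_def ext_deriv_def fd e d1 d2 d3 A' add_ac)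
  then show ?thesis
    unfolding curvature_algebra[OF m1 m2 m1 m2] by (simp add: frame_curvature_def add_ac)
qed

section \<open>The algebra of alternating forms\<close>

lemma wedge_Nil: "(\<alpha> \<and>\<^sub>w \<beta>) [] = \<beta> [] *\<^sub>R \<alpha> []"
  by (simp add: wedge_def)

text \<open>Contraction with \<open>v\<close> is an antiderivation of the wedge product; the identities below follow from
  this by induction on the list of arguments.\<close>

lemma wedge_Cons:
  "(\<alpha> \<and>\<^sub>w \<beta>) (v # vs) = ((\<lambda>l. \<alpha> (v # l)) \<and>\<^sub>w \<beta>) vs
     + ((\<lambda>l. (- 1) ^ length l *\<^sub>R \<alpha> l) \<and>\<^sub>w (\<lambda>l. \<beta> (v # l))) vs"
  by (simp add: wedge_def o_def case_prod_unfold mult_ac)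

lemma wedge_add_left: "((\<lambda>l. \<alpha> l + \<alpha>' l) \<and>\<^sub>w \<beta>) vs = (\<alpha> \<and>\<^sub>w \<beta>) vs + (\<alpha>' \<and>\<^sub>w \<beta>) vs"
  by (induction vs arbitrary: \<alpha> \<alpha>' \<beta>) (simp_all add: wedge_Nil wedge_Cons scaleR_add_right)

lemma wedge_add_right: "(\<alpha> \<and>\<^sub>w (\<lambda>l. \<beta> l + \<beta>' l)) vs = (\<alpha> \<and>\<^sub>w \<beta>) vs + (\<alpha> \<and>\<^sub>w \<beta>') vs"
  by (induction vs arbitrary: \<alpha> \<beta> \<beta>') (simp_all add: wedge_Nil wedge_Cons scaleR_add_left)

lemma wedge_scaleR_left: "((\<lambda>l. c *\<^sub>R \<alpha> l) \<and>\<^sub>w \<beta>) vs = c *\<^sub>R (\<alpha> \<and>\<^sub>w \<beta>) vs"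
proof (induction vs arbitrary: \<alpha> \<beta>)
  case (Cons v vs)
  have "(\<lambda>l. (- 1) ^ length l *\<^sub>R c *\<^sub>R \<alpha> l) = (\<lambda>l. c *\<^sub>R (- 1) ^ length l *\<^sub>R \<alpha> l)"
    by (simp add: mult.commute)
  then show ?case by (simp only: wedge_Cons Cons scaleR_add_right)
qed (simp add: wedge_Nil)

lemma wedge_scale_right: "(\<alpha> \<and>\<^sub>w (\<lambda>l. c * \<beta> l)) vs = c *\<^sub>R (\<alpha> \<and>\<^sub>w \<beta>) vs"
  by (induction vs arbitrary: \<alpha> \<beta>) (simp_all add: wedge_Nil wedge_Cons scaleR_add_right)

lemma wedge_minus_left: "((\<lambda>l. - \<alpha> l) \<and>\<^sub>w \<beta>) vs = - (\<alpha> \<and>\<^sub>w \<beta>) vs"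
  using wedge_scaleR_left[of "-1" \<alpha>] by simp

lemma wedge_minus_right: "(\<alpha> \<and>\<^sub>w (\<lambda>l. - \<beta> l)) vs = - (\<alpha> \<and>\<^sub>w \<beta>) vs"
  using wedge_scale_right[of \<alpha> "-1" \<beta>] by simp

text \<open>The grade involution is multiplicative. Every contraction produces this sign on the left
  factor, and associativity needs it moved across a product.\<close>

lemma wedge_sign:
  "(- 1) ^ length vs *\<^sub>R (\<alpha> \<and>\<^sub>w \<beta>) vs
   = ((\<lambda>l. (- 1) ^ length l *\<^sub>R \<alpha> l) \<and>\<^sub>w (\<lambda>l. (- 1) ^ length l *\<^sub>R \<beta> l)) vs"
proof (induction vs arbitrary: \<alpha> \<beta>)
  case (Cons v vs)
  have "(- 1) ^ length (v # vs) *\<^sub>R (\<alpha> \<and>\<^sub>w \<beta>) (v # vs) =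
      (- 1) *\<^sub>R ((- 1) ^ length vs *\<^sub>R ((\<lambda>l. \<alpha> (v # l)) \<and>\<^sub>w \<beta>) vs)
    + (- 1) *\<^sub>R ((- 1) ^ length vs *\<^sub>R ((\<lambda>l. (- 1) ^ length l *\<^sub>R \<alpha> l) \<and>\<^sub>w (\<lambda>l. \<beta> (v # l))) vs)"
    by (simp add: wedge_Cons scaleR_add_right)
  also have "\<dots> = ((\<lambda>l. (- 1) ^ length (v # l) *\<^sub>R \<alpha> (v # l)) \<and>\<^sub>w (\<lambda>l. (- 1) ^ length l *\<^sub>R \<beta> l)) vs
    + ((\<lambda>l. (- 1) ^ length l *\<^sub>R (- 1) ^ length l *\<^sub>R \<alpha> l) \<and>\<^sub>w
        (\<lambda>l. (- 1) ^ length (v # l) *\<^sub>R \<beta> (v # l))) vs"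
    unfolding Cons by (simp add: wedge_minus_left wedge_minus_right)
  finally show ?case by (simp only: wedge_Cons)
qed (simp add: wedge_Nil)

lemma wedge_assoc: "((\<alpha> \<and>\<^sub>w \<beta>) \<and>\<^sub>w \<gamma>) vs = (\<alpha> \<and>\<^sub>w (\<beta> \<and>\<^sub>w \<gamma>)) vs"
proof (induction vs arbitrary: \<alpha> \<beta> \<gamma>)
  case (Cons v vs)
  show ?case
    by (simp only: wedge_Cons wedge_sign Cons wedge_add_left wedge_add_right add.assoc)
qed (simp add: wedge_Nil)

lemma wedge_map: "(\<alpha> \<and>\<^sub>w \<beta>) (map f vs) = ((\<lambda>l. \<alpha> (map f l)) \<and>\<^sub>w (\<lambda>l. \<beta> (map f l))) vs"
  by (induction vs arbitrary: \<alpha> \<beta>) (simp_all add: wedge_Nil wedge_Cons)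

lemma wedge_bounded_linear:
  assumes "bounded_linear f"
  shows "f ((\<alpha> \<and>\<^sub>w \<beta>) vs) = ((\<lambda>l. f (\<alpha> l)) \<and>\<^sub>w \<beta>) vs"
  by (induction vs arbitrary: \<alpha> \<beta>)
    (simp_all add: wedge_Nil wedge_Cons linear_add linear_scale bounded_linear.linear[OF assms])

text \<open>The wedge evaluates its factors only on sublists of the arguments. This lets the
  curvature formula, known on tangent vectors only, be inserted into a product.\<close>

lemma wedge_cong:
  assumes "\<And>l. set l \<subseteq> set vs \<Longrightarrow> \<alpha> l = \<alpha>' l" "\<And>l. set l \<subseteq> set vs \<Longrightarrow> \<beta> l = \<beta>' l"
  shows "(\<alpha> \<and>\<^sub>w \<beta>) vs = (\<alpha>' \<and>\<^sub>w \<beta>') vs"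
  using assms
proof (induction vs arbitrary: \<alpha> \<beta> \<alpha>' \<beta>')
  case (Cons v vs)
  have "((\<lambda>l. \<alpha> (v # l)) \<and>\<^sub>w \<beta>) vs = ((\<lambda>l. \<alpha>' (v # l)) \<and>\<^sub>w \<beta>') vs"
    by (rule Cons.IH) (auto intro!: Cons.prems)
  moreover have "((\<lambda>l. (- 1) ^ length l *\<^sub>R \<alpha> l) \<and>\<^sub>w (\<lambda>l. \<beta> (v # l))) vs
      = ((\<lambda>l. (- 1) ^ length l *\<^sub>R \<alpha>' l) \<and>\<^sub>w (\<lambda>l. \<beta>' (v # l))) vs"
  proof (rule Cons.IH)
    fix l assume l: "set l \<subseteq> set vs"
    then have "\<alpha> l = \<alpha>' l" by (intro Cons.prems) auto
    then show "(- 1) ^ length l *\<^sub>R \<alpha> l = (- 1) ^ length l *\<^sub>R \<alpha>' l" by simp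
    from l show "\<beta> (v # l) = \<beta>' (v # l)" by (intro Cons.prems) auto
  qed
  ultimately show ?case by (simp only: wedge_Cons)
qed (simp add: wedge_Nil)

lemma wedge_tendsto:
  fixes \<alpha> :: "'p \<Rightarrow> 'v list \<Rightarrow> 'b::real_normed_vector"
  assumes "\<And>l. set l \<subseteq> set vs \<Longrightarrow> ((\<lambda>p. \<alpha> p l) \<longlongrightarrow> \<alpha>' l) F"
    and "\<And>l. set l \<subseteq> set vs \<Longrightarrow> ((\<lambda>p. \<beta> p l) \<longlongrightarrow> \<beta>' l) F"
  shows "((\<lambda>p. (\<alpha> p \<and>\<^sub>w \<beta> p) vs) \<longlongrightarrow> (\<alpha>' \<and>\<^sub>w \<beta>') vs) F"
  using assms
proof (induction vs arbitrary: \<alpha> \<beta> \<alpha>' \<beta>')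
  case Nil
  then show ?case by (simp add: wedge_Nil) (intro tendsto_scaleR; simp)
next
  case (Cons v vs)
  show ?case unfolding wedge_Cons
  proof (intro tendsto_add Cons.IH tendsto_scaleR tendsto_const)
  qed (auto intro!: Cons.prems)
qed

typedef 'v form = "UNIV :: ('v list \<Rightarrow> real) set"
  morphisms form_at Form ..

setup_lifting type_definition_form

instantiation form :: (type) real_algebra_1
begin
lift_definition zero_form :: "'a form" is "\<lambda>l. 0" .
lift_definition one_form :: "'a form" is "\<lambda>l. if l = [] then 1 else 0" .
lift_definition plus_form :: "'a form \<Rightarrow> 'a form \<Rightarrow> 'a form" is "\<lambda>\<alpha> \<beta> l. \<alpha> l + \<beta> l" .
lift_definition minus_form :: "'a form \<Rightarrow> 'a form \<Rightarrow> 'a form" is "\<lambda>\<alpha> \<beta> l. \<alpha> l - \<beta> l" .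
lift_definition uminus_form :: "'a form \<Rightarrow> 'a form" is "\<lambda>\<alpha> l. - \<alpha> l" .
lift_definition scaleR_form :: "real \<Rightarrow> 'a form \<Rightarrow> 'a form" is "\<lambda>c \<alpha> l. c *\<^sub>R \<alpha> l" .
lift_definition times_form :: "'a form \<Rightarrow> 'a form \<Rightarrow> 'a form" is "\<lambda>\<alpha> \<beta>. \<alpha> \<and>\<^sub>w \<beta>" .
instance
proof
  have zl: "((\<lambda>l. 0 :: real) \<and>\<^sub>w \<beta>) vs = 0" for \<beta> :: "'a list \<Rightarrow> real" and vs
    using wedge_scaleR_left[of 0 "\<lambda>l. 0" \<beta> vs] by simp
  have zr: "(\<alpha> \<and>\<^sub>w (\<lambda>l. 0 :: real)) vs = 0" for \<alpha> :: "'a list \<Rightarrow> real" and vs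
    using wedge_scale_right[of \<alpha> 0 "\<lambda>l. 0" vs] by simp
  have l1: "((\<lambda>l. if l = [] then 1 else 0) \<and>\<^sub>w \<alpha>) vs = \<alpha> vs" for \<alpha> :: "'a list \<Rightarrow> real" and vs
  proof (induction vs arbitrary: \<alpha>)
    case (Cons v vs)
    have *: "(\<lambda>l. (- 1) ^ length l *\<^sub>R (if l = [] then 1 else 0 :: real)) = (\<lambda>l. if l = [] then 1 else 0)"
      by auto
    show ?case unfolding wedge_Cons * Cons by (simp add: zl)
  qed (simp add: wedge_Nil)
  have r1: "(\<alpha> \<and>\<^sub>w (\<lambda>l. if l = [] then 1 else 0)) vs = \<alpha> vs" for \<alpha> :: "'a list \<Rightarrow> real" and vs
    by (induction vs arbitrary: \<alpha>) (simp_all add: wedge_Nil wedge_Cons zr)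
  fix a b c :: "'a form" and r s :: real
  show "a + b + c = a + (b + c)" by transfer auto
  show "a + b = b + a" by transfer auto
  show "0 + a = a" by transfer auto
  show "- a + a = 0" by transfer auto
  show "a - b = a + - b" by transfer auto
  show "r *\<^sub>R (a + b) = r *\<^sub>R a + r *\<^sub>R b" by transfer (auto simp: algebra_simps)
  show "(r + s) *\<^sub>R a = r *\<^sub>R a + s *\<^sub>R a" by transfer (auto simp: algebra_simps)
  show "r *\<^sub>R s *\<^sub>R a = (r * s) *\<^sub>R a" by transfer auto
  show "1 *\<^sub>R a = a" by transfer auto
  show "a * b * c = a * (b * c)" by transfer (auto simp: fun_eq_iff wedge_assoc)
  show "(a + b) * c = a * c + b * c" by transfer (auto simp: fun_eq_iff wedge_add_left)
  show "a * (b + c) = a * b + a * c" by transfer (auto simp: fun_eq_iff wedge_add_right)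
  show "1 * a = a" by transfer (auto simp: fun_eq_iff l1)
  show "a * 1 = a" by transfer (auto simp: fun_eq_iff r1)
  show "(0 :: 'a form) \<noteq> 1" by transfer (metis one_neq_zero)
  show "r *\<^sub>R a * b = r *\<^sub>R (a * b)"
    by transfer (simp only: fun_eq_iff wedge_scaleR_left simp_thms)
  show "a * r *\<^sub>R b = r *\<^sub>R (a * b)"
    by transfer (simp add: fun_eq_iff wedge_scale_right)
qed
end

section \<open>One-forms and their products\<close>

lift_definition cov :: "('v \<Rightarrow> real) \<Rightarrow> 'v form" is covec .

lemmas form_at_simps = zero_form.rep_eq one_form.rep_eq plus_form.rep_eq minus_form.rep_eq
  uminus_form.rep_eq scaleR_form.rep_eq times_form.rep_eq cov.rep_eq

lemma covec_simps [simp]: "covec a [] = 0" "covec a [u] = a u" "covec a (u # v # w) = 0"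
  by (simp_all add: covec_def)

lemma wedge_zero_left [simp]: "((\<lambda>l. 0) \<and>\<^sub>w \<beta>) vs = 0"
  using wedge_scaleR_left[of 0 "\<lambda>l. 0" \<beta> vs] by simp

lemma wedge_zero_right [simp]: "(\<alpha> \<and>\<^sub>w (\<lambda>l. 0)) vs = 0"
  using wedge_scale_right[of \<alpha> 0 "\<lambda>l. 0" vs] by simp

lemma wedge_scalar_left: "((\<lambda>l. if l = [] then c else 0) \<and>\<^sub>w \<beta>) vs = \<beta> vs *\<^sub>R c"
proof (induction vs arbitrary: \<beta>)
  case (Cons v vs)
  have *: "(\<lambda>l. (- 1) ^ length l *\<^sub>R (if l = [] then c else 0)) = (\<lambda>l. if l = [] then c else 0)"
    by auto
  show ?case unfolding wedge_Cons * Cons by simp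
qed (simp add: wedge_Nil)

lemma covec_Cons: "covec a (v # l) = (if l = [] then a v else 0)"
  by (cases l) auto

lemma wedge_covec_Cons:
  "(covec a \<and>\<^sub>w \<beta>) (v # vs) = a v * \<beta> vs - (covec a \<and>\<^sub>w (\<lambda>l. \<beta> (v # l))) vs"
proof -
  have "(\<lambda>l. (- 1) ^ length l *\<^sub>R covec a l) = (\<lambda>l. (- 1) *\<^sub>R covec a l)"
    by (auto simp: covec_def fun_eq_iff split: list.splits)
  then show ?thesis
    by (simp only: wedge_Cons covec_Cons wedge_scalar_left wedge_scaleR_left) simp
qed

lemma cov_mult_cov: "form_at (cov a * cov b) vs = (case vs of [u, v] \<Rightarrow> a u * b v - a v * b u | _ \<Rightarrow> 0)"
  by (auto simp: form_at_simps wedge_Nil wedge_covec_Cons covec_Cons split: list.splits)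

lemma form_eqI: "(\<And>vs. form_at x vs = form_at y vs) \<Longrightarrow> x = y"
  by transfer auto

lemma cov_anticommute: "cov a * cov b = - (cov b * cov a)"
  by (rule form_eqI) (simp add: cov_mult_cov uminus_form.rep_eq split: list.splits)

lemma cov_square [simp]: "cov a * cov a = 0"
  by (rule form_eqI) (simp add: cov_mult_cov zero_form.rep_eq split: list.splits)

lemma cov_add: "cov (\<lambda>v. a v + b v) = cov a + cov b"
  and cov_diff: "cov (\<lambda>v. a v - b v) = cov a - cov b"
  and cov_scaleR: "cov (\<lambda>v. c * a v) = c *\<^sub>R cov a"
  by (rule form_eqI; simp add: form_at_simps covec_def split: list.splits)+

lemma form_at_sum: "form_at (sum f A) vs = (\<Sum>i\<in>A. form_at (f i) vs)"
  by (induction A rule: infinite_finite_induct) (simp_all add: form_at_simps)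

section \<open>The four-form in an invariant frame\<close>

definition cvec :: "('v \<Rightarrow> real^3) \<Rightarrow> 3 \<Rightarrow> 'v form" where
  "cvec P i = cov (\<lambda>v. P v $ i)"

definition omega_form :: "real \<Rightarrow> real \<Rightarrow> ('v \<Rightarrow> real^3) \<Rightarrow> ('v \<Rightarrow> real^3) \<Rightarrow> 'v form" where
  "omega_form A B P N = (4 * A * B) *\<^sub>R (cvec N 1 * cvec P 1 + cvec N 2 * cvec P 2 + cvec N 3 * cvec P 3)"

text \<open>The sum over \<open>eps\<close> in \<open>bs_Omega2\<close> has six nonzero terms, equal
  in pairs since the first two one-forms anticommute; this turns the factor 4 into 8 for the three
  cyclic terms.\<close>

definition Omega2_form :: "real \<Rightarrow> real \<Rightarrow> ('v \<Rightarrow> real^3) \<Rightarrow> ('v \<Rightarrow> real^3) \<Rightarrow> 'v form" where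
  "Omega2_form A B P N = (- 8 * A ^ 3) *\<^sub>R (cvec P 1 * (cvec P 2 * cvec P 3))
     + (8 * B\<^sup>2 * A) *\<^sub>R (cvec N 1 * (cvec N 2 * cvec P 3) + cvec N 2 * (cvec N 3 * cvec P 1)
       + cvec N 3 * (cvec N 1 * cvec P 2))"

definition psi_form :: "real \<Rightarrow> real \<Rightarrow> ('v \<Rightarrow> real) \<Rightarrow> ('v \<Rightarrow> real^3) \<Rightarrow> ('v \<Rightarrow> real^3) \<Rightarrow> 'v form" where
  "psi_form A B e P N = (1 / 2) *\<^sub>R (omega_form A B P N * omega_form A B P N) - cov e * Omega2_form A B P N"

lemma cov_mult_cov_mult: "cov a * (cov b * x) = - (cov b * (cov a * x))"
  using arg_cong[OF cov_anticommute[of a b], of "\<lambda>y. y * x"] by (simp add: mult.assoc)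

text \<open>Numbering the one-forms orients anticommutation as a rewrite rule: factors are sorted by
  index and repeated ones vanish, so that simplification reaches a normal form.\<close>

lemma cov_sort:
  fixes c :: "nat \<Rightarrow> 'v \<Rightarrow> real"
  shows "i < j \<Longrightarrow> cov (c j) * cov (c i) = - (cov (c i) * cov (c j))"
    and "i < j \<Longrightarrow> cov (c j) * (cov (c i) * x) = - (cov (c i) * (cov (c j) * x))"
    and "cov (c i) * (cov (c i) * x) = 0"
  by (rule cov_anticommute, rule cov_mult_cov_mult, simp flip: mult.assoc)

lemmas form_expand = cov_sort distrib_left distrib_right left_diff_distrib right_diff_distrib
  scaleR_add_right scaleR_diff_right mult.assoc

lemmas form_at_linear = zero_form.rep_eq plus_form.rep_eq minus_form.rep_eq
  uminus_form.rep_eq scaleR_form.rep_eq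

text \<open>Index 0 stands for dt, 1 to 3 for \<open>P\<close> and 4 to 6 for \<open>N\<close>; the
  left factor is the shape of one component of the curvature. Of the seven possible six-forms only
  two survive, so each component amounts to two scalar equations.\<close>

lemma curvature_wedge_psi_ring:
  fixes c :: "nat \<Rightarrow> 'v \<Rightarrow> real"
  defines "g \<equiv> \<lambda>i. cov (c i)"
  defines "w \<equiv> g 4 * g 1 + g 5 * g 2 + g 6 * g 3"
  shows "(a' *\<^sub>R (g 0 * g 1) + b' *\<^sub>R (g 0 * g 4) + k *\<^sub>R (g 2 * g 3) + l *\<^sub>R (g 5 * g 6)
      + m *\<^sub>R (g 2 * g 6 + g 5 * g 3)) *
    ((8 * A\<^sup>2 * B\<^sup>2) *\<^sub>R (w * w) - g 0 * ((- 8 * A ^ 3) *\<^sub>R (g 1 * (g 2 * g 3))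
      + (8 * B\<^sup>2 * A) *\<^sub>R (g 4 * (g 5 * g 3) + g 5 * (g 6 * g 1) + g 6 * (g 4 * g 2))))
    = (- 16 * A\<^sup>2 * B\<^sup>2 * a' - 8 * A * B\<^sup>2 * k + 8 * A ^ 3 * l) *\<^sub>R (g 0 * (g 1 * (g 2 * (g 3 * (g 5 * g 6)))))
    + (- 16 * A\<^sup>2 * B\<^sup>2 * b' + 16 * A * B\<^sup>2 * m) *\<^sub>R (g 0 * (g 2 * (g 3 * (g 4 * (g 5 * g 6)))))"
  unfolding w_def g_def
  by (simp add: form_expand, rule form_eqI, simp add: form_at_linear, simp add: algebra_simps)

lemma form_at_triple:
  "form_at (cov a * (cov b * cov c)) vs = (case vs of [u, v, w] \<Rightarrow>
     a u * (b v * c w - b w * c v) - a v * (b u * c w - b w * c u) + a w * (b u * c v - b v * c u) | _ \<Rightarrow> 0)"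
  by (auto simp: form_at_simps wedge_Nil wedge_covec_Cons covec_Cons algebra_simps split: list.splits)

lemma form_at_omega:
  "form_at (omega_form A B P N) vs = (case vs of [u, v] \<Rightarrow> 4 * A * B * (N u \<bullet> P v - N v \<bullet> P u) | _ \<Rightarrow> 0)"
  by (auto simp: omega_form_def cvec_def form_at_linear cov_mult_cov inner_vec_def sum_3 algebra_simps
      split: list.splits)

lemma form_at_Omega2:
  "form_at (Omega2_form A B P N) vs = (case vs of [u, v, w] \<Rightarrow>
      - 8 * A ^ 3 * (cross3 (P u) (P v) \<bullet> P w)
      + 8 * B\<^sup>2 * A * (cross3 (N u) (N v) \<bullet> P w + cross3 (N v) (N w) \<bullet> P u + cross3 (N w) (N u) \<bullet> P v) | _ \<Rightarrow> 0)"
proof -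
  have "form_at (Omega2_form A B P N) [u, v, w] = - 8 * A ^ 3 * (cross3 (P u) (P v) \<bullet> P w)
      + 8 * B\<^sup>2 * A * (cross3 (N u) (N v) \<bullet> P w + cross3 (N v) (N w) \<bullet> P u + cross3 (N w) (N u) \<bullet> P v)" for u v w
    unfolding Omega2_form_def cvec_def
    by (simp add: form_at_linear form_at_triple inner_vec_def sum_3 cross3_def, simp add: algebra_simps)
  moreover have "form_at (Omega2_form A B P N) vs = 0" if "\<And>u v w. vs \<noteq> [u, v, w]"
    unfolding Omega2_form_def cvec_def
    using that by (auto simp: form_at_linear form_at_triple split: list.splits)
  ultimately show ?thesis by (auto split: list.splits)
qed

abbreviation psi_at :: "tot \<Rightarrow> tot form" where
  "psi_at z \<equiv> psi_form (bsA (norm (fst z))) (bsB (norm (fst z))) (frt z) (frP z) (frN z)"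

text \<open>Evaluated on vectors, \<open>omega_form\<close> and \<open>Omega2_form\<close> contain
  only inner products and triple products. The lemma is used for \<open>Ad h\<close> with a unit
  quaternion \<open>h\<close> and for cyclic permutation of the coordinates.\<close>

lemma psi_form_rotate:
  assumes "\<And>x y. R x \<bullet> R y = x \<bullet> y" "\<And>x y. R (cross3 x y) = cross3 (R x) (R y)"
  shows "psi_form A B e (\<lambda>v. R (P v)) (\<lambda>v. R (N v)) = psi_form A B e P N"
proof -
  have "omega_form A B (\<lambda>v. R (P v)) (\<lambda>v. R (N v)) = omega_form A B P N"
    by (rule form_eqI) (simp add: form_at_omega assms(1) cong: list.case_cong)
  moreover have "Omega2_form A B (\<lambda>v. R (P v)) (\<lambda>v. R (N v)) = Omega2_form A B P N"
    by (rule form_eqI) (simp add: form_at_Omega2 assms(1) flip: assms(2) cong: list.case_cong)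
  ultimately show ?thesis by (simp add: psi_form_def)
qed

section \<open>Pull-backs, and the given four-form in the frame\<close>

lift_definition pull :: "('u \<Rightarrow> 'v) \<Rightarrow> 'v form \<Rightarrow> 'u form" is "\<lambda>f \<alpha> l. \<alpha> (map f l)" .

lemma pull_add: "pull f (x + y) = pull f x + pull f y"
  and pull_diff: "pull f (x - y) = pull f x - pull f y"
  and pull_scaleR: "pull f (s *\<^sub>R x) = s *\<^sub>R pull f x"
  by (transfer, simp)+

lemma pull_mult: "pull f (x * y) = pull f x * pull f y"
  by transfer (simp add: fun_eq_iff wedge_map)

lemma pull_cov: "pull f (cov a) = cov (\<lambda>u. a (f u))"
  by transfer (auto simp: fun_eq_iff covec_def split: list.splits)

text \<open>\<open>psi_form\<close> is a polynomial in its one-forms, and pulling back is a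
  homomorphism of the algebra of forms.\<close>

lemma form_at_psi_map:
  "form_at (psi_form A B e P N) (map f vs)
    = form_at (psi_form A B (\<lambda>v. e (f v)) (\<lambda>v. P (f v)) (\<lambda>v. N (f v))) vs"
proof -
  have "pull f (psi_form A B e P N) = psi_form A B (\<lambda>v. e (f v)) (\<lambda>v. P (f v)) (\<lambda>v. N (f v))"
    by (simp add: psi_form_def omega_form_def Omega2_form_def cvec_def pull_add pull_diff pull_scaleR
        pull_mult pull_cov)
  then show ?thesis by (metis pull.rep_eq)
qed

definition etaP :: "cyl \<Rightarrow> cyl \<Rightarrow> real^3" where
  "etaP = (\<lambda>(t, g1, g2) (\<tau>, v1, v2). (1 / 2) *\<^sub>R (mc g1 v1 + mc g2 v2))"

definition etaN :: "cyl \<Rightarrow> cyl \<Rightarrow> real^3" where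
  "etaN = (\<lambda>(t, g1, g2) (\<tau>, v1, v2). (1 / 2) *\<^sub>R (mc g1 v1 - mc g2 v2))"

lemma eta_plus_eq: "eta_plus i n = (\<lambda>v. etaP n v $ i)"
  and eta_minus_eq: "eta_minus i n = (\<lambda>v. etaN n v $ i)"
  by (simp_all add: eta_plus_def eta_minus_def etaP_def etaN_def fun_eq_iff case_prod_unfold)

lemma bs_psi_eq: "bs_psi n vs = form_at (psi_form (bsA (fst n)) (bsB (fst n)) fst (etaP n) (etaN n)) vs"
proof -
  let ?A = "bsA (fst n)" and ?B = "bsB (fst n)"
  have om: "bs_omega n = form_at (omega_form ?A ?B (etaP n) (etaN n))"
    by (simp add: fun_eq_iff bs_omega_def omega_form_def cvec_def form_at_linear times_form.rep_eq
        cov.rep_eq sum_3 eta_plus_eq eta_minus_eq algebra_simps)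
  have anti: "cvec (etaN n) j * (cvec (etaN n) i * x) = - (cvec (etaN n) i * (cvec (etaN n) j * x))" for i j x
    unfolding cvec_def by (rule cov_mult_cov_mult)
  have "bs_Omega2 n = form_at ((- 8 * ?A ^ 3) *\<^sub>R (cvec (etaP n) 1 * (cvec (etaP n) 2 * cvec (etaP n) 3))
     + 4 *\<^sub>R (\<Sum>i\<in>UNIV. \<Sum>j\<in>UNIV. \<Sum>k\<in>UNIV. (eps i j k * ?B ^ 2 * ?A) *\<^sub>R
       (cvec (etaN n) i * (cvec (etaN n) j * cvec (etaP n) k))))"
    by (simp add: fun_eq_iff bs_Omega2_def cvec_def form_at_linear form_at_sum times_form.rep_eq
        cov.rep_eq eta_plus_eq eta_minus_eq)
  also have "\<dots> = form_at (Omega2_form ?A ?B (etaP n) (etaN n))"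
    unfolding Omega2_form_def sum_3 eps_values
      anti[of 2 1] anti[of 3 2] anti[of 1 3]
    by (rule arg_cong[where f = form_at], rule form_eqI) (simp add: form_at_linear algebra_simps)
  finally show ?thesis
    by (simp add: bs_psi_def om psi_form_def form_at_linear times_form.rep_eq cov.rep_eq)
qed


text \<open>Renumbers the frame as in \<open>curvature_wedge_psi_ring\<close>; the coefficient 8 A^2
  B^2 is half the square of 4 A B.\<close>

lemma psi_form_alt:
  fixes c :: "nat \<Rightarrow> 'v \<Rightarrow> real"
  assumes "c = (\<lambda>k. [e, \<lambda>v. P v $ 1, \<lambda>v. P v $ 2, \<lambda>v. P v $ 3, \<lambda>v. N v $ 1, \<lambda>v. N v $ 2, \<lambda>v. N v $ 3] ! k)"
  defines "g \<equiv> \<lambda>i. cov (c i)"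
  shows "psi_form A B e P N = (8 * A\<^sup>2 * B\<^sup>2) *\<^sub>R ((g 4 * g 1 + g 5 * g 2 + g 6 * g 3) * (g 4 * g 1 + g 5 * g 2 + g 6 * g 3))
    - g 0 * ((- 8 * A ^ 3) *\<^sub>R (g 1 * (g 2 * g 3))
      + (8 * B\<^sup>2 * A) *\<^sub>R (g 4 * (g 5 * g 3) + g 5 * (g 6 * g 1) + g 6 * (g 4 * g 2)))"
  unfolding psi_form_def omega_form_def Omega2_form_def cvec_def g_def assms(1)
  by (simp add: power2_eq_square mult_ac)

lemma curvature_wedge_psi_component:
  fixes F :: "'v list \<Rightarrow> real^3"
  assumes "\<And>u v. {u, v} \<subseteq> set vs \<Longrightarrow> F [u, v] = frame_curvature a a' b b' e P N u v"
    and "\<And>l. length l \<noteq> 2 \<Longrightarrow> F l = 0"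
  shows "(F \<and>\<^sub>w form_at (psi_form A B e P N)) vs $ 1 =
     (- 16 * A\<^sup>2 * B\<^sup>2 * a' - 16 * A * B\<^sup>2 * (a\<^sup>2 - a) + 16 * A ^ 3 * (b\<^sup>2 - a)) *
       form_at (cov e * (cvec P 1 * (cvec P 2 * (cvec P 3 * (cvec N 2 * cvec N 3))))) vs
   + (- 16 * A\<^sup>2 * B\<^sup>2 * b' + 32 * A * B\<^sup>2 * (a * b - b)) *
       form_at (cov e * (cvec P 2 * (cvec P 3 * (cvec N 1 * (cvec N 2 * cvec N 3))))) vs"
proof -
  define c where "c = (\<lambda>k. [e, \<lambda>v. P v $ 1, \<lambda>v. P v $ 2, \<lambda>v. P v $ 3, \<lambda>v. N v $ 1, \<lambda>v. N v $ 2, \<lambda>v. N v $ 3] ! k)"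
  \<comment> \<open>First component of the curvature; the factors 2 are there because
    \<open>lie\<close> is twice the cross product.\<close>
  define f where "f = a' *\<^sub>R (cov (c 0) * cov (c 1)) + b' *\<^sub>R (cov (c 0) * cov (c 4))
      + (2 * (a\<^sup>2 - a)) *\<^sub>R (cov (c 2) * cov (c 3)) + (2 * (b\<^sup>2 - a)) *\<^sub>R (cov (c 5) * cov (c 6))
      + (2 * (a * b - b)) *\<^sub>R (cov (c 2) * cov (c 6) + cov (c 5) * cov (c 3))"
  have F: "F l $ 1 = form_at f l" if l: "set l \<subseteq> set vs" for l
  proof (cases "length l = 2")
    case True
    then obtain u v where "l = [u, v]" by (auto simp: numeral_2_eq_2 length_Suc_conv)
    have "{u, v} \<subseteq> set vs" using l \<open>l = [u, v]\<close> by simp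
    from assms(1)[OF this] show ?thesis unfolding \<open>l = [u, v]\<close>
      by (simp only: frame_curvature_def) (simp add: f_def c_def form_at_linear cov_mult_cov lie_eq_cross3 cross3_def algebra_simps)
  next
    case False
    then show ?thesis
      by (auto simp: f_def assms(2) form_at_linear cov_mult_cov split: list.splits)
  qed
  have "(F \<and>\<^sub>w form_at (psi_form A B e P N)) vs $ 1 = ((\<lambda>l. F l $ 1) \<and>\<^sub>w form_at (psi_form A B e P N)) vs"
    by (rule wedge_bounded_linear) (rule bounded_linear_vec_nth)
  also have "\<dots> = (form_at f \<and>\<^sub>w form_at (psi_form A B e P N)) vs"
    by (rule wedge_cong) (auto simp: F)
  also have "\<dots> = form_at (f * psi_form A B e P N) vs"
    by (simp add: times_form.rep_eq)
  also have "\<dots> = (- 16 * A\<^sup>2 * B\<^sup>2 * a' - 16 * A * B\<^sup>2 * (a\<^sup>2 - a) + 16 * A ^ 3 * (b\<^sup>2 - a)) *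
       form_at (cov (c 0) * (cov (c 1) * (cov (c 2) * (cov (c 3) * (cov (c 5) * cov (c 6)))))) vs
   + (- 16 * A\<^sup>2 * B\<^sup>2 * b' + 32 * A * B\<^sup>2 * (a * b - b)) *
       form_at (cov (c 0) * (cov (c 2) * (cov (c 3) * (cov (c 4) * (cov (c 5) * cov (c 6)))))) vs"
    unfolding psi_form_alt[OF c_def] f_def curvature_wedge_psi_ring
    by (simp add: form_at_linear) (simp add: algebra_simps)
  finally show ?thesis by (simp add: c_def cvec_def)
qed

text \<open>The other two components of the instanton equation follow from the first by cyclic symmetry.\<close>

definition cyc :: "real^3 \<Rightarrow> real^3" where
  "cyc x = vector [x $ 2, x $ 3, x $ 1]"

lemma cyc_nth [simp]: "cyc x $ 1 = x $ 2" "cyc x $ 2 = x $ 3" "cyc x $ 3 = x $ 1"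
  by (simp_all add: cyc_def)

lemma cyc_inner: "cyc x \<bullet> cyc y = x \<bullet> y"
  by (simp add: inner_vec_def sum_3)

lemma cyc_cross3: "cyc (cross3 x y) = cross3 (cyc x) (cyc y)"
  by (simp add: vec_eq_iff forall_3 cross3_def)

lemma cyc_linear:
  "cyc (x + y) = cyc x + cyc y" "cyc (x - y) = cyc x - cyc y" "cyc (s *\<^sub>R x) = s *\<^sub>R cyc x" "cyc 0 = 0"
  by (simp_all add: vec_eq_iff forall_3)

lemma bounded_linear_cyc: "bounded_linear cyc"
  unfolding linear_conv_bounded_linear[symmetric] by (rule linearI) (rule cyc_linear)+

lemma cyc_lie: "cyc (lie x y) = lie (cyc x) (cyc y)"
  by (simp add: lie_eq_cross3 cyc_linear cyc_cross3)

lemma curvature_wedge_psi_zero: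
  fixes F :: "'v list \<Rightarrow> real^3"
  assumes F2: "\<And>u v. {u, v} \<subseteq> set vs \<Longrightarrow> F [u, v] = frame_curvature a a' b b' e P N u v"
    and F0: "\<And>l. length l \<noteq> 2 \<Longrightarrow> F l = 0"
    and ode: "- 16 * A\<^sup>2 * B\<^sup>2 * a' - 16 * A * B\<^sup>2 * (a\<^sup>2 - a) + 16 * A ^ 3 * (b\<^sup>2 - a) = 0"
      "- 16 * A\<^sup>2 * B\<^sup>2 * b' + 32 * A * B\<^sup>2 * (a * b - b) = 0"
  shows "(F \<and>\<^sub>w form_at (psi_form A B e P N)) vs = 0"
proof -
  let ?c = "frame_curvature a a' b b' e"
  have cyc_curv: "cyc (?c P N u v) = ?c (\<lambda>v. cyc (P v)) (\<lambda>v. cyc (N v)) u v" for P N u v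
    unfolding frame_curvature_def by (simp only: cyc_linear cyc_lie)
  have zero: "(F \<and>\<^sub>w form_at (psi_form A B e P N)) vs $ 1 = 0"
    if "\<And>u v. {u, v} \<subseteq> set vs \<Longrightarrow> F [u, v] = ?c P N u v" "\<And>l. length l \<noteq> 2 \<Longrightarrow> F l = 0"
    for F :: "'v list \<Rightarrow> real^3" and P N
    using curvature_wedge_psi_component[where F = F and P = P and N = N and vs = vs and A = A and B = B,
        OF that] unfolding ode by simp
  \<comment> \<open>Rotating the curvature is the same as rotating its frame. The four-form for the
    rotated frame is the original one, so the vanishing of the first component applies to
    \<open>cyc\<close> of the curvature as well.\<close>
  have step: "((\<lambda>l. cyc (F l)) \<and>\<^sub>w form_at (psi_form A B e P N)) vs $ 1 = 0"
    if F: "\<And>u v. {u, v} \<subseteq> set vs \<Longrightarrow> F [u, v] = ?c P N u v" "\<And>l. length l \<noteq> 2 \<Longrightarrow> F l = 0"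
    for F :: "'v list \<Rightarrow> real^3" and P N
  proof -
    have "((\<lambda>l. cyc (F l)) \<and>\<^sub>w form_at (psi_form A B e (\<lambda>v. cyc (P v)) (\<lambda>v. cyc (N v)))) vs $ 1 = 0"
      by (rule zero) (simp_all add: F cyc_curv cyc_linear)
    then show ?thesis by (simp only: psi_form_rotate[of cyc, OF cyc_inner cyc_cross3])
  qed
  \<comment> \<open>\<open>cyc\<close> brings the second component to the first place, and applied
    twice the third one.\<close>
  let ?w = "(F \<and>\<^sub>w form_at (psi_form A B e P N)) vs"
  have "?w $ 1 = 0"
    by (rule zero[OF F2 F0])
  moreover have "cyc ?w $ 1 = 0"
    unfolding wedge_bounded_linear[OF bounded_linear_cyc] by (rule step[OF F2 F0])
  moreover have "cyc (cyc ?w) $ 1 = 0"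
    unfolding wedge_bounded_linear[OF bounded_linear_cyc]
      psi_form_rotate[of cyc, OF cyc_inner cyc_cross3, symmetric, of A B e P N]
    by (rule step) (simp_all add: F2 F0 cyc_curv cyc_linear)
  ultimately show ?thesis by (simp add: vec_eq_iff forall_3)
qed

text \<open>At the singular orbit dt and the rescaled frame depend on the direction of p and have no
  limit, but they stay bounded on each list of arguments. This suffices to discard a term whose
  coefficient tends to 0.\<close>

definition bounded_forms :: "'p set \<Rightarrow> ('p \<Rightarrow> 'v form) \<Rightarrow> bool" where
  "bounded_forms S X \<longleftrightarrow> (\<forall>vs. \<exists>C. \<forall>p\<in>S. \<bar>form_at (X p) vs\<bar> \<le> C)"

lemma bounded_forms_add: "bounded_forms S X \<Longrightarrow> bounded_forms S Y \<Longrightarrow> bounded_forms S (\<lambda>p. X p + Y p)"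
  unfolding bounded_forms_def
proof
  fix vs assume "\<forall>vs. \<exists>C. \<forall>p\<in>S. \<bar>form_at (X p) vs\<bar> \<le> C" "\<forall>vs. \<exists>C. \<forall>p\<in>S. \<bar>form_at (Y p) vs\<bar> \<le> C"
  then obtain C D where "\<forall>p\<in>S. \<bar>form_at (X p) vs\<bar> \<le> C" "\<forall>p\<in>S. \<bar>form_at (Y p) vs\<bar> \<le> D" by metis
  then have "\<bar>form_at (X p + Y p) vs\<bar> \<le> C + D" if "p \<in> S" for p
    unfolding form_at_linear using that by (intro order_trans[OF abs_triangle_ineq add_mono]) blast+
  then show "\<exists>C. \<forall>p\<in>S. \<bar>form_at (X p + Y p) vs\<bar> \<le> C" by blast
qed

lemma bounded_wedge:
  fixes X Y :: "'p \<Rightarrow> 'v list \<Rightarrow> real"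
  assumes "\<And>vs. \<exists>C. \<forall>p\<in>S. \<bar>X p vs\<bar> \<le> C" "\<And>vs. \<exists>C. \<forall>p\<in>S. \<bar>Y p vs\<bar> \<le> C"
  shows "\<exists>C. \<forall>p\<in>S. \<bar>(X p \<and>\<^sub>w Y p) vs\<bar> \<le> C"
  using assms
proof (induction vs arbitrary: X Y)
  case Nil
  obtain C D where CD: "\<forall>p\<in>S. \<bar>X p []\<bar> \<le> C" "\<forall>p\<in>S. \<bar>Y p []\<bar> \<le> D"
    using Nil(1)[of "[]"] Nil(2)[of "[]"] by blast
  have "\<bar>(X p \<and>\<^sub>w Y p) []\<bar> \<le> D * C" if "p \<in> S" for p
    unfolding wedge_Nil real_scaleR_def abs_mult
    using CD that by (intro mult_mono) (auto intro: order_trans[OF abs_ge_zero])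
  then show ?case by blast
next
  case (Cons v vs)
  define X' where "X' p l = (- 1) ^ length l *\<^sub>R X p l" for p l
  have X': "\<exists>C. \<forall>p\<in>S. \<bar>X' p l\<bar> \<le> C" for l
    using Cons.prems(1)[of l] by (simp add: X'_def abs_mult)
  obtain C where C: "\<forall>p\<in>S. \<bar>((\<lambda>l. X p (v # l)) \<and>\<^sub>w Y p) vs\<bar> \<le> C"
    using Cons.IH[of "\<lambda>p l. X p (v # l)" Y, OF Cons.prems(1,2)] by blast
  obtain D where D: "\<forall>p\<in>S. \<bar>(X' p \<and>\<^sub>w (\<lambda>l. Y p (v # l))) vs\<bar> \<le> D"
    using Cons.IH[of X' "\<lambda>p l. Y p (v # l)", OF X' Cons.prems(2)] by blast
  have "\<bar>(X p \<and>\<^sub>w Y p) (v # vs)\<bar> \<le> C + D" if "p \<in> S" for p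
    unfolding wedge_Cons X'_def[symmetric]
    by (rule order_trans[OF abs_triangle_ineq add_mono]) (use C D that in blast)+
  then show ?case by blast
qed

lemma bounded_forms_mult: "bounded_forms S X \<Longrightarrow> bounded_forms S Y \<Longrightarrow> bounded_forms S (\<lambda>p. X p * Y p)"
  unfolding bounded_forms_def times_form.rep_eq by (rule allI, rule bounded_wedge) blast+

lemma bounded_forms_cov:
  fixes a :: "'p \<Rightarrow> 'v \<Rightarrow> real"
  assumes "\<And>v. \<exists>C. \<forall>p\<in>S. \<bar>a p v\<bar> \<le> C"
  shows "bounded_forms S (\<lambda>p. cov (a p))"
  unfolding bounded_forms_def cov.rep_eq
proof
  fix vs :: "'v list"
  show "\<exists>C. \<forall>p\<in>S. \<bar>covec (a p) vs\<bar> \<le> C"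
  proof (cases "\<exists>v. vs = [v]")
    case True
    then show ?thesis using assms by auto
  next
    case False
    then have "covec (a p) vs = 0" for p by (auto simp: covec_def split: list.splits)
    then show ?thesis by auto
  qed
qed

lemma bounded_forms_tendsto:
  assumes "bounded_forms S X" "(c \<longlongrightarrow> 0) F" "eventually (\<lambda>p. p \<in> S) F"
  shows "((\<lambda>p. form_at (c p *\<^sub>R X p) vs) \<longlongrightarrow> 0) F"
proof -
  obtain C where C: "\<forall>p\<in>S. \<bar>form_at (X p) vs\<bar> \<le> C"
    using assms(1) by (auto simp: bounded_forms_def)
  have "((\<lambda>p. \<bar>c p\<bar> * C) \<longlongrightarrow> 0) F"
    using tendsto_mult_left_zero[OF tendsto_rabs_zero[OF assms(2)]] .
  then show ?thesis
    by (rule Lim_null_comparison[rotated])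
      (use assms(3) C in \<open>auto elim!: eventually_mono simp: form_at_linear abs_mult intro!: mult_left_mono\<close>)
qed

section \<open>The radial coordinate\<close>

text \<open>This family of integrals is closed under differentiation in \<open>v\<close>: the
  exponent rises by 2 and \<open>q\<close> is replaced by its derivative. The exponent is carried
  along for the induction in \<open>Ck_on_tint\<close>.\<close>

definition tint :: "nat \<Rightarrow> (real \<Rightarrow> real) \<Rightarrow> real \<Rightarrow> real" where
  "tint m q v = integral {0..1} (\<lambda>s. s ^ m * q (s\<^sup>2 * v))"

lemma scale_mem:
  fixes s v :: real
  assumes "v \<in> {-1<..}" "s \<in> {0..1::real}"
  shows "s\<^sup>2 * v \<in> {-1<..}"
proof (cases "v \<ge> 0")
  case True
  then have "0 \<le> s\<^sup>2 * v" by simp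
  then show ?thesis by simp
next
  case False
  have "s\<^sup>2 \<le> 1" using assms(2) by (simp add: power_le_one)
  then have "1 * v \<le> s\<^sup>2 * v" using False by (intro mult_right_mono_neg) auto
  then show ?thesis using assms(1) by simp
qed

lemma continuous_on_tint_integrand:
  fixes q :: "real \<Rightarrow> real"
  assumes "continuous_on {-1<..} q"
  shows "continuous_on ({-1<..} \<times> {0..1}) (\<lambda>(v, s). s ^ m * q (s\<^sup>2 * v))"
proof -
  have "continuous_on ({-1<..} \<times> {0..1}) (\<lambda>x. snd x ^ m * q ((snd x)\<^sup>2 * fst x))"
  proof -
    have "continuous_on ({-1<..} \<times> {0..1}) (\<lambda>x. q ((snd x)\<^sup>2 * fst x))"
      by (rule continuous_on_compose2[OF assms])
        (auto intro!: continuous_intros scale_mem[simplified])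
    then show ?thesis by (intro continuous_intros)
  qed
  then show ?thesis by (simp add: case_prod_unfold)
qed

lemma continuous_on_tint_integrand1:
  fixes q :: "real \<Rightarrow> real"
  assumes "continuous_on {-1<..} q" "v \<in> {-1<..}"
  shows "continuous_on {0..1} (\<lambda>s. s ^ m * q (s\<^sup>2 * v))"
proof -
  have "continuous_on {0..1} (\<lambda>s. q (s\<^sup>2 * v))"
    by (rule continuous_on_compose2[OF assms(1)])
      (use scale_mem[OF assms(2)] in \<open>auto intro!: continuous_intros\<close>)
  then show ?thesis by (intro continuous_intros)
qed

lemma tint_has_derivative:
  fixes q :: "real \<Rightarrow> real"
  assumes "\<And>x. x \<in> {-1<..} \<Longrightarrow> (q has_real_derivative q' x) (at x)" "continuous_on {-1<..} q'"
    and v: "v \<in> {-1<..}"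
  shows "(tint m q has_real_derivative tint (m + 2) q' v) (at v)"
proof -
  have q: "continuous_on {-1<..} q"
    by (intro continuous_at_imp_continuous_on ballI) (use assms(1) DERIV_isCont in blast)
  have "((\<lambda>v. integral (cbox 0 1) (\<lambda>s. s ^ m * q (s\<^sup>2 * v))) has_field_derivative
     integral (cbox 0 1) (\<lambda>s. s ^ (m + 2) * q' (s\<^sup>2 * v))) (at v within {-1<..})"
  proof (rule leibniz_rule_field_derivative)
    fix x s :: real assume x: "x \<in> {-1<..}" and s: "s \<in> cbox 0 1"
    have "((\<lambda>x. q (s\<^sup>2 * x)) has_real_derivative q' (s\<^sup>2 * x) * s\<^sup>2) (at x within {-1<..})"
      by (rule DERIV_chain2[OF assms(1)])
        (use scale_mem[OF x] s in \<open>auto intro!: derivative_eq_intros\<close>)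
    from DERIV_cmult[OF this, of "s ^ m"]
    show "((\<lambda>x. s ^ m * q (s\<^sup>2 * x)) has_real_derivative s ^ (m + 2) * q' (s\<^sup>2 * x)) (at x within {-1<..})"
      by (simp add: power2_eq_square mult_ac)
  next
    fix x :: real assume "x \<in> {-1<..}"
    from continuous_on_tint_integrand1[OF q this]
    show "(\<lambda>s. s ^ m * q (s\<^sup>2 * x)) integrable_on cbox 0 1"
      by (simp add: integrable_continuous_real)
  next
    show "continuous_on ({-1<..} \<times> cbox 0 1) (\<lambda>(x, s). s ^ (m + 2) * q' (s\<^sup>2 * x))"
      using continuous_on_tint_integrand[OF assms(2), of "m + 2"] by simp
  qed (use v in auto)
  moreover have "at v within {-1<..} = at v" using v by (intro at_within_open) auto
  ultimately show ?thesis by (simp add: tint_def[abs_def])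
qed

lemma has_real_derivative_frechet:
  fixes f :: "real \<Rightarrow> real"
  assumes "(f has_derivative D) (at x)"
  shows "(f has_real_derivative D 1) (at x)"
proof -
  have "linear D" using assms has_derivative_linear by blast
  then have "D h = D 1 * h" for h using linear_scale[of D h 1] by (simp add: mult.commute)
  then have "D = (*) (D 1)" by (rule ext)
  then show ?thesis using assms by (simp add: has_field_derivative_def)
qed

lemma Ck_on_tint:
  assumes "smooth_on {-1<..} q"
  shows "Ck_on k {-1<..} (tint m q)"
  using assms
proof (induction k arbitrary: m q)
  case 0
  have "continuous_on {-1<..} (\<lambda>v. integral (cbox 0 1) (\<lambda>s. s ^ m * q (s\<^sup>2 * v)))"
    by (rule integral_continuous_on_param)
      (use continuous_on_tint_integrand[OF smooth_on_imp_continuous_on[OF 0]] in auto)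
  then show ?case by (simp add: tint_def[abs_def])
next
  case (Suc k)
  define q' where "q' x = frechet_derivative q (at x) 1" for x
  have q': "smooth_on {-1<..} q'"
    unfolding q'_def by (rule smooth_on_frechet_derivative[OF Suc.prems])
  have dq: "(q has_real_derivative q' x) (at x)" if "x \<in> {-1<..}" for x
    unfolding q'_def by (rule has_real_derivative_frechet[OF smooth_on_has_derivative[OF Suc.prems that]])
  have D: "(tint m q has_real_derivative tint (m + 2) q' v) (at v)" if "v \<in> {-1<..}" for v
    by (rule tint_has_derivative[OF dq smooth_on_imp_continuous_on[OF q'] that])
  show ?case
    by (rule Ck_on_SucI_real[OF _ D Suc.IH[OF q']]) auto
qed

text \<open>With \<open>v = r - 1\<close> one has \<open>1 - 1 / r ^ 3 = v * g v\<close>, where \<open>g v = (3 + 3 * v + v\<^sup>2) / (1 + v) ^ 3\<close> is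
  positive for \<open>v > -1\<close>. Substituting \<open>1 + s\<^sup>2 * v\<close> for the integration variable in \<open>t_of_r (1 + v)\<close>
  gives \<open>sqrt v * bsH v\<close>, so that \<open>t\<^sup>2 = bsU v\<close> is a smooth function of \<open>v\<close> also at \<open>v = 0\<close>.\<close>

definition bsq :: "real \<Rightarrow> real" where
  "bsq v = 2 / sqrt ((3 + 3 * v + v\<^sup>2) / (1 + v) ^ 3)"

definition bsq' :: "real \<Rightarrow> real" where
  "bsq' v = frechet_derivative bsq (at v) 1"

definition bsH :: "real \<Rightarrow> real" where
  "bsH = tint 0 bsq"

definition bsU :: "real \<Rightarrow> real" where
  "bsU v = v * (bsH v)\<^sup>2"

lemma quad_pos: "0 < 3 + 3 * v + (v::real)\<^sup>2"
proof -
  have "3 + 3 * v + v\<^sup>2 = (v + 3 / 2)\<^sup>2 + 3 / 4" by (simp add: power2_eq_square algebra_simps)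
  then show ?thesis by (simp add: add_nonneg_pos)
qed

lemma bsq_pos: "-1 < v \<Longrightarrow> 0 < bsq v"
  by (simp add: bsq_def quad_pos)

lemma smooth_on_bsq: "smooth_on {-1<..} bsq"
proof -
  have op: "open {-1::real<..}" by simp
  note poly = smooth_on_add[OF op] smooth_on_mult[OF op] smooth_on_const[OF op]
    smooth_on_linear[OF op bounded_linear_ident]
  have "smooth_on {-1<..} (\<lambda>v::real. (3 + 3 * v + v * v) / ((1 + v) * ((1 + v) * (1 + v))))"
    by (intro smooth_on_divide op poly) auto
  then have "smooth_on {-1<..} (\<lambda>v. sqrt ((3 + 3 * v + v * v) / ((1 + v) * ((1 + v) * (1 + v)))))"
    by (rule smooth_on_compose_real[OF op _ smooth_on_sqrt, rotated])
      (use quad_pos in \<open>auto simp: power2_eq_square\<close>)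
  then have "smooth_on {-1<..} (\<lambda>v. 2 / sqrt ((3 + 3 * v + v * v) / ((1 + v) * ((1 + v) * (1 + v)))))"
    by (rule smooth_on_divide[OF op smooth_on_const[OF op]])
      (metis greaterThan_iff less_irrefl power2_eq_square quad_pos real_sqrt_eq_zero_cancel_iff
        divide_eq_0_iff mult_eq_0_iff add.commute less_add_same_cancel1 less_minus_iff add_eq_0_iff)
  then show ?thesis
    by (rule smooth_on_cong[OF op, rotated]) (simp add: bsq_def power2_eq_square power3_eq_cube mult.assoc)
qed

lemma bsq_has_derivative: "-1 < v \<Longrightarrow> (bsq has_real_derivative bsq' v) (at v)"
  unfolding bsq'_def using smooth_on_has_derivative[OF smooth_on_bsq, of v]
  by (intro has_real_derivative_frechet) auto

lemma continuous_on_bsq: "continuous_on {-1<..} bsq" "continuous_on {-1<..} bsq'"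
  using smooth_on_bsq smooth_on_frechet_derivative[OF smooth_on_bsq, of 1]
  by (auto simp: bsq'_def[abs_def] intro: smooth_on_imp_continuous_on)

lemma smooth_on_bsH: "smooth_on {-1<..} bsH"
  unfolding bsH_def by (rule smooth_onI, rule Ck_on_tint[OF smooth_on_bsq])

lemma bsH_has_derivative: "-1 < v \<Longrightarrow> (bsH has_real_derivative tint 2 bsq' v) (at v)"
  unfolding bsH_def
  by (rule tint_has_derivative[of bsq bsq' v 0, unfolded add_0, OF bsq_has_derivative continuous_on_bsq(2)]) auto

text \<open>Obtained by integrating the derivative of \<open>s * bsq (s\<^sup>2 * v)\<close> over
  the unit interval. It gives closed forms for the derivatives of both \<open>bsU\<close> and
  \<open>sqrt v * bsH v\<close>.\<close>

lemma bsH_ode: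
  assumes v: "-1 < v"
  shows "bsH v + 2 * v * tint 2 bsq' v = bsq v"
proof -
  note c = continuous_on_tint_integrand1[OF continuous_on_bsq(1), of v 0]
    continuous_on_tint_integrand1[OF continuous_on_bsq(2), of v 2]
  have "((\<lambda>s. bsq (s\<^sup>2 * v) + s * (bsq' (s\<^sup>2 * v) * (2 * s * v))) has_integral 1 * bsq (1\<^sup>2 * v) - 0 * bsq (0\<^sup>2 * v)) {0..1}"
  proof (rule fundamental_theorem_of_calculus)
    fix s :: real assume s: "s \<in> {0..1}"
    have "((\<lambda>s. bsq (s\<^sup>2 * v)) has_real_derivative bsq' (s\<^sup>2 * v) * (2 * s * v)) (at s within {0..1})"
      by (rule DERIV_chain2[OF bsq_has_derivative])
        (use scale_mem[of v s] s v in \<open>auto intro!: derivative_eq_intros\<close>)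
    from DERIV_mult[OF DERIV_ident this]
    show "((\<lambda>s. s * bsq (s\<^sup>2 * v)) has_vector_derivative bsq (s\<^sup>2 * v) + s * (bsq' (s\<^sup>2 * v) * (2 * s * v))) (at s within {0..1})"
      by (simp add: has_real_derivative_iff_has_vector_derivative[symmetric] mult_ac)
  qed simp
  moreover have "((\<lambda>s. s ^ 0 * bsq (s\<^sup>2 * v) + 2 * v * (s\<^sup>2 * bsq' (s\<^sup>2 * v))) has_integral bsH v + 2 * v * tint 2 bsq' v) {0..1}"
    unfolding bsH_def tint_def using c v
    by (intro has_integral_add has_integral_mult_right integrable_integral integrable_continuous_real) auto
  ultimately show ?thesis
    by (intro has_integral_unique[of _ _ "{0..1}"]) (simp_all add: power2_eq_square mult_ac)
qed

lemma bsH_pos: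
  assumes "-1 < v"
  shows "0 < bsH v"
proof -
  have c: "continuous_on {0..1} (\<lambda>s. s ^ 0 * bsq (s\<^sup>2 * v))"
    by (rule continuous_on_tint_integrand1[OF continuous_on_bsq(1)]) (use assms in auto)
  have pos: "0 < s ^ 0 * bsq (s\<^sup>2 * v)" if "s \<in> {0..1}" for s
    using scale_mem[of v s] that assms by (simp add: bsq_pos)
  have "0 \<le> bsH v" unfolding bsH_def tint_def
    by (intro integral_nonneg integrable_continuous_real c) (use pos in \<open>auto intro: less_imp_le\<close>)
  moreover have "bsH v \<noteq> 0" unfolding bsH_def tint_def
    by (subst integral_eq_0_iff[OF c]) (use pos bsq_pos[of 0] in \<open>auto intro!: less_imp_le bexI[of _ 0]\<close>)
  ultimately show ?thesis by simp
qed

lemma bsU_has_derivative: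
  assumes "-1 < v"
  shows "(bsU has_real_derivative bsH v * bsq v) (at v)"
  unfolding bsU_def[abs_def] bsH_ode[OF assms, symmetric]
  by (rule derivative_eq_intros bsH_has_derivative assms refl)+ (simp add: power2_eq_square algebra_simps)

lemma bsU_strict_mono:
  assumes "-1 < v" "v < w"
  shows "bsU v < bsU w"
proof (rule DERIV_pos_imp_increasing[OF assms(2)])
  fix x assume "v \<le> x"
  then have "-1 < x" using assms by simp
  then show "\<exists>y. (bsU has_real_derivative y) (at x) \<and> 0 < y"
    using bsU_has_derivative bsH_pos bsq_pos by (metis mult_pos_pos)
qed

text \<open>A crude bound whose purpose is \<open>bsU_ge\<close>: since \<open>bsU v\<close>
  dominates \<open>v\<close>, the intermediate value theorem reaches every nonnegative
  value.\<close>

lemma bsq_ge_1: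
  assumes "0 \<le> v"
  shows "1 \<le> bsq v"
proof -
  have "(3 + 3 * v + v\<^sup>2) / (1 + v) ^ 3 \<le> 4"
  proof (subst pos_divide_le_eq)
    show "3 + 3 * v + v\<^sup>2 \<le> 4 * (1 + v) ^ 3"
      using assms by (simp add: power2_eq_square power3_eq_cube algebra_simps add_nonneg_nonneg)
  qed (use assms in simp)
  then have "sqrt ((3 + 3 * v + v\<^sup>2) / (1 + v) ^ 3) \<le> sqrt 4" by (rule real_sqrt_le_mono)
  moreover have "0 < sqrt ((3 + 3 * v + v\<^sup>2) / (1 + v) ^ 3)" using assms quad_pos[of v] by simp
  ultimately show ?thesis by (simp add: bsq_def le_divide_eq)
qed

lemma bsH_ge_1:
  assumes "0 \<le> v"
  shows "1 \<le> bsH v"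
proof -
  have c: "continuous_on {0..1} (\<lambda>s. s ^ 0 * bsq (s\<^sup>2 * v))"
    by (rule continuous_on_tint_integrand1[OF continuous_on_bsq(1)]) (use assms in auto)
  have "integral {0..1} (\<lambda>s::real. 1 :: real) \<le> integral {0..1} (\<lambda>s. s ^ 0 * bsq (s\<^sup>2 * v))"
    by (intro integral_le integrable_continuous_real c) (use assms bsq_ge_1 in auto)
  then show ?thesis by (simp add: bsH_def tint_def)
qed

lemma bsH_bsq_nonzero: "-1 < v \<Longrightarrow> bsH v \<noteq> 0" "-1 < v \<Longrightarrow> bsq v \<noteq> 0"
  using bsH_pos bsq_pos by (metis less_irrefl)+

lemma bsU_ge: "0 \<le> v \<Longrightarrow> v \<le> bsU v"
  unfolding bsU_def using bsH_ge_1[of v] by (intro mult_le_cancel_left1[THEN iffD2]) auto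

lemma bsU_0 [simp]: "bsU 0 = 0"
  by (simp add: bsU_def)

lemma inj_on_bsU: "inj_on bsU {-1<..}"
  by (rule inj_onI) (metis bsU_strict_mono greaterThan_iff less_irrefl linorder_neqE_linordered_idom)

lemma bsU_less_iff: "-1 < v \<Longrightarrow> -1 < w \<Longrightarrow> bsU v < bsU w \<longleftrightarrow> v < w"
  by (metis bsU_strict_mono less_asym linorder_neqE_linordered_idom)

lemma t_of_r_eq:
  assumes "0 \<le> v"
  shows "t_of_r (1 + v) = sqrt v * bsH v"
proof -
  have "((\<lambda>s. 1 / sqrt (1 - 1 / s ^ 3)) has_integral
      sqrt (1 + v - 1) * bsH (1 + v - 1) - sqrt (1 - 1) * bsH (1 - 1)) {1..1 + v}"
  \<comment> \<open>Only interior derivatives are available: the primitive contains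
    \<open>sqrt (s - 1)\<close>, which has no finite slope at the end point s = 1.\<close>
  proof (rule fundamental_theorem_of_calculus_interior)
    show "continuous_on {1..1 + v} (\<lambda>s. sqrt (s - 1) * bsH (s - 1))"
    proof (rule continuous_on_mult)
      show "continuous_on {1..1 + v} (\<lambda>s. bsH (s - 1))"
        by (rule continuous_on_compose2[OF smooth_on_imp_continuous_on[OF smooth_on_bsH]])
          (auto intro!: continuous_intros)
    qed (intro continuous_intros)
  next
    fix s assume "s \<in> {1<..<1 + v}"
    then have s: "1 < s" by simp
    define w where "w = s - 1"
    have w: "0 < w" using s by (simp add: w_def)
    have "((\<lambda>s. bsH (s - 1)) has_real_derivative tint 2 bsq' w * 1) (at s)"
      unfolding w_def by (rule DERIV_chain2[OF bsH_has_derivative]) (use s in \<open>auto intro!: derivative_eq_intros\<close>)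
    moreover have "((\<lambda>s. sqrt (s - 1)) has_real_derivative inverse (sqrt w) / 2 * 1) (at s)"
      unfolding w_def by (rule DERIV_chain2[OF DERIV_real_sqrt]) (use s in \<open>auto intro!: derivative_eq_intros\<close>)
    ultimately have "((\<lambda>s. sqrt (s - 1) * bsH (s - 1)) has_real_derivative
        inverse (sqrt w) / 2 * 1 * bsH w + tint 2 bsq' w * 1 * sqrt w) (at s)"
      using DERIV_mult[of "\<lambda>s. sqrt (s - 1)" _ s UNIV "\<lambda>s. bsH (s - 1)"] unfolding w_def by blast
    also have "inverse (sqrt w) / 2 * 1 * bsH w + tint 2 bsq' w * 1 * sqrt w
        = (bsH w + 2 * (sqrt w * sqrt w) * tint 2 bsq' w) / (2 * sqrt w)"
      using w by (simp add: field_simps)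
    also have "\<dots> = bsq w / (2 * sqrt w)"
      using w bsH_ode[of w] by simp
    also have "\<dots> = 1 / (sqrt w * sqrt ((3 + 3 * w + w\<^sup>2) / (1 + w) ^ 3))"
      by (simp add: bsq_def)
    also have "\<dots> = 1 / sqrt (w * ((3 + 3 * w + w\<^sup>2) / (1 + w) ^ 3))"
      by (simp only: real_sqrt_mult)
    also have "w * ((3 + 3 * w + w\<^sup>2) / (1 + w) ^ 3) = 1 - 1 / s ^ 3"
      using s by (simp add: w_def field_simps power2_eq_square power3_eq_cube)
    finally show "((\<lambda>s. sqrt (s - 1) * bsH (s - 1)) has_vector_derivative 1 / sqrt (1 - 1 / s ^ 3)) (at s)"
      by (simp add: has_real_derivative_iff_has_vector_derivative)
  qed (use assms in auto)
  then show ?thesis unfolding t_of_r_def by (simp add: integral_unique)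
qed

section \<open>The inverse function, expressing r - 1 through t^2\<close>

definition bsV :: "real \<Rightarrow> real" where
  "bsV = inv_into {-1<..} bsU"

text \<open>The value -1/2 stands for any point of (-1, 0). What matters is an open set that
  contains 0, on which the inverse of \<open>bsU\<close> exists.\<close>

definition bsT :: "real set" where
  "bsT = {bsU (-1 / 2)<..}"

lemma open_bsT [simp]: "open bsT"
  by (simp add: bsT_def)

lemma nonneg_in_bsT: "0 \<le> u \<Longrightarrow> u \<in> bsT"
  using bsU_strict_mono[of "-1/2" 0] by (simp add: bsT_def)

lemma bsV_bsU: "-1 < v \<Longrightarrow> bsV (bsU v) = v"
  unfolding bsV_def by (rule inv_into_f_f[OF inj_on_bsU]) simp

lemma bsU_bsV:
  assumes "u \<in> bsT"
  shows "bsU (bsV u) = u" "-1 < bsV u"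
proof -
  \<comment> \<open>The upper end point is \<open>\<bar>u\<bar>\<close>, because \<open>bsU\<close>
    is at least the identity on nonnegative numbers.\<close>
  have "\<exists>v. -1 / 2 \<le> v \<and> v \<le> \<bar>u\<bar> \<and> bsU v = u"
  proof (rule IVT)
    show "bsU (- 1 / 2) \<le> u" using assms by (simp add: bsT_def)
    show "u \<le> bsU \<bar>u\<bar>" using bsU_ge[of "\<bar>u\<bar>"] by simp
    show "\<forall>x. - 1 / 2 \<le> x \<and> x \<le> \<bar>u\<bar> \<longrightarrow> isCont bsU x"
      using bsU_has_derivative DERIV_isCont by force
  qed simp
  then obtain v where "-1 < v" "bsU v = u" by force
  then have "u \<in> bsU ` {-1<..}" by auto
  from f_inv_into_f[OF this] inv_into_into[OF this]
  show "bsU (bsV u) = u" "-1 < bsV u" by (simp_all add: bsV_def)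
qed

lemma bsV_0 [simp]: "bsV 0 = 0"
  using bsV_bsU[of 0] by simp

lemma bsV_pos:
  assumes "0 < u"
  shows "0 < bsV u"
proof -
  have u: "u \<in> bsT" using assms nonneg_in_bsT by simp
  have "bsU 0 < bsU (bsV u)" using assms bsU_bsV(1)[OF u] by simp
  then show ?thesis using bsU_less_iff[of 0 "bsV u"] bsU_bsV(2)[OF u] by simp
qed

lemma bsV_has_derivative:
  assumes "u \<in> bsT"
  shows "(bsV has_real_derivative inverse (bsH (bsV u) * bsq (bsV u))) (at u)"
proof -
  note v = bsU_bsV[OF assms]
  have "isCont bsV (bsU (bsV u))"
  \<comment> \<open>The radius is half the distance from \<open>bsV u\<close> to -1, which keeps the
    interval inside the domain where \<open>bsU\<close> is injective.\<close>
  proof (rule isCont_inverse_function[where f = bsU and d = "(bsV u + 1) / 2"])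
    fix z assume "\<bar>z - bsV u\<bar> \<le> (bsV u + 1) / 2"
    then have "bsV u - z \<le> (bsV u + 1) / 2" by (simp only: abs_le_iff minus_diff_eq)
    then have "-1 < z" using v(2) by simp
    then show "bsV (bsU z) = z" "isCont bsU z"
      using bsV_bsU bsU_has_derivative DERIV_isCont by blast+
  qed (use v in simp)
  then have c: "isCont bsV u" by (simp add: v)
  show ?thesis
  proof (rule DERIV_inverse_function[where f = bsU and a = "bsU (-1/2)" and b = "u + 1"])
    show "(bsU has_real_derivative bsH (bsV u) * bsq (bsV u)) (at (bsV u))"
      by (rule bsU_has_derivative[OF v(2)])
    show "bsH (bsV u) * bsq (bsV u) \<noteq> 0" using bsH_pos[OF v(2)] bsq_pos[OF v(2)] by simp
    show "bsU (bsV y) = y" if "bsU (-1/2) < y" "y < u + 1" for y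
      using that by (intro bsU_bsV) (simp add: bsT_def)
  qed (use assms c in \<open>auto simp: bsT_def\<close>)
qed

text \<open>Bootstrapping: the derivative of the inverse function is a smooth function of the
  inverse function itself.\<close>

lemma smooth_on_bsV: "smooth_on bsT bsV"
proof (rule smooth_onI)
  fix k
  have sm: "smooth_on {-1<..} (\<lambda>v. inverse (bsH v * bsq v))"
    by (rule smooth_on_compose_real[OF _ _ smooth_on_inverse smooth_on_mult[OF _ smooth_on_bsH smooth_on_bsq]])
      (auto simp: bsH_bsq_nonzero)
  show "Ck_on k bsT bsV"
  proof (induction k)
    case 0
    show ?case unfolding Ck_on.simps(1)
      by (intro continuous_at_imp_continuous_on ballI DERIV_isCont[OF bsV_has_derivative])
  next
    case (Suc k)
    show ?case
      by (rule Ck_on_SucI_real[OF open_bsT bsV_has_derivative Ck_on_compose_real[OF open_bsT _ smooth_onD[OF sm] Suc]])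
        (auto intro: bsU_bsV)
  qed
qed

text \<open>The square of \<open>t_of_r r\<close> is \<open>bsU (r - 1)\<close>. So r depends
  smoothly on t^2 and not merely on t, which is what makes functions of |p| smooth across p =
  0.\<close>

lemma r_of_t_eq:
  assumes "0 \<le> t"
  shows "r_of_t t = 1 + bsV (t\<^sup>2)"
proof -
  have "t\<^sup>2 \<in> bsT" by (rule nonneg_in_bsT) simp
  note V = bsU_bsV[OF this]
  have V0: "0 \<le> bsV (t\<^sup>2)"
    using bsV_pos[of "t\<^sup>2"] by (cases "t = 0") auto
  have sq: "(t_of_r r)\<^sup>2 = bsU (r - 1)" if "1 \<le> r" for r
    using t_of_r_eq[of "r - 1"] that by (simp add: bsU_def power_mult_distrib)
  have inj: "inj_on t_of_r {1..}"
  proof (rule inj_onI)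
    fix x y assume "x \<in> {1..}" "y \<in> {1..}" "t_of_r x = t_of_r y"
    then have "bsU (x - 1) = bsU (y - 1)" "x - 1 \<in> {-1<..}" "y - 1 \<in> {-1<..}"
      using sq[of x] sq[of y] by auto
    then have "x - 1 = y - 1" using inj_onD[OF inj_on_bsU] by blast
    then show "x = y" by simp
  qed
  have "t_of_r (1 + bsV (t\<^sup>2)) = sqrt (bsV (t\<^sup>2) * (bsH (bsV (t\<^sup>2)))\<^sup>2)"
    using t_of_r_eq[OF V0] bsH_pos[OF V(2)] by (simp add: real_sqrt_mult)
  also have "\<dots> = t" using V(1) assms by (simp add: bsU_def)
  finally show ?thesis
    unfolding r_of_t_def using inv_into_f_f[OF inj, of "1 + bsV (t\<^sup>2)"] V0 by simp
qed

text \<open>The even factor of A, with A = t * \<open>bsRho\<close> of t^2: for v = r - 1 one has A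
  = (1 + v)/3 * 2 \<open>sqrt v\<close> / \<open>bsq v\<close> and t =
  \<open>sqrt v * bsH v\<close>.\<close>

definition bsRho :: "real \<Rightarrow> real" where
  "bsRho u = 2 * (1 + bsV u) / (3 * (bsq (bsV u) * bsH (bsV u)))"

text \<open>In terms of r the solution is a0 = 2 (r^2 + r + 1) / (3 r (r + 1)), whence a0 - 1 = -(r
  - 1)(r + 2) / (3 r (r + 1)). Setting r = 1 + v and dividing by t^2 = v *
  \<open>(bsH v)\<^sup>2\<close> gives this function.\<close>

definition bsF :: "real \<Rightarrow> real" where
  "bsF u = - (3 + bsV u) / (3 * (1 + bsV u) * (2 + bsV u) * (bsH (bsV u))\<^sup>2)"

lemma smooth_on_bsRho: "smooth_on bsT bsRho"
proof -
  have op: "open {-1::real<..}" by simp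
  note poly = smooth_on_add[OF op] smooth_on_mult[OF op] smooth_on_const[OF op]
    smooth_on_linear[OF op bounded_linear_ident] smooth_on_bsq smooth_on_bsH
  have "smooth_on {-1<..} (\<lambda>v. 2 * (1 + v) / (3 * (bsq v * bsH v)))"
    by (intro smooth_on_divide op poly) (auto simp: bsH_bsq_nonzero)
  then show ?thesis unfolding bsRho_def[abs_def]
    by (rule smooth_on_compose_real[OF open_bsT _ _ smooth_on_bsV, rotated]) (auto intro: bsU_bsV)
qed

lemma smooth_on_bsF: "smooth_on bsT bsF"
proof -
  have op: "open {-1::real<..}" by simp
  note poly = smooth_on_add[OF op] smooth_on_mult[OF op] smooth_on_const[OF op]
    smooth_on_linear[OF op bounded_linear_ident] smooth_on_bsq smooth_on_bsH
  have "smooth_on {-1<..} (\<lambda>v. (- 3 + - 1 * v) / (3 * (1 + v) * (2 + v) * (bsH v * bsH v)))"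
    by (intro smooth_on_divide op poly) (auto simp: bsH_bsq_nonzero)
  then have "smooth_on bsT (\<lambda>u. (- 3 + - 1 * bsV u) / (3 * (1 + bsV u) * (2 + bsV u) * (bsH (bsV u) * bsH (bsV u))))"
    by (rule smooth_on_compose_real[OF open_bsT _ _ smooth_on_bsV, rotated]) (auto intro: bsU_bsV)
  then show ?thesis unfolding bsF_def[abs_def] by (simp add: power2_eq_square)
qed

lemma inverse_cube_less_1: "1 < r \<Longrightarrow> 1 / r ^ 3 < (1 :: real)"
  by (simp add: divide_less_eq)

lemma one_minus_inverse_cube:
  assumes "-1 < v"
  shows "1 - 1 / (1 + v) ^ 3 = v * ((3 + 3 * v + v\<^sup>2) / (1 + v) ^ 3 :: real)"
proof -
  have c: "(1 + v) ^ 3 - 1 = v * (3 + 3 * v + v\<^sup>2)"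
    by (simp add: power2_eq_square power3_eq_cube algebra_simps)
  have "1 - 1 / (1 + v) ^ 3 = ((1 + v) ^ 3 - 1) / (1 + v) ^ 3"
    using assms by (simp add: diff_divide_distrib)
  then show ?thesis by (simp only: c times_divide_eq_right)
qed

text \<open>With v = r - 1 as parameter, the radial identities turn into algebra in
  \<open>sqrt v\<close>, \<open>bsH v\<close> and \<open>bsq v\<close>.\<close>

lemma radial_parametrization:
  assumes "0 < t"
  obtains v where "0 < v" "bsV (t\<^sup>2) = v" "t = sqrt v * bsH v" "r_of_t t = 1 + v"
    "sqrt (1 - 1 / r_of_t t ^ 3) = 2 * sqrt v / bsq v"
proof
  let ?v = "bsV (t\<^sup>2)"
  show v: "0 < ?v" using bsV_pos assms by simp
  have "bsU ?v = t\<^sup>2" by (intro bsU_bsV nonneg_in_bsT) simp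
  then have "sqrt (?v * (bsH ?v)\<^sup>2) = sqrt (t\<^sup>2)" by (simp only: bsU_def)
  then show "t = sqrt ?v * bsH ?v"
    using assms bsH_pos[of ?v] v by (simp add: real_sqrt_mult)
  show r: "r_of_t t = 1 + ?v" using r_of_t_eq assms by simp
  have "1 - 1 / r_of_t t ^ 3 = ?v * ((3 + 3 * ?v + ?v\<^sup>2) / (1 + ?v) ^ 3)"
    unfolding r using v by (intro one_minus_inverse_cube) simp
  then show "sqrt (1 - 1 / r_of_t t ^ 3) = 2 * sqrt ?v / bsq ?v"
    by (simp only: real_sqrt_mult) (simp add: bsq_def)
qed simp

lemma r_of_t_gt_1: "0 < t \<Longrightarrow> 1 < r_of_t t"
  by (rule radial_parametrization) auto

section \<open>Derivatives of the metric coefficients\<close>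

lemma r_of_t_has_derivative:
  assumes "0 < t"
  shows "(r_of_t has_real_derivative sqrt (1 - 1 / r_of_t t ^ 3)) (at t)"
proof -
  obtain v where v: "0 < v" "bsV (t\<^sup>2) = v" "t = sqrt v * bsH v"
    "sqrt (1 - 1 / r_of_t t ^ 3) = 2 * sqrt v / bsq v"
    by (rule radial_parametrization[OF assms])
  have "((\<lambda>t. bsV (t\<^sup>2)) has_real_derivative inverse (bsH v * bsq v) * (2 * t)) (at t)"
    unfolding v(2)[symmetric]
    by (rule DERIV_chain2[OF bsV_has_derivative[OF nonneg_in_bsT]]) (auto intro!: derivative_eq_intros)
  then have "((\<lambda>t. 1 + bsV (t\<^sup>2)) has_real_derivative 0 + inverse (bsH v * bsq v) * (2 * t)) (at t)"
    by (intro DERIV_add DERIV_const)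
  also have "0 + inverse (bsH v * bsq v) * (2 * t) = sqrt (1 - 1 / r_of_t t ^ 3)"
    unfolding v(4) using bsH_pos[of v] v(1) by (simp add: v(3) field_simps)
  finally show ?thesis
    by (rule has_field_derivative_transform_within_open[where S = "{0<..}"])
      (use assms in \<open>auto simp: r_of_t_eq\<close>)
qed

lemma bsA_eq_Rho: "0 < t \<Longrightarrow> bsA t = t * bsRho (t\<^sup>2)"
proof -
  assume "0 < t"
  then obtain v where v: "0 < v" "bsV (t\<^sup>2) = v" "t = sqrt v * bsH v" "r_of_t t = 1 + v"
    "sqrt (1 - 1 / r_of_t t ^ 3) = 2 * sqrt v / bsq v"
    by (rule radial_parametrization)
  have "bsA t = (1 + v) / 3 * (2 * sqrt v / bsq v)"
    unfolding bsA_def v(5) unfolding v(4) ..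
  moreover have "t * bsRho (t\<^sup>2) = (sqrt v * bsH v) * (2 * (1 + v) / (3 * (bsq v * bsH v)))"
    unfolding bsRho_def v(2) v(3)[symmetric] ..
  moreover have "(1 + v) / 3 * (2 * sqrt v / bsq v) = (sqrt v * bsH v) * (2 * (1 + v) / (3 * (bsq v * bsH v)))"
    using bsH_pos[of v] bsq_pos[of v] v(1) by (simp add: field_simps)
  ultimately show ?thesis by simp
qed

lemma bsA_pos: "0 < t \<Longrightarrow> 0 < bsA t"
  using r_of_t_gt_1[of t] one_less_power[of "r_of_t t" 3] by (simp add: bsA_def)

lemma bsB_sqr: "0 < t \<Longrightarrow> (bsB t)\<^sup>2 = (r_of_t t)\<^sup>2 / 3"
  by (simp add: bsB_def power_divide)

lemma bsB_sqr_gt: "0 < t \<Longrightarrow> 1 / 3 < (bsB t)\<^sup>2"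
  using bsB_sqr r_of_t_gt_1[of t] one_less_power[of "r_of_t t" 2] by simp

lemma bsB_pos: "0 < t \<Longrightarrow> 0 < bsB t"
  using r_of_t_gt_1[of t] by (simp add: bsB_def)

lemma bsB_has_derivative:
  assumes "0 < t"
  shows "(bsB has_real_derivative bsA t / bsB t) (at t)"
proof -
  have "(bsB has_real_derivative sqrt (1 - 1 / r_of_t t ^ 3) / sqrt 3) (at t)"
    unfolding bsB_def[abs_def] by (rule DERIV_cdivide[OF r_of_t_has_derivative[OF assms]])
  also have "sqrt (1 - 1 / r_of_t t ^ 3) / sqrt 3 = bsA t / bsB t"
    using r_of_t_gt_1[OF assms] by (simp add: bsA_def bsB_def field_simps)
  finally show ?thesis .
qed

text \<open>Together with \<open>bsB_has_derivative\<close> this is a closed system for A and B,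
  from which r has been eliminated.\<close>

lemma bsA_has_derivative:
  assumes "0 < t"
  shows "(bsA has_real_derivative (1 - (bsA t)\<^sup>2 / (bsB t)\<^sup>2) / 2) (at t)"
proof -
  define r where "r = r_of_t t"
  define s where "s = sqrt (1 - 1 / r ^ 3)"
  have r: "1 < r" using r_of_t_gt_1[OF assms] by (simp add: r_def)
  then have r3: "1 / r ^ 3 < 1" by (rule inverse_cube_less_1)
  then have s: "0 < s" "s\<^sup>2 = 1 - 1 / r ^ 3" by (simp_all add: s_def)
  have D: "((\<lambda>t. 1 - 1 / r_of_t t ^ 3) has_real_derivative 3 / r ^ 4 * s) (at t)"
  proof (rule DERIV_chain2[of "\<lambda>r. 1 - 1 / r ^ 3"])
    show "((\<lambda>r. 1 - 1 / r ^ 3) has_real_derivative 3 / r ^ 4) (at (r_of_t t))"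
      unfolding r_def[symmetric] using r by (auto intro!: derivative_eq_intros simp: field_simps eval_nat_numeral)
    show "(r_of_t has_real_derivative s) (at t)"
      using r_of_t_has_derivative[OF assms] by (simp only: r_def s_def)
  qed
  have S: "((\<lambda>t. sqrt (1 - 1 / r_of_t t ^ 3)) has_real_derivative inverse s / 2 * (3 / r ^ 4 * s)) (at t)"
    unfolding s_def r_def by (rule DERIV_chain2[OF DERIV_real_sqrt])
      (use r3 D in \<open>auto simp: r_def s_def\<close>)
  have "(bsA has_real_derivative s / 3 * s + inverse s / 2 * (3 / r ^ 4 * s) * (r / 3)) (at t)"
    unfolding bsA_def[abs_def]
    using DERIV_mult[OF DERIV_cdivide[OF r_of_t_has_derivative[OF assms], of 3] S]
    by (simp add: r_def[symmetric] s_def[symmetric])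
  also have "s / 3 * s + inverse s / 2 * (3 / r ^ 4 * s) * (r / 3) = s\<^sup>2 / 3 + 1 / (2 * r ^ 3)"
    using s(1) r by (simp add: field_simps power2_eq_square eval_nat_numeral)
  also have "\<dots> = (1 - s\<^sup>2 / 3) / 2"
    unfolding s(2) by (simp add: field_simps)
  also have "s\<^sup>2 / 3 = (bsA t)\<^sup>2 / (bsB t)\<^sup>2"
    unfolding bsB_sqr[OF assms] bsA_def r_def[symmetric] s_def[symmetric]
    using r by (simp add: field_simps power2_eq_square)
  finally show ?thesis .
qed

section \<open>The explicit solution of the reduced equation\<close>

abbreviation profile :: "real \<Rightarrow> real" where
  "profile \<equiv> \<lambda>t. bsA t / (1 / 2 * ((bsB t)\<^sup>2 - 1 / 3))"

definition bsa :: "real \<Rightarrow> real" where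
  "bsa t = bsA t * profile t"

text \<open>The denominator of \<open>profile\<close> is a primitive of A because B B' = A, so
  \<open>profile\<close> is a logarithmic derivative; this linearises the Riccati equation.\<close>

lemma bsa_has_derivative:
  assumes "0 < t"
  shows "(bsa has_real_derivative (bsa t - (bsa t)\<^sup>2) / bsA t - bsA t * bsa t / (bsB t)\<^sup>2) (at t)"
proof -
  define A B D where "A = bsA t" and "B = bsB t" and "D = B\<^sup>2 - 1 / 3"
  have pos: "0 < A" "0 < B" "0 < D"
    using bsA_pos bsB_pos bsB_sqr_gt assms by (simp_all add: A_def B_def D_def)
  have D: "((\<lambda>t. 1 / 2 * ((bsB t)\<^sup>2 - 1 / 3)) has_real_derivative A) (at t)"
    by (rule derivative_eq_intros bsB_has_derivative[OF assms] refl)+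
      (use pos in \<open>simp add: A_def B_def\<close>)
  have "(bsa has_real_derivative
      ((1 - A\<^sup>2 / B\<^sup>2) / 2 * (A / (1 / 2 * D)) +
        ((1 - A\<^sup>2 / B\<^sup>2) / 2 * (1 / 2 * D) - A * A) / ((1 / 2 * D) * (1 / 2 * D)) * A)) (at t)"
    unfolding bsa_def[abs_def]
    using DERIV_mult[OF bsA_has_derivative[OF assms] DERIV_divide[OF bsA_has_derivative[OF assms] D]] pos
    by (simp add: A_def B_def D_def)
  moreover have "(1 - A\<^sup>2 / B\<^sup>2) / 2 * (A / (1 / 2 * D)) +
      ((1 - A\<^sup>2 / B\<^sup>2) / 2 * (1 / 2 * D) - A * A) / ((1 / 2 * D) * (1 / 2 * D)) * A
    = (A * (A / (1 / 2 * D)) - (A * (A / (1 / 2 * D)))\<^sup>2) / A - A * (A * (A / (1 / 2 * D))) / B\<^sup>2"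
    using pos by (simp add: field_simps power2_eq_square)
  ultimately show ?thesis by (simp add: bsa_def A_def B_def D_def)
qed

lemma bsa_eq_F: "0 < t \<Longrightarrow> bsa t = 1 + t\<^sup>2 * bsF (t\<^sup>2)"
proof -
  assume t: "0 < t"
  then obtain v where v: "0 < v" "bsV (t\<^sup>2) = v" "t = sqrt v * bsH v" "r_of_t t = 1 + v"
    "sqrt (1 - 1 / r_of_t t ^ 3) = 2 * sqrt v / bsq v"
    by (rule radial_parametrization)
  have H: "0 < bsH v" using bsH_pos v(1) by simp
  have r3: "1 / (1 + v) ^ 3 < 1" using v(1) by (intro inverse_cube_less_1) simp
  have s: "(sqrt (1 - 1 / (1 + v) ^ 3))\<^sup>2 = 1 - 1 / (1 + v) ^ 3" using r3 by simp
  have t2: "t\<^sup>2 = v * (bsH v)\<^sup>2" unfolding v(3) using v(1) by (simp add: power_mult_distrib)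
  have "t\<^sup>2 * bsF (t\<^sup>2) = t\<^sup>2 * (- (3 + v) / (3 * (1 + v) * (2 + v) * (bsH v)\<^sup>2))"
    by (simp only: bsF_def v(2))
  also have "\<dots> = v * (bsH v)\<^sup>2 * (- (3 + v) / (3 * (1 + v) * (2 + v) * (bsH v)\<^sup>2))"
    by (simp only: t2)
  also have "\<dots> = - v * (3 + v) / (3 * (1 + v) * (2 + v))"
  proof -
    have "- v * (3 + v) = v * (- 3 - v)" by (simp add: algebra_simps)
    then show ?thesis using H by simp
  qed
  finally have F: "t\<^sup>2 * bsF (t\<^sup>2) = \<dots>" .
  have "bsa t = (bsA t)\<^sup>2 * 2 / ((bsB t)\<^sup>2 - 1 / 3)"
    by (simp add: bsa_def power2_eq_square)
  also have "\<dots> = (1 + v)\<^sup>2 / 9 * (1 - 1 / (1 + v) ^ 3) * 2 / ((1 + v)\<^sup>2 / 3 - 1 / 3)"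
    unfolding bsB_sqr[OF t] unfolding bsA_def v(4) power_mult_distrib s power_divide by simp
  also have "(1 + v)\<^sup>2 / 3 - 1 / 3 = v * (2 + v) / 3"
    by (simp add: power2_eq_square field_simps)
  also have "(1 + v)\<^sup>2 / 9 * (1 - 1 / (1 + v) ^ 3) * 2 / (v * (2 + v) / 3)
      = 1 + (- v * (3 + v) / (3 * (1 + v) * (2 + v)))"
    using v(1) by (simp add: divide_simps power2_eq_square power3_eq_cube) (simp add: algebra_simps)
  finally show ?thesis unfolding F .
qed

lemma bsRho_0: "bsRho 0 = 1 / 2"
proof -
  have "bsH 0 = bsq 0" using bsH_ode[of 0] by simp
  moreover have "bsq 0 * bsq 0 = 4 / 3" by (simp add: bsq_def)
  ultimately show ?thesis using bsq_pos[of 0] by (simp add: bsRho_def)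
qed

lemma isCont_bsV: "isCont bsV 0" and isCont_bsRho: "isCont bsRho 0"
proof -
  have 0: "0 \<in> bsT" by (rule nonneg_in_bsT) simp
  then show "isCont bsV 0" "isCont bsRho 0"
    using continuous_on_eq_continuous_at[OF open_bsT] smooth_on_imp_continuous_on[OF smooth_on_bsV]
      smooth_on_imp_continuous_on[OF smooth_on_bsRho] by auto
qed

lemma bs_limits:
  "((\<lambda>t. bsA t / t) \<longlongrightarrow> 1 / 2) (at_right 0)" "(bsA \<longlongrightarrow> 0) (at_right 0)"
  "((\<lambda>t. (bsB t)\<^sup>2) \<longlongrightarrow> 1 / 3) (at_right 0)"
proof -
  have sq: "((\<lambda>t::real. t\<^sup>2) \<longlongrightarrow> 0) (at_right 0)" by (auto intro!: tendsto_eq_intros)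
  have ev: "eventually (\<lambda>t::real. 0 < t) (at_right 0)" by (simp add: eventually_at_right_less)
  have "((\<lambda>t. bsRho (t\<^sup>2)) \<longlongrightarrow> bsRho 0) (at_right 0)"
    by (rule isCont_tendsto_compose[OF isCont_bsRho sq])
  then show lam: "((\<lambda>t. bsA t / t) \<longlongrightarrow> 1 / 2) (at_right 0)"
    unfolding bsRho_0
    by (rule Lim_transform_eventually) (use ev in \<open>auto elim!: eventually_mono simp: bsA_eq_Rho\<close>)
  have "((\<lambda>t. bsA t / t * t) \<longlongrightarrow> 0) (at_right 0)"
    using tendsto_mult[OF lam tendsto_ident_at] by simp
  then show "(bsA \<longlongrightarrow> 0) (at_right 0)"
    by (rule Lim_transform_eventually[OF _ eventually_mono[OF ev]]) simp_all
  have "((\<lambda>t. (1 + bsV (t\<^sup>2))\<^sup>2 / 3) \<longlongrightarrow> (1 + bsV 0)\<^sup>2 / 3) (at_right 0)"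
    by (intro tendsto_intros isCont_tendsto_compose[OF isCont_bsV sq]) simp
  then show "((\<lambda>t. (bsB t)\<^sup>2) \<longlongrightarrow> 1 / 3) (at_right 0)"
    by (rule Lim_transform_eventually[OF _ eventually_mono[OF ev], THEN tendsto_eq_rhs])
      (simp_all add: bsB_sqr r_of_t_eq)
qed

section \<open>Transport to the total space\<close>

definition dnorm :: "quat \<Rightarrow> quat \<Rightarrow> quat" where
  "dnorm a w = w /\<^sub>R norm a - ((a \<bullet> w) / norm a ^ 3) *\<^sub>R a"

lemma has_derivative_normalize:
  assumes "a \<noteq> 0"
  shows "((\<lambda>a. a /\<^sub>R norm a) has_derivative dnorm a) (at a)"
proof -
  have "((\<lambda>a. inverse (norm a)) has_derivative
      (\<lambda>w. - (inverse (norm a) * (w \<bullet> sgn a) * inverse (norm a)))) (at a)"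
    using assms by (intro Deriv.has_derivative_inverse has_derivative_norm) auto
  from has_derivative_scaleR[OF this has_derivative_ident]
  show ?thesis
    by (rule has_derivative_eq_rhs)
      (simp add: fun_eq_iff dnorm_def sgn_div_norm inner_commute divide_inverse power3_eq_cube mult_ac)
qed

lemma mcn_normalize: "a \<noteq> 0 \<Longrightarrow> mcn (a /\<^sub>R norm a) (dnorm a w) = mcn a w"
  by (simp add: dnorm_def mcn_homogeneous mcn_diff mcn_scaleR)

lemma inner_dnorm: "a \<bullet> dnorm a w = 0"
  by (cases "a = 0")
    (simp_all add: dnorm_def inner_diff_right dot_square_norm power3_eq_cube power2_eq_square field_simps)

lemma dnorm_unit: "norm a = 1 \<Longrightarrow> a \<bullet> w = 0 \<Longrightarrow> dnorm a w = w"
  by (simp add: dnorm_def)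

definition dpr :: "tot \<Rightarrow> tot \<Rightarrow> quat \<times> quat" where
  "dpr z v = (fst v, fst (snd z) \<odot> qcnj (snd (snd v)) + fst (snd v) \<odot> qcnj (snd (snd z)))"

lemma has_derivative_pr: "(pr has_derivative dpr z) (at z)"
proof -
  have eq: "pr = (\<lambda>z. (fst z, fst (snd z) \<odot> qcnj (snd (snd z))))"
    by (simp add: pr_def case_prod_unfold)
  show ?thesis unfolding eq dpr_def
    by (intro has_derivative_Pair qmul.FDERIV has_derivative_qcnj has_derivative_fst has_derivative_snd
        has_derivative_ident)
qed

definition dPhi_inv :: "quat \<times> quat \<Rightarrow> quat \<times> quat \<Rightarrow> cyl" where
  "dPhi_inv m y = ((fst m \<bullet> fst y) / norm (fst m), dnorm (fst m) (fst y),
     qcnj (snd m) \<odot> dnorm (fst m) (fst y) + qcnj (snd y) \<odot> (fst m /\<^sub>R norm (fst m)))"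

lemma has_derivative_Phi_inv:
  assumes "fst m \<noteq> 0"
  shows "(Phi_inv has_derivative dPhi_inv m) (at m)"
proof -
  have eq: "Phi_inv = (\<lambda>m. (norm (fst m), fst m /\<^sub>R norm (fst m), qcnj (snd m) \<odot> (fst m /\<^sub>R norm (fst m))))"
    by (simp add: Phi_inv_def case_prod_unfold)
  have t: "((\<lambda>m. norm (fst m)) has_derivative (\<lambda>y. (fst m \<bullet> fst y) / norm (fst m))) (at m)"
    by (rule has_derivative_eq_rhs[OF has_derivative_compose[OF has_derivative_fst[OF has_derivative_ident]
          has_derivative_norm]])
      (use assms in \<open>auto simp: fun_eq_iff sgn_div_norm inner_commute divide_inverse\<close>)
  have g: "((\<lambda>m. fst m /\<^sub>R norm (fst m)) has_derivative (\<lambda>y. dnorm (fst m) (fst y))) (at m)"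
    by (rule has_derivative_compose[OF has_derivative_fst[OF has_derivative_ident]
          has_derivative_normalize[OF assms]])
  show ?thesis unfolding eq dPhi_inv_def
    by (intro has_derivative_Pair qmul.FDERIV has_derivative_qcnj t g has_derivative_snd has_derivative_ident)
qed

text \<open>\<open>frZ\<close> is \<open>(norm p)\<^sup>2 *\<^sub>R (frP + frN)\<close>, which unlike \<open>frP\<close> is smooth across \<open>p = 0\<close>.\<close>

definition frZ :: "tot \<Rightarrow> tot \<Rightarrow> real^3" where
  "frZ z v = Ad (qcnj (fst (snd z))) (snd (fst v \<odot> qcnj (fst z))) /\<^sub>R (norm (fst (snd z)))\<^sup>2"

text \<open>Separates the two contributions to the derivative of \<open>qcnj p \<odot> a1\<close>:
  varying \<open>a1\<close> gives \<open>mu1\<close>, varying \<open>p\<close> gives the other term.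
  The factor |p|^-2 is thus the only singularity of \<open>mu3\<close> at p = 0.\<close>

lemma mu3_eq:
  assumes "fst z \<noteq> 0" "fst (snd z) \<noteq> 0"
  shows "mu3 z v = mu1 z v - frZ z v /\<^sub>R (norm (fst z))\<^sup>2"
proof -
  have "mu3 z v = mcn (qcnj (fst z) \<odot> fst (snd z)) (qcnj (fst z) \<odot> fst (snd v))
      + mcn (qcnj (fst z) \<odot> fst (snd z)) (qcnj (fst v) \<odot> fst (snd z))"
    by (simp add: mu3_def case_prod_unfold mcn_add)
  also have "mcn (qcnj (fst z) \<odot> fst (snd z)) (qcnj (fst z) \<odot> fst (snd v)) = mu1 z v"
    using assms by (simp add: mcn_qmul_cancel qcnj_eq_0_iff mu1_def case_prod_unfold)
  also have "mcn (qcnj (fst z) \<odot> fst (snd z)) (qcnj (fst v) \<odot> fst (snd z))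
      = - (frZ z v /\<^sub>R (norm (fst z))\<^sup>2)"
    using snd_qcnj_qmul_swap[of "qcnj (fst z)" "qcnj (fst v)"]
    unfolding mcn_qmul_right
    by (simp add: mcn_def frZ_def linear_scale[OF linear_Ad] linear_neg[OF linear_Ad] mult.commute)
  finally show ?thesis by simp
qed

lemma frP_eq:
  assumes "fst z \<noteq> 0" "fst (snd z) \<noteq> 0"
  shows "frP z v = frZ z v /\<^sub>R (norm (fst z))\<^sup>2 - frN z v"
  unfolding frP_def frN_def mu3_eq[OF assms] by (simp add: vec_eq_iff field_simps)

text \<open>The point \<open>z\<close> is the right translate by \<open>h\<close> of the canonical
  section over the same base point. This explains the common rotation \<open>Ad h\<close> of both
  frames, to which the four-form is insensitive.\<close>

lemma eta_Phi_inv: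
  fixes z v :: tot
  assumes p: "fst z \<noteq> 0" and a: "fst (snd z) \<in> SU2" "snd (snd z) \<in> SU2"
  defines "n \<equiv> Phi_inv (pr z)" and "y \<equiv> dPhi_inv (pr z) (dpr z v)"
    and "h \<equiv> qcnj (fst z /\<^sub>R norm (fst z)) \<odot> fst (snd z)"
  shows "fst n = norm (fst z)" "fst y = frt z v" "etaP n y = Ad h (frP z v)" "etaN n y = Ad h (frN z v)"
proof -
  obtain p a1 a2 where z: "z = (p, a1, a2)" by (cases z)
  obtain u w1 w2 where v: "v = (u, w1, w2)" by (cases v)
  define g1 where "g1 = p /\<^sub>R norm p"
  define q where "q = a1 \<odot> qcnj a2"
  define w where "w = a1 \<odot> qcnj w2 + w1 \<odot> qcnj a2"
  have p0: "p \<noteq> 0" and a1: "a1 \<in> SU2" and a2: "a2 \<in> SU2" using p a by (simp_all add: z)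
  have a10: "a1 \<noteq> 0" using a1 by (auto simp: SU2_iff)
  have g1: "g1 \<in> SU2" using p0 by (simp add: g1_def SU2_iff)
  have q: "q \<in> SU2" using a1 a2 by (simp add: q_def SU2_iff norm_qmul)
  have n: "n = (norm p, g1, qcnj q \<odot> g1)"
    by (simp add: n_def z pr_def Phi_inv_def g1_def q_def)
  have y: "y = (frt z v, dnorm p u, qcnj q \<odot> dnorm p u + qcnj w \<odot> g1)"
    by (simp add: y_def z v pr_def dPhi_inv_def dpr_def frt_def g1_def q_def w_def)
  show "fst n = norm (fst z)" "fst y = frt z v" by (simp_all add: n y z)
  have h: "h = qcnj g1 \<odot> a1" by (simp add: h_def z g1_def)
  have Adh: "Ad h (Ad (qcnj a1) \<xi>) = Ad (qcnj g1) \<xi>" for \<xi>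
    by (simp add: h qmul_assoc SU2_cancel[OF a1] flip: Ad_qmul)
  have Z: "frZ z v = Ad (qcnj a1) (snd (u \<odot> qcnj p))"
    using a1 by (simp add: frZ_def z v SU2_iff)
  have m1: "mc g1 (dnorm p u) = Ad h (mu1 z v - mu3 z v)"
  proof -
    have "mc g1 (dnorm p u) = mcn p u"
      using mcn_eq_mc[OF g1] mcn_normalize[OF p0] by (simp add: g1_def)
    also have "\<dots> = Ad (qcnj g1) (snd (u \<odot> qcnj p)) /\<^sub>R (norm p)\<^sup>2"
    proof -
      have "qcnj g1 \<odot> (u \<odot> qcnj p) \<odot> qcnj (qcnj g1) = qcnj g1 \<odot> u \<odot> (qcnj p \<odot> g1)"
        by (simp add: qmul_assoc)
      also have "qcnj p \<odot> g1 = (norm p, 0)"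
        using p0 by (simp add: g1_def qmul.scaleR_right qcnj_self power2_eq_square)
      also have "qcnj g1 \<odot> u \<odot> (norm p, 0) = qcnj p \<odot> u"
        using p0 by (simp add: qmul_real g1_def qcnj_scaleR qmul.scaleR_left)
      finally show ?thesis by (simp add: Ad_snd mcn_def)
    qed
    also have "\<dots> = Ad h (mu1 z v - mu3 z v)"
      using p0 a10 by (simp add: mu3_eq z Z[unfolded z] linear_scale[OF linear_Ad] Adh)
    finally show ?thesis .
  qed
  have m2: "mc (qcnj q \<odot> g1) (qcnj q \<odot> dnorm p u + qcnj w \<odot> g1)
      = mc g1 (dnorm p u) + Ad h (mu2 z v - mu1 z v)"
  proof -
    have "qcnj (qcnj q \<odot> g1) \<odot> (qcnj q \<odot> dnorm p u + qcnj w \<odot> g1)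
        = qcnj g1 \<odot> ((q \<odot> qcnj q) \<odot> dnorm p u) + qcnj g1 \<odot> (q \<odot> qcnj w) \<odot> qcnj (qcnj g1)"
      by (simp add: qcnj_qmul qmul.add_right qmul_assoc)
    then have "mc (qcnj q \<odot> g1) (qcnj q \<odot> dnorm p u + qcnj w \<odot> g1)
        = mc g1 (dnorm p u) + Ad (qcnj g1) (snd (q \<odot> qcnj w))"
      by (simp add: mc_def SU2_cancel[OF q] Ad_snd)
    also have "q \<odot> qcnj w = a1 \<odot> (qcnj a2 \<odot> w2 + qcnj (qcnj a1 \<odot> w1)) \<odot> qcnj a1"
    proof -
      have "q \<odot> qcnj w = a1 \<odot> (qcnj a2 \<odot> w2) \<odot> qcnj a1 + a1 \<odot> ((qcnj a2 \<odot> a2) \<odot> qcnj w1)"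
        by (simp add: q_def w_def qcnj_add qcnj_qmul qmul.add_right qmul_assoc)
      also have "a1 \<odot> ((qcnj a2 \<odot> a2) \<odot> qcnj w1) = a1 \<odot> qcnj w1 \<odot> (a1 \<odot> qcnj a1)"
        by (simp add: SU2_cancel[OF a1] SU2_cancel[OF a2])
      finally show ?thesis by (simp add: qmul.add_right qmul.add_left qcnj_qmul qmul_assoc)
    qed
    also have "snd (a1 \<odot> (qcnj a2 \<odot> w2 + qcnj (qcnj a1 \<odot> w1)) \<odot> qcnj a1) = Ad a1 (mu2 z v - mu1 z v)"
      using a1 a2 by (simp add: Ad_snd[symmetric] mu1_def mu2_def z v mcn_def SU2_iff)
        (simp add: qcnj_def)
    finally show ?thesis by (simp add: h Ad_qmul)
  qed
  show "etaP n y = Ad h (frP z v)" "etaN n y = Ad h (frN z v)"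
    unfolding n y etaP_def etaN_def prod.case m2 m1
    by (simp_all add: frP_def frN_def linear_add[OF linear_Ad] linear_diff[OF linear_Ad]
        linear_scale[OF linear_Ad] vec_eq_iff field_simps)
qed

lemma pullback_pr_psi:
  assumes p: "fst z \<noteq> 0" and a: "fst (snd z) \<in> SU2" "snd (snd z) \<in> SU2"
  shows "pullback Phi_inv bs_psi (pr z) (map (dpr z) vs)
    = form_at (psi_at z) vs"
    and "pullback pr psi z vs = pullback Phi_inv bs_psi (pr z) (map (dpr z) vs)"
proof -
  define h where "h = qcnj (fst z /\<^sub>R norm (fst z)) \<odot> fst (snd z)"
  have h: "h \<in> SU2" using p a by (simp add: h_def SU2_iff norm_qmul)
  have fpr: "fst (pr z) = fst z" by (simp add: pr_def case_prod_unfold)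
  then have p': "fst (pr z) \<noteq> 0" using p by simp
  have fd: "frechet_derivative Phi_inv (at (pr z)) = dPhi_inv (pr z)" "frechet_derivative pr (at z) = dpr z"
    using frechet_derivative_at[OF has_derivative_Phi_inv[OF p']] frechet_derivative_at[OF has_derivative_pr]
    by simp_all
  have "psi_form A B (frt z) (\<lambda>v. Ad h (frP z v)) (\<lambda>v. Ad h (frN z v)) = psi_form A B (frt z) (frP z) (frN z)"
    for A B by (rule psi_form_rotate) (simp_all add: Ad_inner[OF h] Ad_cross3[OF h])
  then show "pullback Phi_inv bs_psi (pr z) (map (dpr z) vs)
    = form_at (psi_at z) vs"
    by (simp add: pullback_def fd bs_psi_eq form_at_psi_map eta_Phi_inv[OF p a] o_def
        flip: h_def)
  show "pullback pr psi z vs = pullback Phi_inv bs_psi (pr z) (map (dpr z) vs)"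
    using p' by (simp add: pullback_def[of pr] psi_def fd case_prod_unfold)
qed

section \<open>Extension of forms along the retraction\<close>

definition dretr :: "tot \<Rightarrow> tot \<Rightarrow> tot" where
  "dretr z v = (fst v, dnorm (fst (snd z)) (fst (snd v)), dnorm (snd (snd z)) (snd (snd v)))"

lemma has_derivative_retr:
  assumes "fst (snd z) \<noteq> 0" "snd (snd z) \<noteq> 0"
  shows "(retr has_derivative dretr z) (at z)"
proof -
  have eq: "retr = (\<lambda>z. (fst z, fst (snd z) /\<^sub>R norm (fst (snd z)), snd (snd z) /\<^sub>R norm (snd (snd z))))"
    by (simp add: retr_def case_prod_unfold)
  show ?thesis unfolding eq dretr_def
    by (intro has_derivative_Pair has_derivative_fst has_derivative_ident
        has_derivative_compose[OF _ has_derivative_normalize, of "\<lambda>z. fst (snd z)"]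
        has_derivative_compose[OF _ has_derivative_normalize, of "\<lambda>z. snd (snd z)"]
        has_derivative_snd assms)
qed

lemma ext_eq:
  assumes "fst (snd z) \<noteq> 0" "snd (snd z) \<noteq> 0"
  shows "ext A z v = A (retr z) (dretr z v)"
  unfolding ext_def frechet_derivative_at[OF has_derivative_retr[OF assms], symmetric] ..

lemma retr_id: "fst (snd z) \<in> SU2 \<Longrightarrow> snd (snd z) \<in> SU2 \<Longrightarrow> retr z = z"
  by (cases z) (auto simp: retr_def SU2_iff simp del: scaleR_Pair)

lemma SU2_nonzero: "a \<in> SU2 \<Longrightarrow> a \<noteq> 0"
  by (auto simp: SU2_iff)

lemma T_P_iff: "v \<in> T_P z \<longleftrightarrow> fst (snd z) \<bullet> fst (snd v) = 0 \<and> snd (snd z) \<bullet> snd (snd v) = 0"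
  by (simp add: T_P_def case_prod_unfold)

lemma ext_tangent:
  assumes "fst (snd z) \<in> SU2" "snd (snd z) \<in> SU2" "v \<in> T_P z"
  shows "ext A z v = A z v"
proof -
  have "dretr z v = v"
    using assms by (simp add: dretr_def T_P_iff dnorm_unit SU2_iff)
  then show ?thesis
    using assms by (simp add: ext_eq SU2_nonzero retr_id)
qed

lemma dretr_T_P: "dretr z v \<in> T_P (retr z)"
  by (simp add: T_P_iff dretr_def retr_def case_prod_unfold inner_dnorm)

text \<open>These forms do not change when \<open>a1\<close>, \<open>a2\<close> and their variations
  are normalised. Hence \<open>ext\<close> of a connection built from them is given by the same
  formula on an open subset of the ambient space.\<close>

lemma mu_retr:
  assumes "fst (snd z) \<noteq> 0" "snd (snd z) \<noteq> 0"
  shows "mu1 (retr z) (dretr z v) = mu1 z v" "mu2 (retr z) (dretr z v) = mu2 z v"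
    "frN (retr z) (dretr z v) = frN z v" "frZ (retr z) (dretr z v) = frZ z v"
proof -
  show 1: "mu1 (retr z) (dretr z v) = mu1 z v" and 2: "mu2 (retr z) (dretr z v) = mu2 z v"
    using assms by (simp_all add: mu1_def mu2_def retr_def dretr_def case_prod_unfold mcn_normalize)
  show "frN (retr z) (dretr z v) = frN z v" by (simp add: frN_def 1 2)
  have "Ad (s *\<^sub>R b) \<xi> = s\<^sup>2 *\<^sub>R Ad b \<xi>" for s b \<xi>
    by (simp add: Ad_def qcnj_scaleR qmul.scaleR_left qmul.scaleR_right power2_eq_square)
  then show "frZ (retr z) (dretr z v) = frZ z v"
    using assms by (simp add: frZ_def retr_def dretr_def case_prod_unfold qcnj_scaleR power_inverse)
qed

lemma gen_retr:
  assumes "fst z \<noteq> 0" "fst (snd z) \<noteq> 0" "snd (snd z) \<noteq> 0"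
  shows "gen a b (retr z) (dretr z v) = gen a b z v"
proof -
  have r: "fst (retr z) = fst z" "fst (snd (retr z)) \<noteq> 0"
    using assms by (simp_all add: retr_def case_prod_unfold)
  show ?thesis
    using assms r by (simp add: gen_def frP_eq mu3_eq mu_retr)
qed

section \<open>The four-form along the singular orbit\<close>

lemma Ad_norm: "h \<in> SU2 \<Longrightarrow> norm (Ad h \<xi>) = norm \<xi>"
  by (simp add: norm_eq_sqrt_inner Ad_inner)

definition frE :: "tot \<Rightarrow> tot \<Rightarrow> real^3" where
  "frE z v = frZ z v /\<^sub>R norm (fst z)"

text \<open>Up to the factor -1/2 and the rotation by \<open>qcnj a\<close>, a component of the
  quaternion-valued two-form dp \<and> d(qcnj p). Its coefficients do not depend on
  \<open>p\<close>.\<close>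

definition sigma_form :: "quat \<Rightarrow> 3 \<Rightarrow> tot form" where
  "sigma_form a k = Form (\<lambda>l. case l of [u, v] \<Rightarrow> - (Ad (qcnj a) (snd (fst u \<odot> qcnj (fst v))) $ k) | _ \<Rightarrow> 0)"

text \<open>Before the rotation by \<open>Ad\<close>, \<open>frt\<close> and \<open>frE\<close> are
  the real and imaginary parts of X u = u qcnj(p)/|p|. The unit factor qcnj(p)/|p| cancels in X u
  qcnj(X v), so this combination is independent of \<open>p\<close> although \<open>frt\<close> and
  \<open>frE\<close> are not.\<close>

lemma frE_self_dual:
  assumes p: "fst z \<noteq> 0" and a: "fst (snd z) \<in> SU2"
  shows "cross3 (frE z u) (frE z v) + frt z u *\<^sub>R frE z v - frt z v *\<^sub>R frE z u
    = - Ad (qcnj (fst (snd z))) (snd (fst u \<odot> qcnj (fst v)))"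
proof -
  define t where "t = norm (fst z)"
  define X where "X u = (fst u \<odot> qcnj (fst z)) /\<^sub>R t" for u :: tot
  have t: "t \<noteq> 0" using p by (simp add: t_def)
  have a': "qcnj (fst (snd z)) \<in> SU2" using a by (simp add: SU2_iff)
  have E: "frE z u = Ad (qcnj (fst (snd z))) (snd (X u))" for u
    using a by (simp add: frE_def frZ_def X_def t_def SU2_iff linear_scale[OF linear_Ad])
  have e: "frt z u = fst (X u)" for u
    using fst_qcnj_qmul[of "qcnj (fst u)" "qcnj (fst z)"]
    by (simp add: frt_def X_def t_def inner_qcnj inner_commute divide_inverse mult.commute)
  have "X u \<odot> qcnj (X v) = fst u \<odot> ((qcnj (fst z) \<odot> fst z) \<odot> qcnj (fst v)) /\<^sub>R t\<^sup>2"
    by (simp add: X_def qcnj_scaleR qcnj_qmul qmul.scaleR_left qmul.scaleR_right qmul_assoc power2_eq_square)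
  also have "\<dots> = fst u \<odot> qcnj (fst v)"
    using t by (simp add: qcnj_self t_def[symmetric] qmul_real qmul.scaleR_right)
  finally have XX: "X u \<odot> qcnj (X v) = fst u \<odot> qcnj (fst v)" .
  have "snd (X u \<odot> qcnj (X v)) = fst (X v) *\<^sub>R snd (X u) - fst (X u) *\<^sub>R snd (X v) - cross3 (snd (X u)) (snd (X v))"
    using snd_qcnj_qmul[of "qcnj (X u)" "qcnj (X v)"]
    by (simp add: qcnj_def cross_minus_left cross_minus_right)
  then show ?thesis
    unfolding XX E e Ad_cross3[OF a', symmetric]
    by (simp add: linear_diff[OF linear_Ad] linear_scale[OF linear_Ad])
qed

lemma cov_mult_add_eqI:
  assumes "\<And>u v. a u * b v - a v * b u + (c u * d v - c v * d u) = f u v"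
  shows "cov a * cov b + cov c * cov d = Form (\<lambda>l. case l of [u, v] \<Rightarrow> f u v | _ \<Rightarrow> 0)"
  by (rule form_eqI) (auto simp: form_at_linear cov_mult_cov Form_inverse assms split: list.splits)

lemma sigma_form_eq:
  assumes "fst z \<noteq> 0" "fst (snd z) \<in> SU2"
  shows "cvec (frE z) 2 * cvec (frE z) 3 + cov (frt z) * cvec (frE z) 1 = sigma_form (fst (snd z)) 1"
    "cvec (frE z) 3 * cvec (frE z) 1 + cov (frt z) * cvec (frE z) 2 = sigma_form (fst (snd z)) 2"
    "cvec (frE z) 1 * cvec (frE z) 2 + cov (frt z) * cvec (frE z) 3 = sigma_form (fst (snd z)) 3"
proof -
  have *: "- (Ad (qcnj (fst (snd z))) (snd (fst u \<odot> qcnj (fst v))) $ k)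
      = (cross3 (frE z u) (frE z v) + frt z u *\<^sub>R frE z v - frt z v *\<^sub>R frE z u) $ k" for u v k
    unfolding frE_self_dual[OF assms] by simp
  show "cvec (frE z) 2 * cvec (frE z) 3 + cov (frt z) * cvec (frE z) 1 = sigma_form (fst (snd z)) 1"
    unfolding cvec_def sigma_form_def by (rule cov_mult_add_eqI) (simp only: *, simp add: cross3_def)
  show "cvec (frE z) 3 * cvec (frE z) 1 + cov (frt z) * cvec (frE z) 2 = sigma_form (fst (snd z)) 2"
    unfolding cvec_def sigma_form_def by (rule cov_mult_add_eqI) (simp only: *, simp add: cross3_def)
  show "cvec (frE z) 1 * cvec (frE z) 2 + cov (frt z) * cvec (frE z) 3 = sigma_form (fst (snd z)) 3"
    unfolding cvec_def sigma_form_def by (rule cov_mult_add_eqI) (simp only: *, simp add: cross3_def)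
qed

text \<open>On the right, \<open>- 4 / 3\<close> and \<open>1 / 2\<close> are the limits at \<open>t = 0\<close>, where \<open>r = A / t\<close> tends to \<open>1 / 2\<close> and
  \<open>B\<^sup>2\<close> to \<open>1 / 3\<close>; all the other coefficients tend to 0.\<close>

lemma psi_form_split:
  fixes F N :: "'v \<Rightarrow> real^3"
  assumes "t \<noteq> 0" "A = r * t"
  defines "n \<equiv> cvec N" and "E \<equiv> cvec F"
  shows "psi_form A B e (\<lambda>v. F v /\<^sub>R t - N v) N
    = (- 4 / 3) *\<^sub>R (n 1 * (n 2 * (E 1 * E 2 + cov e * E 3)) + n 2 * (n 3 * (E 2 * E 3 + cov e * E 1))
        + n 3 * (n 1 * (E 3 * E 1 + cov e * E 2)))
      + (1 / 2) *\<^sub>R ((E 2 * E 3 + cov e * E 1) * (E 2 * E 3 + cov e * E 1))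
      + (4 / 3 - 16 * r\<^sup>2 * B\<^sup>2) *\<^sub>R (n 1 * (n 2 * (E 1 * E 2)) + n 2 * (n 3 * (E 2 * E 3)) + n 3 * (n 1 * (E 3 * E 1)))
      + (4 / 3 - 8 * r * B\<^sup>2) *\<^sub>R (n 1 * (n 2 * (cov e * E 3)) + n 2 * (n 3 * (cov e * E 1)) + n 3 * (n 1 * (cov e * E 2)))
      + (8 * r ^ 3 - 1) *\<^sub>R (cov e * (E 1 * (E 2 * E 3)))
      + (A * (24 * B\<^sup>2 - 8 * A\<^sup>2)) *\<^sub>R (cov e * (n 1 * (n 2 * n 3)))
      + (- 8 * A * r\<^sup>2) *\<^sub>R (cov e * (E 1 * (E 2 * n 3)) + cov e * (E 2 * (E 3 * n 1)) + cov e * (E 3 * (E 1 * n 2)))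
      + (8 * A\<^sup>2 * r) *\<^sub>R (cov e * (n 1 * (n 2 * E 3)) + cov e * (n 2 * (n 3 * E 1)) + cov e * (n 3 * (n 1 * E 2)))"
proof -
  define c where "c = (\<lambda>k::nat. [e, \<lambda>v. F v $ 1, \<lambda>v. F v $ 2, \<lambda>v. F v $ 3, \<lambda>v. N v $ 1, \<lambda>v. N v $ 2, \<lambda>v. N v $ 3] ! k)"
  have P: "cvec (\<lambda>v. F v /\<^sub>R t - N v) i = (1 / t) *\<^sub>R cvec F i - cvec N i" for i
    unfolding cvec_def by (simp add: cov_diff cov_scaleR divide_inverse)
  have g: "cov e = cov (c 0)" "cvec F 1 = cov (c 1)" "cvec F 2 = cov (c 2)" "cvec F 3 = cov (c 3)"
    "cvec N 1 = cov (c 4)" "cvec N 2 = cov (c 5)" "cvec N 3 = cov (c 6)"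
    by (simp_all add: c_def cvec_def)
  \<comment> \<open>With 1/t named \<open>i\<close> and r = A i the claim is a polynomial identity.
    The square of a sigma form is twice the volume form of dt, E1, E2, E3, so the half square
    accounts for the limit 1 of the coefficient 8 r^3.\<close>
  define i where "i = 1 / t"
  have r: "r = A * i" using assms(1,2) by (simp add: i_def)
  show ?thesis
    unfolding psi_form_def omega_form_def Omega2_form_def n_def E_def P g i_def[symmetric] r
    by (simp add: form_expand, rule form_eqI, simp add: form_at_linear,
      simp add: algebra_simps power2_eq_square power3_eq_cube)
qed

lemma filterlim_norm_at_right: "filterlim norm (at_right 0) (at (0 :: 'a::real_normed_vector))"
  unfolding filterlim_at
  by (auto intro!: tendsto_norm_zero simp: eventually_at_filter)

lemma coefficient_limits:
  fixes A B r :: "'a \<Rightarrow> real"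
  assumes "(A \<longlongrightarrow> 0) F" "((\<lambda>p. (B p)\<^sup>2) \<longlongrightarrow> 1 / 3) F" "(r \<longlongrightarrow> 1 / 2) F"
  shows "((\<lambda>p. 4 / 3 - 16 * (r p)\<^sup>2 * (B p)\<^sup>2) \<longlongrightarrow> 0) F"
    "((\<lambda>p. 4 / 3 - 8 * r p * (B p)\<^sup>2) \<longlongrightarrow> 0) F"
    "((\<lambda>p. 8 * r p ^ 3 - 1) \<longlongrightarrow> 0) F"
    "((\<lambda>p. A p * (24 * (B p)\<^sup>2 - 8 * (A p)\<^sup>2)) \<longlongrightarrow> 0) F"
    "((\<lambda>p. - 8 * A p * (r p)\<^sup>2) \<longlongrightarrow> 0) F"
    "((\<lambda>p. 8 * (A p)\<^sup>2 * r p) \<longlongrightarrow> 0) F"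
proof -
  have "((\<lambda>p. 4 / 3 - 16 * (r p)\<^sup>2 * (B p)\<^sup>2) \<longlongrightarrow> 4 / 3 - 16 * (1 / 2)\<^sup>2 * (1 / 3)) F"
    by (intro tendsto_diff tendsto_mult tendsto_const tendsto_power[OF assms(3)] assms(2))
  then show "((\<lambda>p. 4 / 3 - 16 * (r p)\<^sup>2 * (B p)\<^sup>2) \<longlongrightarrow> 0) F" by (simp add: power2_eq_square)
  have "((\<lambda>p. 4 / 3 - 8 * r p * (B p)\<^sup>2) \<longlongrightarrow> 4 / 3 - 8 * (1 / 2) * (1 / 3)) F"
    by (intro tendsto_diff tendsto_mult tendsto_const assms)
  then show "((\<lambda>p. 4 / 3 - 8 * r p * (B p)\<^sup>2) \<longlongrightarrow> 0) F" by simp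
  have "((\<lambda>p. 8 * r p ^ 3 - 1) \<longlongrightarrow> 8 * (1 / 2) ^ 3 - 1) F"
    by (intro tendsto_diff tendsto_mult tendsto_const tendsto_power[OF assms(3)])
  then show "((\<lambda>p. 8 * r p ^ 3 - 1) \<longlongrightarrow> 0) F" by (simp add: power3_eq_cube)
  have "((\<lambda>p. A p * (24 * (B p)\<^sup>2 - 8 * (A p)\<^sup>2)) \<longlongrightarrow> 0 * (24 * (1 / 3) - 8 * 0\<^sup>2)) F"
    by (intro tendsto_diff tendsto_mult tendsto_const tendsto_power[OF assms(1)] assms)
  then show "((\<lambda>p. A p * (24 * (B p)\<^sup>2 - 8 * (A p)\<^sup>2)) \<longlongrightarrow> 0) F" by simp
  have "((\<lambda>p. - 8 * A p * (r p)\<^sup>2) \<longlongrightarrow> - 8 * 0 * (1 / 2)\<^sup>2) F"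
    by (intro tendsto_diff tendsto_mult tendsto_const tendsto_power[OF assms(3)] assms)
  then show "((\<lambda>p. - 8 * A p * (r p)\<^sup>2) \<longlongrightarrow> 0) F" by simp
  have "((\<lambda>p. 8 * (A p)\<^sup>2 * r p) \<longlongrightarrow> 8 * 0\<^sup>2 * (1 / 2)) F"
    by (intro tendsto_diff tendsto_mult tendsto_const tendsto_power[OF assms(1)] assms)
  then show "((\<lambda>p. 8 * (A p)\<^sup>2 * r p) \<longlongrightarrow> 0) F" by simp
qed

text \<open>What \<open>psi_form_split\<close> leaves at p = 0, where the remaining coefficients
  vanish.\<close>

definition psi0 :: "quat \<Rightarrow> quat \<Rightarrow> tot form" where
  "psi0 a1 a2 = (let n = cvec (frN (0, a1, a2)) in
     (- 4 / 3) *\<^sub>R (n 1 * (n 2 * sigma_form a1 3) + n 2 * (n 3 * sigma_form a1 1) + n 3 * (n 1 * sigma_form a1 2))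
     + (1 / 2) *\<^sub>R (sigma_form a1 1 * sigma_form a1 1))"

lemma psi_form_tendsto:
  assumes a: "a1 \<in> SU2" "a2 \<in> SU2"
  shows "((\<lambda>p. form_at (psi_at (p, a1, a2)) vs)
    \<longlongrightarrow> form_at (psi0 a1 a2) vs) (at 0)"
proof -
  define S where "S = - {0 :: quat}"
  define n0 where "n0 = frN (0, a1, a2)"
  define n where "n = cvec n0"
  define E where "E p = cvec (frE (p, a1, a2))" for p
  define e where "e p = cov (frt (p, a1, a2))" for p
  define A where "A p = bsA (norm p)" for p :: quat
  define B where "B p = bsB (norm p)" for p :: quat
  define r where "r p = A p / norm p" for p :: quat
  \<comment> \<open>\<open>frN\<close> does not involve \<open>p\<close> and may be frozen at p =
    0.\<close>
  have N: "frN (p, a1, a2) = n0" for p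
    unfolding n0_def by (rule ext) (simp add: frN_def mu1_def mu2_def case_prod_unfold)
  have be: "bounded_forms S e" unfolding e_def
  proof (rule bounded_forms_cov)
    fix v :: tot
    have "\<bar>frt (p, a1, a2) v\<bar> \<le> norm (fst v)" if "p \<in> S" for p
      using Cauchy_Schwarz_ineq2[of p "fst v"] that
      by (simp add: frt_def S_def divide_le_eq mult.commute)
    then show "\<exists>C. \<forall>p\<in>S. \<bar>frt (p, a1, a2) v\<bar> \<le> C" by blast
  qed
  have bE: "bounded_forms S (\<lambda>p. E p i)" for i unfolding E_def cvec_def
  proof (rule bounded_forms_cov)
    fix v :: tot
    have "\<bar>frE (p, a1, a2) v $ i\<bar> \<le> norm (fst v)" if "p \<in> S" for p
    proof -
      have "\<bar>frE (p, a1, a2) v $ i\<bar> \<le> norm (frE (p, a1, a2) v)" by (rule component_le_norm_cart)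
      also have "\<dots> = norm (snd (fst v \<odot> qcnj p)) / norm p"
        using a by (simp add: frE_def frZ_def SU2_iff Ad_norm divide_inverse mult.commute)
      also have "\<dots> \<le> norm (fst v \<odot> qcnj p) / norm p"
        by (intro divide_right_mono) (metis norm_snd_le prod.collapse, simp)
      also have "\<dots> = norm (fst v)" using that by (simp add: norm_qmul S_def)
      finally show ?thesis .
    qed
    then show "\<exists>C. \<forall>p\<in>S. \<bar>frE (p, a1, a2) v $ i\<bar> \<le> C" by blast
  qed
  have bn: "bounded_forms S (\<lambda>p. n i)" for i
    unfolding bounded_forms_def by (rule allI, rule exI, rule ballI, rule order_refl)
  note bounded = bounded_forms_add bounded_forms_mult be bE bn
  have lims: "(A \<longlongrightarrow> 0) (at 0)" "((\<lambda>p. (B p)\<^sup>2) \<longlongrightarrow> 1 / 3) (at 0)" "(r \<longlongrightarrow> 1 / 2) (at 0)"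
    unfolding A_def B_def r_def
    by (rule filterlim_compose[OF bs_limits(2) filterlim_norm_at_right],
      rule filterlim_compose[OF bs_limits(3) filterlim_norm_at_right],
      rule filterlim_compose[OF bs_limits(1) filterlim_norm_at_right])
  have ev: "eventually (\<lambda>p. p \<in> S) (at 0)"
    by (simp add: S_def eventually_at_filter)
  define c1 where "c1 p = 4 / 3 - 16 * (r p)\<^sup>2 * (B p)\<^sup>2" for p
  define c2 where "c2 p = 4 / 3 - 8 * r p * (B p)\<^sup>2" for p
  define c3 where "c3 p = 8 * r p ^ 3 - 1" for p
  define c4 where "c4 p = A p * (24 * (B p)\<^sup>2 - 8 * (A p)\<^sup>2)" for p
  define c5 where "c5 p = - 8 * A p * (r p)\<^sup>2" for p
  define c6 where "c6 p = 8 * (A p)\<^sup>2 * r p" for p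
  have c: "(c1 \<longlongrightarrow> 0) (at 0)" "(c2 \<longlongrightarrow> 0) (at 0)" "(c3 \<longlongrightarrow> 0) (at 0)" "(c4 \<longlongrightarrow> 0) (at 0)" "(c5 \<longlongrightarrow> 0) (at 0)"
      "(c6 \<longlongrightarrow> 0) (at 0)"
    unfolding c1_def c2_def c3_def c4_def c5_def c6_def
    by (rule coefficient_limits[OF lims])+
  define X1 where "X1 p = n 1 * (n 2 * (E p 1 * E p 2)) + n 2 * (n 3 * (E p 2 * E p 3)) + n 3 * (n 1 * (E p 3 * E p 1))" for p
  define X2 where "X2 p = n 1 * (n 2 * (e p * E p 3)) + n 2 * (n 3 * (e p * E p 1)) + n 3 * (n 1 * (e p * E p 2))" for p
  define X3 where "X3 p = e p * (E p 1 * (E p 2 * E p 3))" for p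
  define X4 where "X4 p = e p * (n 1 * (n 2 * n 3))" for p
  define X5 where "X5 p = e p * (E p 1 * (E p 2 * n 3)) + e p * (E p 2 * (E p 3 * n 1)) + e p * (E p 3 * (E p 1 * n 2))" for p
  define X6 where "X6 p = e p * (n 1 * (n 2 * E p 3)) + e p * (n 2 * (n 3 * E p 1)) + e p * (n 3 * (n 1 * E p 2))" for p
  note X = X1_def X2_def X3_def X4_def X5_def X6_def
  have bX: "bounded_forms S X1" "bounded_forms S X2" "bounded_forms S X3" "bounded_forms S X4"
    "bounded_forms S X5" "bounded_forms S X6"
    unfolding X[abs_def] by (intro bounded)+
  define sum where "sum p = form_at (psi0 a1 a2) vs + form_at (c1 p *\<^sub>R X1 p) vs + form_at (c2 p *\<^sub>R X2 p) vs
    + form_at (c3 p *\<^sub>R X3 p) vs + form_at (c4 p *\<^sub>R X4 p) vs + form_at (c5 p *\<^sub>R X5 p) vs + form_at (c6 p *\<^sub>R X6 p) vs" for p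
  have "(sum \<longlongrightarrow> form_at (psi0 a1 a2) vs + 0 + 0 + 0 + 0 + 0 + 0) (at 0)"
    unfolding sum_def[abs_def] by (intro tendsto_add tendsto_const bounded_forms_tendsto[OF _ _ ev] bX c)
  then show ?thesis
  proof (rule Lim_transform_eventually[THEN tendsto_eq_rhs, OF _ eventually_mono[OF ev]])
    fix p assume "p \<in> S"
    then have p: "norm p \<noteq> 0" "p \<noteq> 0" by (simp_all add: S_def)
    have P: "frP (p, a1, a2) = (\<lambda>v. frE (p, a1, a2) v /\<^sub>R norm p - n0 v)"
      using p SU2_nonzero[OF a(1)]
      by (simp add: fun_eq_iff frP_eq frE_def power2_eq_square N)
    have Ar: "bsA (norm p) = r p * norm p" using p by (simp add: r_def A_def)
    have s: "fst (p, a1, a2) \<noteq> 0" "fst (snd (p, a1, a2)) \<in> SU2" using p a by simp_all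
    show "sum p = form_at (psi_at (p, a1, a2)) vs"
      unfolding fst_conv N P psi_form_split[OF p(1) Ar] sigma_form_eq[OF s] psi0_def Let_def sum_def X
      by (simp only: plus_form.rep_eq c1_def c2_def c3_def c4_def c5_def c6_def n_def E_def e_def
          A_def[symmetric] B_def[symmetric] fst_conv snd_conv)
  qed simp
qed

section \<open>The limiting connection\<close>

lemma Ck_on_linear_compose:
  fixes l :: "'b::euclidean_space \<Rightarrow> 'c::euclidean_space" and f :: "'a::euclidean_space \<Rightarrow> 'b"
  assumes "open W" "bounded_linear l" "Ck_on k W f"
  shows "Ck_on k W (\<lambda>x. l (f x))"
  using assms(3)
proof (induction k arbitrary: f)
  case 0
  then show ?case using bounded_linear.continuous_on[OF assms(2)] by simp
next
  case (Suc k)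
  note f = Ck_on_SucE[OF Suc.prems]
  show ?case
    by (rule Ck_on_SucI[OF assms(1) bounded_linear.has_derivative[OF assms(2) f(1)] Suc.IH[OF f(2)]])
qed

lemma smooth_on_linear_compose:
  fixes l :: "'b::euclidean_space \<Rightarrow> 'c::euclidean_space" and f :: "'a::euclidean_space \<Rightarrow> 'b"
  assumes "open W" "bounded_linear l" "smooth_on W f"
  shows "smooth_on W (\<lambda>x. l (f x))"
  by (rule smooth_onI, rule Ck_on_linear_compose[OF assms(1,2) smooth_onD[OF assms(3)]])

text \<open>Treats the tubes (balls) and the whole manifold (all of R^4) alike.\<close>

definition over :: "quat set \<Rightarrow> (quat \<times> quat) set" where
  "over S = {(p, q). p \<in> S \<and> q \<in> SU2}"

lemma tube_eq_over: "tube \<epsilon> = over (ball 0 \<epsilon>)"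
  by (auto simp: tube_def over_def)

lemma M_eq_over: "M = over UNIV"
  by (auto simp: M_def over_def)

lemma P_id_over: "z \<in> P_id (over S) \<longleftrightarrow> fst z \<in> S \<and> fst (snd z) \<in> SU2 \<and> snd (snd z) \<in> SU2"
  by (auto simp: P_id_def over_def pr_def case_prod_unfold SU2_iff norm_qmul)

definition ext_dom :: "quat set \<Rightarrow> tot set" where
  "ext_dom S = {z. fst z \<in> S \<and> fst (snd z) \<noteq> 0 \<and> snd (snd z) \<noteq> 0}"

lemma retr_vimage_P_id: "retr -` P_id (over S) = ext_dom S"
proof -
  \<comment> \<open>For a = 0 the quotient is 0, by the convention for division by zero, and does
    not lie on the sphere.\<close>
  have "norm (a /\<^sub>R norm a) = 1 \<longleftrightarrow> a \<noteq> 0" for a :: quat by auto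
  then show ?thesis
    unfolding vimage_def P_id_over ext_dom_def SU2_iff by (simp add: retr_def case_prod_unfold)
qed

lemma open_ext_dom: "open S \<Longrightarrow> open (ext_dom S)"
proof -
  assume S: "open S"
  have "ext_dom S = S \<times> ((- {0}) \<times> (- {0}))"
    by (auto simp: ext_dom_def mem_Times_iff)
  moreover have "open (S \<times> ((- {0 :: quat}) \<times> (- {0 :: quat})))"
    by (intro open_Times S) auto
  ultimately show ?thesis by simp
qed

text \<open>The last bracket is |p|^2 times \<open>frP\<close>, expressed through \<open>frZ\<close>
  so that the formula makes sense and is smooth at p = 0.\<close>

definition Alim :: "tot \<Rightarrow> tot \<Rightarrow> real^3" where
  "Alim z v = (1 / 2) *\<^sub>R (mu1 z v + mu2 z v)
     + bsF ((norm (fst z))\<^sup>2) *\<^sub>R (frZ z v - (norm (fst z))\<^sup>2 *\<^sub>R frN z v)"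

lemma Alim_eq_gen:
  assumes "fst z \<noteq> 0" "fst (snd z) \<noteq> 0"
  shows "Alim z v = gen bsa (\<lambda>_. 0) z v"
proof -
  define n where "n = (norm (fst z))\<^sup>2"
  have n: "n \<noteq> 0" using assms by (simp add: n_def)
  have a: "bsa (norm (fst z)) = 1 + n * bsF n" using bsa_eq_F[of "norm (fst z)"] assms by (simp add: n_def)
  have "gen bsa (\<lambda>_. 0) z v = (frP z v + mu3 z v) + (n * bsF n) *\<^sub>R frP z v"
    by (simp add: gen_def a scaleR_add_left)
  also have "frP z v + mu3 z v = (1 / 2) *\<^sub>R (mu1 z v + mu2 z v)"
    by (simp add: frP_def)
  also have "(n * bsF n) *\<^sub>R frP z v = bsF n *\<^sub>R (frZ z v - n *\<^sub>R frN z v)"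
    using n by (simp add: frP_eq[OF assms] flip: n_def) (simp add: scaleR_diff_right mult.commute)
  finally show ?thesis by (simp add: Alim_def n_def)
qed

lemma ext_Alim:
  assumes "fst (snd z) \<noteq> 0" "snd (snd z) \<noteq> 0"
  shows "ext Alim z v = Alim z v"
  using assms by (simp add: ext_eq Alim_def mu_retr) (simp add: retr_def case_prod_unfold)

lemma linear_Alim: "linear (Alim z)"
proof -
  have 1: "linear (mu1 z)" "linear (mu2 z)"
    unfolding mu1_def mu2_def case_prod_unfold
    by (rule linearI; simp add: mcn_add mcn_scaleR)+
  have 2: "linear (frZ z)"
    unfolding frZ_def
    by (rule linearI) (simp_all add: qmul.add_left qmul.scaleR_left linear_add[OF linear_Ad]
        linear_scale[OF linear_Ad] scaleR_add_right)
  show ?thesis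
    by (rule linearI) (simp_all add: Alim_def frN_def linear_add[OF 1(1)] linear_add[OF 1(2)] linear_add[OF 2]
        linear_scale[OF 1(1)] linear_scale[OF 1(2)] linear_scale[OF 2] vec_eq_iff algebra_simps)
qed

lemma smooth_on_mcn:
  fixes c w :: "tot \<Rightarrow> quat"
  assumes "open W" "smooth_on W c" "smooth_on W w" "\<And>z. z \<in> W \<Longrightarrow> c z \<noteq> 0"
  shows "smooth_on W (\<lambda>z. mcn (c z) (w z))"
proof -
  have cc: "smooth_on W (\<lambda>z. c z \<bullet> c z)"
    by (rule smooth_on_bilinear[OF bounded_bilinear_inner assms(1,2,2)])
  have "(\<lambda>z. c z \<bullet> c z) ` W \<subseteq> - {0}"
    using assms(4) by auto
  then have "smooth_on W (\<lambda>z. inverse (c z \<bullet> c z))"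
    by (rule smooth_on_compose_real[OF assms(1) _ smooth_on_inverse cc])
  moreover have "smooth_on W (\<lambda>z. snd (qcnj (c z) \<odot> w z))"
    by (rule smooth_on_linear_compose[OF assms(1) bounded_linear_snd
          smooth_on_bilinear[OF bounded_bilinear_qmul assms(1)
            smooth_on_linear_compose[OF assms(1) bounded_linear_qcnj assms(2)] assms(3)]])
  ultimately have "smooth_on W (\<lambda>z. inverse (c z \<bullet> c z) *\<^sub>R snd (qcnj (c z) \<odot> w z))"
    by (rule smooth_on_bilinear[OF bounded_bilinear_scaleR assms(1)])
  then show ?thesis by (simp add: mcn_def power2_norm_eq_inner)
qed

lemma smooth_on_Alim:
  assumes W: "open W" "W \<subseteq> ext_dom UNIV"
  shows "smooth_on W (\<lambda>z. Alim z v)"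
proof -
  have p: "smooth_on W (\<lambda>z::tot. fst z)" and a1: "smooth_on W (\<lambda>z::tot. fst (snd z))"
    and a2: "smooth_on W (\<lambda>z::tot. snd (snd z))"
    by (intro smooth_on_linear W bounded_linear_fst bounded_linear_fst_comp[OF bounded_linear_snd]
        bounded_linear_snd_comp[OF bounded_linear_snd])+
  have nz: "fst (snd z) \<noteq> 0" "snd (snd z) \<noteq> 0" if "z \<in> W" for z
    using that W(2) by (auto simp: ext_dom_def)
  have m1: "smooth_on W (\<lambda>z. mu1 z v)"
    unfolding mu1_def case_prod_unfold by (rule smooth_on_mcn[OF W(1) a1 smooth_on_const[OF W(1)] nz(1)])
  have m2: "smooth_on W (\<lambda>z. mu2 z v)"
    unfolding mu2_def case_prod_unfold by (rule smooth_on_mcn[OF W(1) a2 smooth_on_const[OF W(1)] nz(2)])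
  have Z: "smooth_on W (\<lambda>z. frZ z v)"
  proof -
    \<comment> \<open>\<open>frZ\<close> is the value of the Maurer--Cartan form at
      \<open>a1\<close> on the vector v qcnj(p) a1.\<close>
    have "smooth_on W (\<lambda>z. mcn (fst (snd z)) (fst v \<odot> qcnj (fst z) \<odot> fst (snd z)))"
      by (intro smooth_on_mcn W a1 smooth_on_bilinear[OF bounded_bilinear_qmul] smooth_on_const
          smooth_on_linear_compose[OF W(1) bounded_linear_qcnj p] nz)
    moreover have "mcn (fst (snd z)) (fst v \<odot> qcnj (fst z) \<odot> fst (snd z)) = frZ z v" for z
      by (simp add: mcn_def frZ_def Ad_snd qmul_assoc)
    ultimately show ?thesis by simp
  qed
  have n: "smooth_on W (\<lambda>z. fst z \<bullet> fst z)"
    by (intro smooth_on_bilinear[OF bounded_bilinear_inner] W p)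
  \<comment> \<open>The argument of \<open>bsF\<close> is the polynomial |p|^2, so nothing goes
    wrong at p = 0, where the norm is not differentiable.\<close>
  have F: "smooth_on W (\<lambda>z. bsF (fst z \<bullet> fst z))"
    by (rule smooth_on_compose_real[OF W(1) _ smooth_on_bsF n]) (auto intro: nonneg_in_bsT)
  have "smooth_on W (\<lambda>z. (1 / 2) *\<^sub>R (mu1 z v + mu2 z v)
     + bsF (fst z \<bullet> fst z) *\<^sub>R (frZ z v + (- 1 / 2 * (fst z \<bullet> fst z)) *\<^sub>R (mu1 z v + (- 1) *\<^sub>R mu2 z v)))"
    by (intro smooth_on_add W smooth_on_bilinear[OF bounded_bilinear_scaleR] smooth_on_mult smooth_on_const
        m1 m2 Z n F)
  then show ?thesis
    by (simp add: Alim_def frN_def power2_norm_eq_inner)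
qed

lemma mu_ract:
  assumes "h \<in> SU2"
  shows "mu1 (ract h z) (ract h v) = Ad (qcnj h) (mu1 z v)" "mu2 (ract h z) (ract h v) = Ad (qcnj h) (mu2 z v)"
    "frZ (ract h z) (ract h v) = Ad (qcnj h) (frZ z v)" "fst (ract h z) = fst z"
  using assms by (simp_all add: mu1_def mu2_def frZ_def ract_def case_prod_unfold mcn_qmul_right SU2_iff
      norm_qmul qcnj_qmul Ad_qmul linear_scale[OF linear_Ad])

lemma mu_act3:
  assumes "h1 \<in> SU2" "h2 \<in> SU2" "h3 \<in> SU2"
  shows "mu1 (act3 h1 h2 h3 z) (act3 h1 h2 h3 v) = mu1 z v" "mu2 (act3 h1 h2 h3 z) (act3 h1 h2 h3 v) = mu2 z v"
    "frZ (act3 h1 h2 h3 z) (act3 h1 h2 h3 v) = frZ z v" "norm (fst (act3 h1 h2 h3 z)) = norm (fst z)"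
proof -
  have "(h1 \<odot> fst v \<odot> qcnj h3) \<odot> qcnj (h1 \<odot> fst z \<odot> qcnj h3)
      = h1 \<odot> (fst v \<odot> ((qcnj h3 \<odot> h3) \<odot> qcnj (fst z))) \<odot> qcnj h1"
    by (simp add: qcnj_qmul qmul_assoc)
  then have "Ad (qcnj (h1 \<odot> fst (snd z))) (snd ((h1 \<odot> fst v \<odot> qcnj h3) \<odot> qcnj (h1 \<odot> fst z \<odot> qcnj h3)))
      = Ad (qcnj (fst (snd z))) (snd (fst v \<odot> qcnj (fst z)))"
    using assms by (simp add: SU2_cancel Ad_snd[of h1, symmetric] qcnj_qmul Ad_qmul Ad_inverse)
  then show "frZ (act3 h1 h2 h3 z) (act3 h1 h2 h3 v) = frZ z v"
    using assms by (simp add: frZ_def act3_def case_prod_unfold SU2_iff norm_qmul)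
qed (use assms in \<open>simp_all add: mu1_def mu2_def act3_def case_prod_unfold mcn_qmul_left SU2_iff norm_qmul\<close>)

lemma connection_on_Alim:
  assumes "open S"
  shows "connection_on (over S) Alim"
  unfolding connection_on_def
proof (intro conjI ballI allI)
  show "smooth_one_form (over S) Alim"
    unfolding smooth_one_form_def retr_vimage_P_id
  proof (intro conjI ballI allI)
    fix z assume "z \<in> P_id (over S)"
    then have "ext Alim z = Alim z"
      by (auto simp: P_id_over fun_eq_iff ext_Alim SU2_nonzero)
    then show "linear (ext Alim z)" by (simp add: linear_Alim)
  next
    fix v
    show "smooth_on (ext_dom S) (\<lambda>z. ext Alim z v)"
      by (rule smooth_on_cong[OF open_ext_dom[OF assms] _ smooth_on_Alim[OF open_ext_dom[OF assms]]])
        (auto simp: ext_dom_def ext_Alim)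
  qed
next
  fix z \<xi> assume "z \<in> P_id (over S)"
  then have "fst (snd z) \<noteq> 0" "snd (snd z) \<noteq> 0" by (auto simp: P_id_over SU2_nonzero)
  then show "Alim z (fund \<xi> z) = \<xi>"
    by (simp add: Alim_def mu1_def mu2_def frN_def frZ_def fund_def case_prod_unfold mcn_fundamental
        qmul.zero_left linear_0[OF linear_Ad] flip: scaleR_2)
next
  fix z v h assume "h \<in> SU2"
  then show "Alim (ract h z) (ract h v) = Ad (qcnj h) (Alim z v)"
    by (simp add: Alim_def frN_def mu_ract linear_add[OF linear_Ad] linear_diff[OF linear_Ad]
        linear_scale[OF linear_Ad])
qed

lemma SU2_cubed_invariant_Alim: "SU2_cubed_invariant V Alim"
  by (simp add: SU2_cubed_invariant_def Alim_def frN_def mu_act3)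

lemma curvature_Alim_nonzero:
  assumes "fst z \<noteq> 0" "fst (snd z) \<in> SU2" "snd (snd z) \<in> SU2" "set vs \<subseteq> T_P z"
  shows "(curvature Alim z \<and>\<^sub>w pullback pr psi z) vs = 0"
proof -
  define t where "t = norm (fst z)"
  have t: "0 < t" using assms by (simp add: t_def)
  define W where "W = ext_dom (- {0})"
  have W: "open W" "z \<in> W"
    using assms by (auto simp: W_def intro!: open_ext_dom) (auto simp: ext_dom_def SU2_nonzero)
  have ext: "ext Alim y v = gen bsa (\<lambda>_. 0) y v" if "y \<in> W" for y v
    using that by (simp add: W_def ext_dom_def ext_Alim Alim_eq_gen)
  define a where "a = bsa t"
  define a' where "a' = (a - a\<^sup>2) / bsA t - bsA t * a / (bsB t)\<^sup>2"
  have a': "(bsa has_real_derivative a') (at (norm (fst z)))"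
    using bsa_has_derivative[OF t] by (simp add: a'_def a_def t_def)
  have F: "curvature Alim z [u, v] = frame_curvature a a' 0 0 (frt z) (frP z) (frN z) u v"
    if "{u, v} \<subseteq> set vs" for u v
  proof -
    have "u \<in> T_P z" "v \<in> T_P z" using that assms(4) by auto
    then have "Alim z u = ext Alim z u" "Alim z v = ext Alim z v"
      using assms by (simp_all add: ext_tangent)
    from curvature_gen[where A = Alim, OF W ext this assms(1) SU2_nonzero[OF assms(2)] SU2_nonzero[OF assms(3)]
        a' DERIV_const]
    show ?thesis by (simp add: a_def t_def)
  qed
  have F0: "curvature Alim z l = 0" if "length l \<noteq> 2" for l
    using that by (auto simp: curvature_def split: list.splits)
  have pos: "0 < bsA t" "0 < bsB t" using t by (simp_all add: bsA_pos bsB_pos)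
  have "(bsA t)\<^sup>2 * (bsB t)\<^sup>2 * a' = bsA t * (bsB t)\<^sup>2 * (a - a\<^sup>2) - bsA t ^ 3 * a"
  proof -
    have "A\<^sup>2 * B\<^sup>2 * (c / A - A * a / B\<^sup>2) = A * B\<^sup>2 * c - A ^ 3 * a" if "0 < A" "0 < B" for A B c :: real
      using that by (simp add: right_diff_distrib power2_eq_square power3_eq_cube)
    from this[OF pos] show ?thesis by (simp only: a'_def)
  qed
  then have ode: "- 16 * (bsA t)\<^sup>2 * (bsB t)\<^sup>2 * a' - 16 * bsA t * (bsB t)\<^sup>2 * (a\<^sup>2 - a) + 16 * bsA t ^ 3 * (0\<^sup>2 - a) = 0"
    by (simp add: algebra_simps)
  have "(curvature Alim z \<and>\<^sub>w form_at (psi_form (bsA t) (bsB t) (frt z) (frP z) (frN z))) vs = 0"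
    by (rule curvature_wedge_psi_zero[where F = "curvature Alim z" and e = "frt z" and P = "frP z" and N = "frN z"
          and vs = vs, OF F F0 ode]) simp_all
  moreover have "pullback pr psi z = form_at (psi_form (bsA t) (bsB t) (frt z) (frP z) (frN z))"
    by (rule HOL.ext) (simp only: t_def pullback_pr_psi[OF assms(1-3)])
  ultimately show ?thesis by simp
qed

text \<open>The point is approached along (p, a1, a2) with \<open>a1\<close>, \<open>a2\<close> and
  the arguments fixed. The tangency conditions do not involve p, so the same vectors stay tangent,
  and both factors of the wedge converge on them.\<close>

lemma curvature_Alim_singular:
  assumes z: "fst z = 0" "fst (snd z) \<in> SU2" "snd (snd z) \<in> SU2" and vs: "set vs \<subseteq> T_P z"
  shows "(curvature Alim z \<and>\<^sub>w pullback pr psi z) vs = 0"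
proof -
  define a1 a2 where "a1 = fst (snd z)" and "a2 = snd (snd z)"
  have z_eq: "z = (0, a1, a2)" using z(1) by (simp add: a1_def a2_def prod_eq_iff)
  have a: "a1 \<in> SU2" "a2 \<in> SU2" using z by (simp_all add: a1_def a2_def)
  have op: "open (ext_dom UNIV)" by (rule open_ext_dom) simp
  have zW: "z \<in> ext_dom UNIV" using a by (simp add: z_eq ext_dom_def SU2_nonzero)
  have y: "((\<lambda>p. (p, a1, a2)) \<longlongrightarrow> z) (at 0)"
    unfolding z_eq by (intro tendsto_Pair tendsto_const tendsto_ident_at)
  have ext: "smooth_on (ext_dom UNIV) (\<lambda>y. ext Alim y v)" for v
    by (rule smooth_on_cong[OF op _ smooth_on_Alim[OF op subset_refl]]) (auto simp: ext_dom_def ext_Alim)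
  have cont: "((\<lambda>p. f (p, a1, a2)) \<longlongrightarrow> f z) (at 0)" if "smooth_on (ext_dom UNIV) f" for f :: "tot \<Rightarrow> real^3"
  proof (rule isCont_tendsto_compose[OF _ y])
    show "isCont f z"
      using smooth_on_imp_continuous_on[OF that] continuous_on_eq_continuous_at[OF op] zW by blast
  qed
  have T: "v \<in> T_P (p, a1, a2)" if "v \<in> set vs" for v p
    using that vs by (auto simp: T_P_iff z_eq)
  have ext_T: "Alim (p, a1, a2) v = ext Alim (p, a1, a2) v" if "v \<in> set vs" for v p
    using T[OF that] a by (simp add: ext_tangent)
  have 1: "((\<lambda>p. curvature Alim (p, a1, a2) l) \<longlongrightarrow> curvature Alim z l) (at 0)" if l: "set l \<subseteq> set vs" for l
  proof (cases "\<exists>u v. l = [u, v]")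
    case True
    then obtain u v where l_eq: "l = [u, v]" by blast
    then have uv: "u \<in> set vs" "v \<in> set vs" using l by auto
    have A: "((\<lambda>p. Alim (p, a1, a2) w) \<longlongrightarrow> Alim z w) (at 0)" if "w \<in> set vs" for w
      using cont[OF ext[of w]] ext_T[OF that] by (simp add: z_eq)
    show ?thesis
      unfolding l_eq curvature_def ext_deriv_def list.case
      by (intro tendsto_add tendsto_diff lie.tendsto A uv cont smooth_on_frechet_derivative ext)
  next
    case False
    then show ?thesis by (auto simp: curvature_def split: list.splits)
  qed
  have 2: "((\<lambda>p. pullback pr psi (p, a1, a2) l) \<longlongrightarrow> pullback pr psi z l) (at 0)" for l
  proof -
    have ev: "eventually (\<lambda>p. p \<noteq> 0) (at (0 :: quat))" by (simp add: eventually_at_filter)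
    have pb: "pullback Phi_inv bs_psi (p, a1 \<odot> qcnj a2) (map (dpr z) l)
        = form_at (psi_at (p, a1, a2)) l"
      "pullback pr psi (p, a1, a2) l = pullback Phi_inv bs_psi (p, a1 \<odot> qcnj a2) (map (dpr z) l)" if "p \<noteq> 0" for p
    proof -
      have "dpr (p, a1, a2) = dpr z" by (rule HOL.ext) (simp add: dpr_def z_eq)
      moreover have "pr (p, a1, a2) = (p, a1 \<odot> qcnj a2)" by (simp add: pr_def)
      ultimately show "pullback Phi_inv bs_psi (p, a1 \<odot> qcnj a2) (map (dpr z) l)
        = form_at (psi_at (p, a1, a2)) l"
        "pullback pr psi (p, a1, a2) l = pullback Phi_inv bs_psi (p, a1 \<odot> qcnj a2) (map (dpr z) l)"
        using pullback_pr_psi[of "(p, a1, a2)" l] that a by simp_all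
    qed
    have lim: "((\<lambda>p. pullback Phi_inv bs_psi (p, a1 \<odot> qcnj a2) (map (dpr z) l)) \<longlongrightarrow> form_at (psi0 a1 a2) l) (at 0)"
      by (rule Lim_transform_eventually[OF psi_form_tendsto[OF a] eventually_mono[OF ev]]) (simp add: pb(1))
    have "pullback pr psi z l = psi (0, a1 \<odot> qcnj a2) (map (dpr z) l)"
      using frechet_derivative_at[OF has_derivative_pr[of z]] by (simp add: pullback_def z_eq pr_def)
    \<comment> \<open>At p = 0 the form \<open>psi\<close> is a \<open>Lim\<close>; since the limit
      has been shown to exist, it is the value of \<open>psi0\<close>.\<close>
    also have "\<dots> = form_at (psi0 a1 a2) l"
      unfolding psi_def using tendsto_Lim[OF _ lim] by simp
    finally have "pullback pr psi z l = form_at (psi0 a1 a2) l" .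
    then show ?thesis
      using Lim_transform_eventually[OF lim eventually_mono[OF ev], of "\<lambda>p. pullback pr psi (p, a1, a2) l"] pb(2)
      by simp
  qed
  have "((\<lambda>p. (curvature Alim (p, a1, a2) \<and>\<^sub>w pullback pr psi (p, a1, a2)) vs)
      \<longlongrightarrow> (curvature Alim z \<and>\<^sub>w pullback pr psi z) vs) (at 0)"
    by (rule wedge_tendsto[OF 1 2])
  moreover have "((\<lambda>p. (curvature Alim (p, a1, a2) \<and>\<^sub>w pullback pr psi (p, a1, a2)) vs) \<longlongrightarrow> 0) (at 0)"
  proof (rule Lim_transform_eventually[OF tendsto_const])
    show "\<forall>\<^sub>F p in at 0. 0 = (curvature Alim (p, a1, a2) \<and>\<^sub>w pullback pr psi (p, a1, a2)) vs"
      unfolding eventually_at_filter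
      by (rule always_eventually, intro allI impI sym[OF curvature_Alim_nonzero]) (use a T in auto)
  qed
  ultimately show ?thesis by (rule tendsto_unique[rotated]) simp
qed

lemma G2_instanton_Alim:
  assumes "open S"
  shows "G2_instanton (over S) Alim"
  unfolding G2_instanton_def
proof (intro conjI ballI allI impI connection_on_Alim assms)
  fix z vs assume "z \<in> P_id (over S)" "set vs \<subseteq> T_P z"
  then show "(curvature Alim z \<and>\<^sub>w pullback pr psi z) vs = 0"
    using curvature_Alim_nonzero curvature_Alim_singular by (cases "fst z = 0") (auto simp: P_id_over)
qed

section \<open>The limiting connection in the canonical trivialisation\<close>

definition dsec :: "cyl \<Rightarrow> cyl \<Rightarrow> tot" where
  "dsec n v = (fst n *\<^sub>R fst (snd v) + fst v *\<^sub>R fst (snd n), fst (snd v), snd (snd v))"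

lemma frechet_derivative_sec: "frechet_derivative sec (at n) = dsec n"
proof -
  have eq: "sec = (\<lambda>n. (fst n *\<^sub>R fst (snd n), fst (snd n), snd (snd n)))"
    by (simp add: sec_def case_prod_unfold)
  have "(sec has_derivative dsec n) (at n)"
    unfolding eq dsec_def
    by (intro has_derivative_Pair has_derivative_scaleR has_derivative_fst has_derivative_snd has_derivative_ident)
  from frechet_derivative_at[OF this] show ?thesis by simp
qed

lemma ansatz_eq:
  "ansatz x y n v = (bsA (fst n) * x (fst n)) *\<^sub>R etaP n v + (bsB (fst n) * y (fst n)) *\<^sub>R etaN n v"
proof -
  have "(\<Sum>i\<in>UNIV. w $ i *\<^sub>R T i) = w" for w :: "real^3"
    by (simp add: sum_3 vec_eq_iff forall_3 T_def axis_def)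
  then show ?thesis by (simp add: ansatz_def eta_plus_eq eta_minus_eq)
qed

lemma norm_fst_sec: "n \<in> Cyl \<Longrightarrow> norm (fst (sec n)) = fst n"
  by (cases n) (auto simp: Cyl_def sec_def SU2_iff simp del: scaleR_Pair)

text \<open>Along the canonical section \<open>qcnj p \<odot> a1\<close> equals the real number t,
  so its Maurer--Cartan form \<open>mu3\<close> vanishes.\<close>

lemma gen_sec:
  assumes "n \<in> Cyl"
  shows "gen a b (sec n) (dsec n v) = a (fst n) *\<^sub>R etaP n v + b (fst n) *\<^sub>R etaN n v"
proof -
  obtain t g1 g2 where n: "n = (t, g1, g2)" by (cases n)
  obtain s v1 v2 where v: "v = (s, v1, v2)" by (cases v)
  have t: "t > 0" and g1: "g1 \<in> SU2" and g2: "g2 \<in> SU2" using assms by (auto simp: Cyl_def n)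
  have "qcnj (t *\<^sub>R g1) \<odot> v1 + qcnj (t *\<^sub>R v1 + s *\<^sub>R g1) \<odot> g1
      = t *\<^sub>R (qcnj g1 \<odot> v1 + qcnj v1 \<odot> g1) + s *\<^sub>R (qcnj g1 \<odot> g1)"
    by (simp add: qcnj_scaleR qcnj_add qmul.add_left qmul.scaleR_left scaleR_add_right)
  then have "snd (qcnj (t *\<^sub>R g1) \<odot> v1 + qcnj (t *\<^sub>R v1 + s *\<^sub>R g1) \<odot> g1) = 0"
    by (simp add: snd_qcnj_qmul_swap[of v1 g1] qcnj_self)
  moreover have "qcnj (t *\<^sub>R g1) \<odot> g1 = (t, 0)"
    using g1 by (simp add: qcnj_scaleR qmul.scaleR_left SU2_cancel)
  ultimately have m3: "mu3 (sec n) (dsec n v) = 0"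
    by (simp add: mu3_def sec_def dsec_def n v mcn_def) (simp add: qcnj_def qmul_real)
  have m12: "mu1 (sec n) (dsec n v) = mc g1 v1" "mu2 (sec n) (dsec n v) = mc g2 v2"
    using g1 g2 by (simp_all add: mu1_def mu2_def sec_def dsec_def n v mcn_eq_mc)
  have "norm (fst (sec n)) = t" using t g1 by (simp add: sec_def n SU2_iff)
  then show ?thesis
    unfolding gen_def frP_def frN_def m3 m12 by (simp add: etaP_def etaN_def n v)
qed

lemma has_form_Alim:
  "has_form V profile (\<lambda>t. 0) Alim"
  unfolding has_form_def
proof (intro ballI impI)
  fix n v assume n: "n \<in> Cyl"
  then have "norm (fst (sec n)) > 0" "fst (snd (sec n)) \<in> SU2"
    unfolding norm_fst_sec[OF n] by (auto simp: Cyl_def sec_def)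
  then have nz: "fst (sec n) \<noteq> 0" "fst (snd (sec n)) \<noteq> 0"
    by (simp_all add: SU2_nonzero)
  have "Alim (sec n) (dsec n v) = bsa (fst n) *\<^sub>R etaP n v"
    unfolding Alim_eq_gen[OF nz] gen_sec[OF n] by simp
  then show "Alim (sec n) (frechet_derivative sec (at n) v)
      = ansatz profile (\<lambda>t. 0) n v"
    unfolding frechet_derivative_sec ansatz_eq by (simp add: bsa_def)
qed

text \<open>The difference quotient of \<open>bsRho\<close> at 0, taken along t^2. It controls how
  far 1/A is from 2/t.\<close>

lemma bsRho_quotient_limit: "\<exists>l. ((\<lambda>t. (2 * bsRho (t\<^sup>2) - 1) / t\<^sup>2) \<longlongrightarrow> l) (at_right 0)"
proof -
  have "(0::real) \<in> bsT" by (rule nonneg_in_bsT) simp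
  from has_real_derivative_frechet[OF smooth_on_has_derivative[OF smooth_on_bsRho this]]
  obtain D where "(bsRho has_real_derivative D) (at 0)" by blast
  then have "((\<lambda>u. (bsRho u - 1 / 2) / u) \<longlongrightarrow> D) (at 0)"
    by (simp add: has_field_derivative_iff bsRho_0)
  moreover have "filterlim (\<lambda>t::real. t\<^sup>2) (at 0) (at_right 0)"
    unfolding filterlim_at by (auto intro!: tendsto_eq_intros simp: eventually_at_filter)
  ultimately have "((\<lambda>t. (bsRho (t\<^sup>2) - 1 / 2) / t\<^sup>2) \<longlongrightarrow> D) (at_right 0)"
    by (rule filterlim_compose)
  from tendsto_mult_left[OF this, of 2] show ?thesis
    by (intro exI[of _ "2 * D"]) (simp add: algebra_simps)
qed

lemma eventually_pos_at_right: "\<forall>\<^sub>F t::real in at_right 0. 0 < t"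
  by (simp add: eventually_at_right_less)

lemma bsRho_tendsto: "((\<lambda>t. bsRho (t\<^sup>2)) \<longlongrightarrow> 1 / 2) (at_right 0)"
  by (rule Lim_transform_eventually[OF bs_limits(1) eventually_mono[OF eventually_pos_at_right]])
    (simp add: bsA_eq_Rho)

text \<open>Since x = (1 + t^2 F)/(t R) with F and R smooth in t^2 and R = 1/2 at 0, the quotient (x
  - 2/t)/t even converges.\<close>

lemma profile_asymptotics:
  "(\<lambda>t. profile t - 2 / t) \<in> O[at_right 0](\<lambda>t. t)"
proof -
  obtain l where l: "((\<lambda>t. (2 * bsRho (t\<^sup>2) - 1) / t\<^sup>2) \<longlongrightarrow> l) (at_right 0)"
    using bsRho_quotient_limit by blast
  have 0: "(0::real) \<in> bsT" by (rule nonneg_in_bsT) simp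
  have "isCont bsF 0"
    using continuous_on_eq_continuous_at[OF open_bsT] smooth_on_imp_continuous_on[OF smooth_on_bsF] 0 by blast
  moreover have "((\<lambda>t::real. t\<^sup>2) \<longlongrightarrow> 0) (at_right 0)" by (auto intro!: tendsto_eq_intros)
  ultimately have F: "((\<lambda>t. bsF (t\<^sup>2)) \<longlongrightarrow> bsF 0) (at_right 0)"
    by (rule isCont_tendsto_compose)
  have "((\<lambda>t. (bsF (t\<^sup>2) - (2 * bsRho (t\<^sup>2) - 1) / t\<^sup>2) / bsRho (t\<^sup>2)) \<longlongrightarrow> (bsF 0 - l) / (1 / 2)) (at_right 0)"
    by (intro tendsto_divide tendsto_diff F l bsRho_tendsto) simp
  then have "((\<lambda>t. (profile t - 2 / t) / t) \<longlongrightarrow> (bsF 0 - l) / (1 / 2)) (at_right 0)"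
  proof (rule Lim_transform_eventually[OF _ eventually_mono[OF eventually_pos_at_right]])
    fix t :: real assume t: "0 < t"
    define R where "R = bsRho (t\<^sup>2)"
    have A: "bsA t = t * R" using t by (simp add: bsA_eq_Rho R_def)
    have R: "R \<noteq> 0" using bsA_pos[OF t] A by auto
    have "profile t = bsa t / bsA t"
      using bsA_pos[OF t] by (simp add: bsa_def)
    also have "\<dots> = (1 + t\<^sup>2 * bsF (t\<^sup>2)) / (t * R)" by (simp only: bsa_eq_F[OF t] A)
    finally have e: "profile t = (1 + t\<^sup>2 * bsF (t\<^sup>2)) / (t * R)" .
    show "(bsF (t\<^sup>2) - (2 * bsRho (t\<^sup>2) - 1) / t\<^sup>2) / bsRho (t\<^sup>2)
        = (profile t - 2 / t) / t"
      unfolding e R_def[symmetric] using t R by (simp add: field_simps power2_eq_square)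
  qed
  then show ?thesis
    by (rule bigoI_tendsto) (simp add: eventually_mono[OF eventually_pos_at_right])
qed

lemma is_A_lim_Alim:
  assumes "0 < \<epsilon>"
  shows "is_A_lim \<epsilon> profile (\<lambda>t. 0) Alim"
  unfolding is_A_lim_def
  using assms G2_instanton_Alim[of "ball 0 \<epsilon>"] SU2_cubed_invariant_Alim has_form_Alim profile_asymptotics
  by (simp add: tube_eq_over)

section \<open>Invariant instantons near the singular orbit\<close>

lemma linear_gen: "linear (gen a b z)"
proof -
  have 1: "linear (mu1 z)" "linear (mu2 z)" "linear (mu3 z)"
    unfolding mu1_def mu2_def mu3_def case_prod_unfold
    by (rule linearI; simp add: mcn_add mcn_scaleR qmul.add_right qmul.add_left qmul.scaleR_left
        qmul.scaleR_right qcnj_add qcnj_scaleR scaleR_add_right)+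
  show ?thesis
    by (rule linearI) (simp_all add: gen_def frN_def frP_def linear_add[OF 1(1)] linear_add[OF 1(2)]
        linear_add[OF 1(3)] linear_scale[OF 1(1)] linear_scale[OF 1(2)] linear_scale[OF 1(3)]
        vec_eq_iff algebra_simps)
qed

lemma gen_fund:
  assumes "fst z \<noteq> 0" "fst (snd z) \<noteq> 0" "snd (snd z) \<noteq> 0"
  shows "gen a b z (fund \<xi> z) = \<xi>"
proof -
  have "mu1 z (fund \<xi> z) = \<xi>" "mu2 z (fund \<xi> z) = \<xi>" "mu3 z (fund \<xi> z) = \<xi>"
    using assms mcn_fundamental[of "qcnj (fst z) \<odot> fst (snd z)"]
    by (simp_all add: mu1_def mu2_def mu3_def fund_def case_prod_unfold mcn_fundamental qcnj_def[of 0]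
        qmul.zero_left qmul_eq_0_iff qcnj_eq_0_iff qmul_assoc flip: zero_prod_def)
  then show ?thesis by (simp add: gen_def frP_def frN_def flip: scaleR_2)
qed

lemma gen_ract:
  assumes "h \<in> SU2" "fst z \<noteq> 0" "fst (snd z) \<noteq> 0"
  shows "gen a b (ract h z) (ract h v) = Ad (qcnj h) (gen a b z v)"
proof -
  have "fst (snd (ract h z)) \<noteq> 0"
    using assms by (simp add: ract_def case_prod_unfold qmul_eq_0_iff SU2_nonzero)
  then have "mu3 (ract h z) (ract h v) = Ad (qcnj h) (mu3 z v)"
    using assms by (simp add: mu3_eq mu_ract linear_diff[OF linear_Ad] linear_scale[OF linear_Ad])
  then show ?thesis
    using assms by (simp add: gen_def frP_def frN_def mu_ract linear_add[OF linear_Ad]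
        linear_diff[OF linear_Ad] linear_scale[OF linear_Ad])
qed

text \<open>Off the singular orbit every point is a right translate of a point of the canonical
  section, and every tangent vector is a translated vector along the section plus a vertical one. A
  connection is thus determined there by its values on the section.\<close>

lemma tangent_decomposition:
  assumes p: "fst z \<noteq> 0" and a: "fst (snd z) \<in> SU2" "snd (snd z) \<in> SU2" and v: "v \<in> T_P z"
  obtains h n y \<xi> where "h \<in> SU2" "n \<in> Cyl" "y \<in> T_Cyl n" "z = ract h (sec n)"
    "v = ract h (dsec n y) + fund \<xi> z"
proof -
  obtain p a1 a2 where z: "z = (p, a1, a2)" by (cases z)
  obtain u w1 w2 where v_eq: "v = (u, w1, w2)" by (cases v)
  have p0: "p \<noteq> 0" and a1: "a1 \<in> SU2" and a2: "a2 \<in> SU2" using p a by (simp_all add: z)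
  have w: "a1 \<bullet> w1 = 0" "a2 \<bullet> w2 = 0" using v by (simp_all add: T_P_iff z v_eq)
  define g1 where "g1 = p /\<^sub>R norm p"
  define h where "h = qcnj g1 \<odot> a1"
  define g2 where "g2 = a2 \<odot> qcnj h"
  define v1 where "v1 = dnorm p u"
  \<comment> \<open>The vertical part is read off from the \<open>a1\<close> component;
    \<open>v2\<close> is then forced by the \<open>a2\<close> component.\<close>
  define \<xi> where "\<xi> = snd (qcnj a1 \<odot> (w1 - v1 \<odot> h))"
  define v2 where "v2 = (w2 - a2 \<odot> imq \<xi>) \<odot> qcnj h"
  have g1: "g1 \<in> SU2" using p0 by (simp add: g1_def SU2_iff)
  have h: "h \<in> SU2" using g1 a1 by (simp add: h_def SU2_iff norm_qmul)
  have g2: "g2 \<in> SU2" using a2 h by (simp add: g2_def SU2_iff norm_qmul)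
  have g1h: "g1 \<odot> h = a1" using SU2_cancel(2)[OF g1] by (simp add: h_def flip: qmul_assoc)
  have g2h: "g2 \<odot> h = a2" using SU2_cancel(1)[OF h] by (simp add: g2_def qmul_assoc)
  have pg: "norm p *\<^sub>R g1 = p" using p0 by (simp add: g1_def)
  have gv1: "g1 \<bullet> v1 = 0" by (simp add: g1_def v1_def inner_dnorm)
  have "fst (qcnj a1 \<odot> (w1 - v1 \<odot> h)) = a1 \<bullet> w1 - (g1 \<odot> h) \<bullet> (v1 \<odot> h)"
    unfolding fst_qcnj_qmul g1h by (rule inner_diff_right)
  also have "\<dots> = 0" using w gv1 by (simp add: inner_qmul_right)
  finally have "imq \<xi> = qcnj a1 \<odot> (w1 - v1 \<odot> h)"
    by (simp add: \<xi>_def imq_def prod_eq_iff)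
  then have c1: "a1 \<odot> imq \<xi> = w1 - v1 \<odot> h"
    using SU2_cancel(2)[OF a1] by (simp flip: qmul_assoc)
  have c2: "v2 \<odot> h = w2 - a2 \<odot> imq \<xi>"
    using SU2_cancel(1)[OF h] by (simp add: v2_def qmul_assoc)
  have "a2 \<bullet> (a2 \<odot> imq \<xi>) = 0"
    using inner_qmul_left[of a2 "(1, 0)" "imq \<xi>"] by (simp add: imq_def inner_prod_def)
  then have gv2: "g2 \<bullet> v2 = 0"
    unfolding g2_def v2_def inner_qmul_right using w by (simp add: inner_diff_right)
  have c0: "norm p *\<^sub>R v1 + ((p \<bullet> u) / norm p) *\<^sub>R g1 = u"
    using p0 by (simp add: v1_def dnorm_def g1_def scaleR_diff_right power3_eq_cube divide_inverse mult_ac)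
  show ?thesis
  proof (rule that[of h "(norm p, g1, g2)" "((p \<bullet> u) / norm p, v1, v2)" \<xi>])
    show "(norm p, g1, g2) \<in> Cyl" using p0 g1 g2 by (simp add: Cyl_def)
    show "((p \<bullet> u) / norm p, v1, v2) \<in> T_Cyl (norm p, g1, g2)"
      using gv1 gv2 by (simp add: T_Cyl_def)
    show "z = ract h (sec (norm p, g1, g2))"
      by (simp add: z ract_def sec_def g1h g2h pg)
    show "v = ract h (dsec (norm p, g1, g2) ((p \<bullet> u) / norm p, v1, v2)) + fund \<xi> z"
      by (simp add: v_eq z ract_def dsec_def fund_def c0 c1 c2)
  qed (rule h)
qed

lemma fund_T_P: "fund \<xi> z \<in> T_P z"
  by (auto simp: T_P_iff fund_def case_prod_unfold fst_qcnj_qmul[symmetric] qmul_assoc[symmetric] qcnj_self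
      qmul_real) (simp_all add: imq_def)

lemma connection_on_smooth: "connection_on (over S) A \<Longrightarrow> smooth_on (ext_dom S) (\<lambda>z. ext A z v)"
  unfolding connection_on_def smooth_one_form_def retr_vimage_P_id by blast

text \<open>Both sides are equivariant and reproduce fundamental fields, so it suffices that they
  agree on the canonical section.\<close>

lemma connection_eq_gen:
  assumes A: "connection_on (over S) A" "has_form (over S) x y A"
    and z: "z \<in> P_id (over S)" "fst z \<noteq> 0" "v \<in> T_P z"
  shows "A z v = gen (\<lambda>t. bsA t * x t) (\<lambda>t. bsB t * y t) z v"
proof -
  define a b where "a t = bsA t * x t" and "b t = bsB t * y t" for t
  have aa: "fst (snd z) \<in> SU2" "snd (snd z) \<in> SU2" "fst z \<in> S" using z by (simp_all add: P_id_over)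
  obtain h n w \<xi> where d: "h \<in> SU2" "n \<in> Cyl" "w \<in> T_Cyl n" "z = ract h (sec n)"
    "v = ract h (dsec n w) + fund \<xi> z"
    by (rule tangent_decomposition[OF z(2) aa(1,2) z(3)])
  have sn: "fst (sec n) = fst z" by (simp add: d(4) ract_def case_prod_unfold)
  have sSU: "fst (snd (sec n)) \<in> SU2" "snd (snd (sec n)) \<in> SU2"
    using d(2) by (auto simp: Cyl_def sec_def)
  have snP: "sec n \<in> P_id (over S)" using sSU aa(3) by (simp add: P_id_over sn)
  have PhiV: "Phi n \<in> over S" using snP by (simp add: P_id_def pr_sec)
  have wT: "dsec n w \<in> T_P (sec n)"
    using d(3) by (auto simp: T_P_iff T_Cyl_def dsec_def sec_def case_prod_unfold)
  have fT: "fund \<xi> z \<in> T_P z" by (rule fund_T_P)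
  have rT: "ract h (dsec n w) \<in> T_P z"
    using wT by (simp add: T_P_iff d(4) ract_def case_prod_unfold inner_qmul_right)
  have lin: "linear (ext A z)"
    using A(1) z(1) by (auto simp: connection_on_def smooth_one_form_def)
  have "A z v = ext A z v" using ext_tangent[OF aa(1,2) z(3)] by simp
  also have "\<dots> = A z (ract h (dsec n w)) + A z (fund \<xi> z)"
    unfolding d(5) linear_add[OF lin] ext_tangent[OF aa(1,2) rT] ext_tangent[OF aa(1,2) fT] ..
  also have "A z (fund \<xi> z) = \<xi>"
    using A(1) z(1) by (simp add: connection_on_def)
  also have "A z (ract h (dsec n w)) = Ad (qcnj h) (A (sec n) (dsec n w))"
    using A(1) snP wT d(1) unfolding d(4) connection_on_def by blast
  also have "A (sec n) (dsec n w) = ansatz x y n w"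
    using A(2) d(2,3) PhiV by (simp add: has_form_def flip: frechet_derivative_sec)
  also have "\<dots> = gen a b (sec n) (dsec n w)"
    unfolding gen_sec[OF d(2)] ansatz_eq by (simp add: a_def b_def)
  also have "Ad (qcnj h) (gen a b (sec n) (dsec n w)) + \<xi> = gen a b z v"
  proof -
    have "gen a b z (ract h (dsec n w)) = Ad (qcnj h) (gen a b (sec n) (dsec n w))"
      unfolding d(4) by (rule gen_ract[OF d(1)]) (use z(2) sn sSU in \<open>auto simp: SU2_nonzero\<close>)
    moreover have "gen a b z v = gen a b z (ract h (dsec n w)) + gen a b z (fund \<xi> z)"
      unfolding d(5) by (rule linear_add[OF linear_gen])
    ultimately show ?thesis
      using gen_fund[OF z(2) SU2_nonzero[OF aa(1)] SU2_nonzero[OF aa(2)]] by simp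
  qed
  finally show ?thesis by (simp only: a_def[abs_def] b_def[abs_def])
qed

lemma ext_eq_gen:
  assumes A: "connection_on (over S) A" "has_form (over S) x y A"
    and z: "z \<in> ext_dom S" "fst z \<noteq> 0"
  shows "ext A z v = gen (\<lambda>t. bsA t * x t) (\<lambda>t. bsB t * y t) z v"
proof -
  have nz: "fst (snd z) \<noteq> 0" "snd (snd z) \<noteq> 0" using z by (simp_all add: ext_dom_def)
  have "retr z \<in> P_id (over S)" using z(1) retr_vimage_P_id by blast
  moreover have "fst (retr z) \<noteq> 0" using z(2) by (simp add: retr_def case_prod_unfold)
  ultimately have "A (retr z) (dretr z v) = gen (\<lambda>t. bsA t * x t) (\<lambda>t. bsB t * y t) (retr z) (dretr z v)"
    by (rule connection_eq_gen[OF A _ _ dretr_T_P])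
  then show ?thesis unfolding ext_eq[OF nz] gen_retr[OF z(2) nz] .
qed

section \<open>Coefficients and equations at a point of the real axis\<close>

abbreviation qone :: quat where "qone \<equiv> (1, 0)"

lemma frame_at_axis:
  assumes "t > 0"
  defines "z \<equiv> ((t, 0), qone, qone) :: tot"
  shows "mu1 z v = snd (fst (snd v))" "mu2 z v = snd (snd (snd v))" "frZ z v = t *\<^sub>R snd (fst v)"
    "frt z v = fst (fst v)" "frN z v = (1 / 2) *\<^sub>R (snd (fst (snd v)) - snd (snd (snd v)))"
    "frP z v = snd (fst v) /\<^sub>R t - frN z v"
proof -
  have q: "qcnj qone = qone" "qcnj (t, 0) = (t, 0)" "norm qone = 1" "norm (t, 0 :: real^3) = t"
    using assms by (simp_all add: qcnj_def)
  show m: "mu1 z v = snd (fst (snd v))" "mu2 z v = snd (snd (snd v))" "frZ z v = t *\<^sub>R snd (fst v)"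
    by (simp_all add: z_def mu1_def mu2_def frZ_def case_prod_unfold mcn_def q qmul_real)
  show "frt z v = fst (fst v)"
    using assms(1) by (simp add: frt_def z_def q inner_prod_def)
  show N: "frN z v = (1 / 2) *\<^sub>R (snd (fst (snd v)) - snd (snd (snd v)))"
    by (simp add: frN_def m)
  show "frP z v = snd (fst v) /\<^sub>R t - frN z v"
    using assms(1) by (subst frP_eq) (simp_all add: m, simp_all add: z_def q zero_prod_def power2_eq_square)
qed

text \<open>Two test vectors from which \<open>a\<close> and \<open>b\<close> can be
  recovered.\<close>

lemma gen_at_axis:
  assumes "t > 0"
  shows "gen a b ((t, 0), qone, qone) ((0, T 1), 0, 0) $ 1 = (a t - 1) / t"
    and "gen a b ((t, 0), qone, qone) (0, imq (T 1), - imq (T 1)) $ 1 = b t - a t + 1"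
proof -
  have n: "norm (t, 0 :: real^3) = t" using assms by simp
  have m3: "mu3 z v = (1 / 2) *\<^sub>R (mu1 z v + mu2 z v) - frP z v" for z v by (simp add: frP_def)
  show "gen a b ((t, 0), qone, qone) ((0, T 1), 0, 0) $ 1 = (a t - 1) / t"
    using assms by (simp add: gen_def m3 frame_at_axis n) (simp add: T_def axis_def field_simps)
  show "gen a b ((t, 0), qone, qone) (0, imq (T 1), - imq (T 1)) $ 1 = b t - a t + 1"
    using assms by (simp add: gen_def m3 frame_at_axis n imq_def) (simp add: T_def axis_def field_simps)
qed

text \<open>\<open>has_form\<close> assumes no regularity of \<open>x\<close> and \<open>y\<close>.
  It is inherited from the smooth connection, evaluated on constant vectors along the curve ((s, 0),
  1, 1).\<close>

lemma coefficients_differentiable: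
  assumes A: "connection_on (over S) A" "has_form (over S) x y A" and S: "open S"
    and t: "0 < t" "\<And>s. 0 < s \<Longrightarrow> s < e \<Longrightarrow> (s, 0) \<in> S" "t < e"
  shows "\<exists>D. ((\<lambda>t. bsA t * x t) has_real_derivative D) (at t)"
    and "\<exists>D. ((\<lambda>t. bsB t * y t) has_real_derivative D) (at t)"
proof -
  define a b where "a t = bsA t * x t" and "b t = bsB t * y t" for t
  define c :: "real \<Rightarrow> tot" where "c s = ((s, 0), qone, qone)" for s
  have c: "(c has_derivative (\<lambda>h. ((h, 0), 0, 0))) (at t)"
    unfolding c_def by (intro has_derivative_Pair has_derivative_ident has_derivative_const)
  have cW: "c s \<in> ext_dom S" "fst (c s) \<noteq> 0" if "0 < s" "s < e" for s
    using that t(2) by (auto simp: c_def ext_dom_def zero_prod_def)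
  have sm: "smooth_on (ext_dom S) (\<lambda>z. ext A z v)" for v
    by (rule connection_on_smooth[OF A(1)])
  have ex: "\<exists>D. ((\<lambda>s. gen a b (c s) v $ 1) has_real_derivative D) (at t)" for v
  proof -
    have "((\<lambda>s. ext A (c s) v $ 1) has_derivative
        (\<lambda>h. frechet_derivative (\<lambda>z. ext A z v) (at (c t)) ((h, 0), 0, 0) $ 1)) (at t)"
      by (rule bounded_linear.has_derivative[OF bounded_linear_vec_nth
            has_derivative_compose[OF c smooth_on_has_derivative[OF sm]]]) (use cW t in auto)
    then obtain D where "((\<lambda>s. ext A (c s) v $ 1) has_real_derivative D) (at t)"
      using has_real_derivative_frechet by blast
    then have "((\<lambda>s. gen a b (c s) v $ 1) has_real_derivative D) (at t)"
      by (rule has_field_derivative_transform_within_open[where S = "{0<..<e}"])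
        (use t ext_eq_gen[OF A] cW in \<open>auto simp: a_def[abs_def] b_def[abs_def]\<close>)
    then show ?thesis ..
  qed
  obtain D where D: "((\<lambda>s. gen a b (c s) ((0, T 1), 0, 0) $ 1) has_real_derivative D) (at t)"
    using ex by blast
  obtain D' where D': "((\<lambda>s. gen a b (c s) (0, imq (T 1), - imq (T 1)) $ 1) has_real_derivative D') (at t)"
    using ex by blast
  have "((\<lambda>s. 1 + s * gen a b (c s) ((0, T 1), 0, 0) $ 1) has_real_derivative
      0 + (1 * gen a b (c t) ((0, T 1), 0, 0) $ 1 + D * t)) (at t)"
    by (intro DERIV_add DERIV_const DERIV_mult DERIV_ident D)
  then have a': "(a has_real_derivative 0 + (1 * gen a b (c t) ((0, T 1), 0, 0) $ 1 + D * t)) (at t)"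
    by (rule has_field_derivative_transform_within_open[where S = "{0<..}"])
      (use t in \<open>auto simp: c_def gen_at_axis\<close>)
  then show "\<exists>D. ((\<lambda>t. bsA t * x t) has_real_derivative D) (at t)" unfolding a_def by blast
  have "(b has_real_derivative D' + (0 + (1 * gen a b (c t) ((0, T 1), 0, 0) $ 1 + D * t)) - 0) (at t)"
    by (rule has_field_derivative_transform_within_open[where S = "{0<..}", OF DERIV_diff[OF DERIV_add[OF D' a'] DERIV_const[of 1]]])
      (use t in \<open>auto simp: c_def gen_at_axis\<close>)
  then show "\<exists>D. ((\<lambda>t. bsB t * y t) has_real_derivative D) (at t)" unfolding b_def by blast
qed

text \<open>Allows evaluating a product of one-forms on a dual frame by removing one factor and one
  vector at a time.\<close>

definition kills :: "'v \<Rightarrow> 'v form \<Rightarrow> bool" where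
  "kills v x \<longleftrightarrow> (\<forall>l. form_at x (v # l) = 0)"

lemma kills_cov: "a v = 0 \<Longrightarrow> kills v (cov a)"
  by (auto simp: kills_def form_at_simps covec_Cons)

lemma kills_mult: "kills v x \<Longrightarrow> kills v y \<Longrightarrow> kills v (x * y)"
  by (simp add: kills_def form_at_simps wedge_Cons)

lemma form_at_cov_mult_Cons: "kills v x \<Longrightarrow> form_at (cov a * x) (v # l) = a v * form_at x l"
  by (simp add: kills_def form_at_simps wedge_covec_Cons)

lemma form_at_cov_mult_vanish:
  assumes "\<forall>v\<in>set l. a v = 0"
  shows "form_at (cov a * x) l = 0"
proof -
  have "(covec a \<and>\<^sub>w \<beta>) l = 0" for \<beta>
    using assms by (induction l arbitrary: \<beta>) (simp_all add: wedge_Nil wedge_covec_Cons)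
  then show ?thesis by (simp add: form_at_simps)
qed

lemma form_at_cov_single: "form_at (cov a) [v] = a v"
  by (simp add: form_at_simps)

lemma instanton_ode:
  assumes A: "G2_instanton (over S) A" "has_form (over S) x y A" and S: "open S"
    and t: "0 < t" "(t, 0) \<in> S"
    and a: "((\<lambda>t. bsA t * x t) has_real_derivative a') (at t)"
    and b: "((\<lambda>t. bsB t * y t) has_real_derivative b') (at t)"
  defines "av \<equiv> bsA t * x t" and "bv \<equiv> bsB t * y t"
  shows "a' = (av - av\<^sup>2) / bsA t + bsA t * (bv\<^sup>2 - av) / (bsB t)\<^sup>2"
    and "b' = 2 * (av - 1) / bsA t * bv"
proof -
  have conn: "connection_on (over S) A" using A(1) by (simp add: G2_instanton_def)
  define z :: tot where "z = ((t, 0), qone, qone)"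
  have q1: "qone \<in> SU2" "qone \<noteq> 0" by (auto simp: SU2_iff zero_prod_def)
  have z: "fst z \<noteq> 0" "fst (snd z) \<in> SU2" "snd (snd z) \<in> SU2" "z \<in> P_id (over S)" "norm (fst z) = t"
    using t q1 by (auto simp: z_def P_id_over zero_prod_def)
  define W where "W = ext_dom (S - {0})"
  have W: "open W" unfolding W_def by (intro open_ext_dom open_delete S)
  have zW: "z \<in> W" using t q1 by (auto simp: W_def z_def ext_dom_def zero_prod_def)
  have ext: "ext A w v = gen (\<lambda>t. bsA t * x t) (\<lambda>t. bsB t * y t) w v" if "w \<in> W" for w v
    by (rule ext_eq_gen[OF conn A(2)]) (use that in \<open>auto simp: W_def ext_dom_def\<close>)
  have F: "curvature A z [u, v] = frame_curvature av a' bv b' (frt z) (frP z) (frN z) u v"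
    if "{u, v} \<subseteq> set vs" "set vs \<subseteq> T_P z" for u v vs
  proof -
    have "u \<in> T_P z" "v \<in> T_P z" using that by auto
    then have "A z u = ext A z u" "A z v = ext A z v"
      using z by (simp_all add: ext_tangent)
    from curvature_gen[where A = A, OF W zW ext this z(1) SU2_nonzero[OF z(2)] SU2_nonzero[OF z(3)]
        a[folded z(5)] b[folded z(5)]]
    show ?thesis by (simp only: z(5) av_def bv_def)
  qed
  have F0: "curvature A z l = 0" if "length l \<noteq> 2" for l
    using that by (auto simp: curvature_def split: list.splits)
  \<comment> \<open>A frame dual to dt, P, N at \<open>z\<close>. As P is the imaginary part of the
    \<open>p\<close> component divided by t, minus N, the component t T_i in \<open>eN i\<close>
    serves to make P vanish.\<close>
  define e0 :: tot where "e0 = ((1, 0), 0, 0)"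
  define eP :: "3 \<Rightarrow> tot" where "eP i = ((0, t *\<^sub>R T i), 0, 0)" for i
  define eN :: "3 \<Rightarrow> tot" where "eN i = ((0, t *\<^sub>R T i), imq (T i), - imq (T i))" for i
  have fr: "frt z e0 = 1" "frP z e0 = 0" "frN z e0 = 0" "frt z (eP i) = 0" "frP z (eP i) = T i" "frN z (eP i) = 0"
    "frt z (eN i) = 0" "frP z (eN i) = 0" "frN z (eN i) = T i" for i
    using t(1) frame_at_axis[OF t(1), folded z_def]
    by (simp_all add: e0_def eP_def eN_def imq_def flip: scaleR_2)
  have TP: "e0 \<in> T_P z" "eP i \<in> T_P z" "eN i \<in> T_P z" for i
    by (simp_all add: T_P_iff e0_def eP_def eN_def imq_def z_def inner_prod_def)
  have Tij: "T i $ j = (if i = j then 1 else 0)" for i j by (simp add: T_def axis_def)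
  have eq: "(- 16 * (bsA t)\<^sup>2 * (bsB t)\<^sup>2 * a' - 16 * bsA t * (bsB t)\<^sup>2 * (av\<^sup>2 - av) + 16 * bsA t ^ 3 * (bv\<^sup>2 - av)) *
       form_at (cov (frt z) * (cvec (frP z) 1 * (cvec (frP z) 2 * (cvec (frP z) 3 * (cvec (frN z) 2 * cvec (frN z) 3))))) vs
   + (- 16 * (bsA t)\<^sup>2 * (bsB t)\<^sup>2 * b' + 32 * bsA t * (bsB t)\<^sup>2 * (av * bv - bv)) *
       form_at (cov (frt z) * (cvec (frP z) 2 * (cvec (frP z) 3 * (cvec (frN z) 1 * (cvec (frN z) 2 * cvec (frN z) 3))))) vs = 0"
    if vs: "set vs \<subseteq> T_P z" for vs
  proof -
    have "pullback pr psi z = form_at (psi_form (bsA t) (bsB t) (frt z) (frP z) (frN z))"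
      by (rule HOL.ext) (simp only: pullback_pr_psi[OF z(1-3)] z(5))
    moreover have "(curvature A z \<and>\<^sub>w pullback pr psi z) vs = 0"
      using A(1) z(4) vs by (simp add: G2_instanton_def)
    ultimately have "(curvature A z \<and>\<^sub>w form_at (psi_form (bsA t) (bsB t) (frt z) (frP z) (frN z))) vs $ 1 = 0"
      by simp
    then show ?thesis
      using curvature_wedge_psi_component[where F = "curvature A z" and e = "frt z" and P = "frP z" and N = "frN z"
          and vs = vs, OF F[OF _ vs] F0] by simp
  qed
  note eval = form_at_cov_mult_Cons kills_mult kills_cov form_at_cov_single fr Tij
  have pos: "0 < bsA t" "0 < bsB t" using t(1) by (simp_all add: bsA_pos bsB_pos)
  \<comment> \<open>Each list of vectors is dual to one of the two six-forms, and the other six-form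
    vanishes on it.\<close>
  have 1: "- 16 * (bsA t)\<^sup>2 * (bsB t)\<^sup>2 * a' - 16 * bsA t * (bsB t)\<^sup>2 * (av\<^sup>2 - av) + 16 * bsA t ^ 3 * (bv\<^sup>2 - av) = 0"
    using eq[of "[e0, eP 1, eP 2, eP 3, eN 2, eN 3]"] unfolding cvec_def by (simp add: TP eval)
  have 2: "- 16 * (bsA t)\<^sup>2 * (bsB t)\<^sup>2 * b' + 32 * bsA t * (bsB t)\<^sup>2 * (av * bv - bv) = 0"
    using eq[of "[e0, eP 2, eP 3, eN 1, eN 2, eN 3]"] unfolding cvec_def by (simp add: TP eval form_at_cov_mult_vanish)
  show "a' = (av - av\<^sup>2) / bsA t + bsA t * (bv\<^sup>2 - av) / (bsB t)\<^sup>2"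
  proof -
    have "bsA t * (bsA t * (bsB t)\<^sup>2 * a' - ((bsB t)\<^sup>2 * (av - av\<^sup>2) + (bsA t)\<^sup>2 * (bv\<^sup>2 - av))) = 0"
      using 1 by (simp add: power2_eq_square power3_eq_cube algebra_simps)
    then have "bsA t * (bsB t)\<^sup>2 * a' = (bsB t)\<^sup>2 * (av - av\<^sup>2) + (bsA t)\<^sup>2 * (bv\<^sup>2 - av)"
      using pos by simp
    then show ?thesis using pos by (simp add: field_simps power2_eq_square)
  qed
  show "b' = 2 * (av - 1) / bsA t * bv"
  proof -
    have "bsA t * (bsB t)\<^sup>2 * (bsA t * b' - 2 * (av - 1) * bv) = 0"
      using 2 by (simp add: power2_eq_square algebra_simps)
    then have "bsA t * b' = 2 * (av - 1) * bv" using pos by simp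
    then show ?thesis using pos by (simp add: field_simps)
  qed
qed

text \<open>If c \<le> K up to \<open>s1\<close>, then D^2 exp(-2 K t) is nonincreasing there, and
  it is nonnegative with limit 0 at t = 0. The bound comes from the limit of \<open>c\<close> near 0
  and from compactness on the rest of the interval.\<close>

lemma linear_ode_zero:
  fixes D c :: "real \<Rightarrow> real"
  assumes D: "\<And>t. 0 < t \<Longrightarrow> t < e \<Longrightarrow> (D has_real_derivative c t * D t) (at t)"
    and cont: "\<And>t. 0 < t \<Longrightarrow> t < e \<Longrightarrow> isCont c t"
    and c0: "(c \<longlongrightarrow> l) (at_right 0)" and D0: "(D \<longlongrightarrow> 0) (at_right 0)"
    and s1: "0 < s1" "s1 < e"
  shows "D s1 = 0"
proof -
  have "eventually (\<lambda>t. c t < l + 1) (at_right 0)"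
    using order_tendstoD(2)[OF c0] by simp
  then obtain d where d: "0 < d" "\<And>t. 0 < t \<Longrightarrow> t < d \<Longrightarrow> c t < l + 1"
    by (auto simp: eventually_at_right_field)
  define s0 where "s0 = min (d / 2) s1"
  have s0: "0 < s0" "s0 < d" "s0 \<le> s1" using d s1 by (auto simp: s0_def min_def)
  have "continuous_on {s0..s1} c"
    by (intro continuous_at_imp_continuous_on ballI cont) (use s0 s1 in auto)
  then have "bounded (c ` {s0..s1})" by (intro compact_imp_bounded compact_continuous_image compact_Icc)
  then obtain K1 where K1: "\<forall>t\<in>{s0..s1}. \<bar>c t\<bar> \<le> K1"
    by (auto simp: bounded_iff)
  define K where "K = max (l + 1) K1"
  have K: "c t \<le> K" if "0 < t" "t \<le> s1" for t
    using d(2)[of t] bspec[OF K1, of t] that s0 by (cases "t < s0") (auto simp: K_def max_def)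
  define E where "E t = (D t)\<^sup>2 * exp (- 2 * K * t)" for t
  have E': "(E has_real_derivative 2 * (c t - K) * (D t)\<^sup>2 * exp (- 2 * K * t)) (at t)" if "0 < t" "t < e" for t
    unfolding E_def[abs_def]
    by (rule derivative_eq_intros D[OF that] refl)+ (simp add: power2_eq_square algebra_simps)
  have dec: "E s1 \<le> E s" if s: "0 < s" "s \<le> s1" for s
  proof (rule DERIV_nonpos_imp_nonincreasing[OF s(2)])
    fix t assume "s \<le> t" "t \<le> s1"
    then have t: "0 < t" "t \<le> s1" "t < e" using s s1 by auto
    have "2 * (c t - K) * (D t)\<^sup>2 * exp (- 2 * K * t) \<le> 0"
      by (rule mult_nonpos_nonneg[OF mult_nonpos_nonneg]) (use K[OF t(1,2)] in simp_all)
    then show "\<exists>y. (E has_real_derivative y) (at t) \<and> y \<le> 0"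
      using E'[OF t(1,3)] by blast
  qed
  have "(E \<longlongrightarrow> 0\<^sup>2 * exp (- 2 * K * 0)) (at_right 0)"
    unfolding E_def[abs_def]
    by (intro tendsto_mult tendsto_power D0 tendsto_exp tendsto_const tendsto_ident_at)
  then have E0: "(E \<longlongrightarrow> 0) (at_right 0)" by simp
  have "E s1 \<le> 0"
  proof (rule tendsto_lowerbound[OF E0])
    show "\<forall>\<^sub>F s in at_right 0. E s1 \<le> E s"
      unfolding eventually_at_right_field using dec s1(1) by (intro exI[of _ s1]) auto
  qed simp
  then show ?thesis by (simp add: E_def mult_le_0_iff)
qed

section \<open>Identification of the coefficients and of the connection\<close>

lemma tendsto_zero_of_bigo:
  fixes f :: "real \<Rightarrow> real"
  assumes "f \<in> O[at_right 0](\<lambda>t. t)"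
  shows "(f \<longlongrightarrow> 0) (at_right 0)"
proof -
  obtain C where "\<forall>\<^sub>F t in at_right 0. norm (f t) \<le> C * norm t"
    using assms by (auto elim: landau_o.bigE)
  moreover have "((\<lambda>t::real. C * norm t) \<longlongrightarrow> 0) (at_right 0)"
    by (auto intro!: tendsto_eq_intros)
  ultimately show ?thesis by (rule Lim_null_comparison)
qed

lemma A_lim_coefficients:
  assumes "is_A_lim \<epsilon> x y A" "0 < s1" "s1 < \<epsilon>"
  shows "bsA s1 * x s1 = bsa s1" "bsB s1 * y s1 = 0"
proof -
  define a b where "a t = bsA t * x t" and "b t = bsB t * y t" for t
  let ?S = "ball (0::quat) \<epsilon>"
  have inst: "G2_instanton (over ?S) A" and form: "has_form (over ?S) x y A"
    and x: "(\<lambda>t. x t - 2 / t) \<in> O[at_right 0](\<lambda>t. t)" and y: "(y \<longlongrightarrow> 0) (at_right 0)"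
    using assms(1) by (simp_all add: is_A_lim_def tube_eq_over)
  have conn: "connection_on (over ?S) A" using inst by (simp add: G2_instanton_def)
  have ode: "(a has_real_derivative (a t - (a t)\<^sup>2) / bsA t + bsA t * ((b t)\<^sup>2 - a t) / (bsB t)\<^sup>2) (at t)"
    "(b has_real_derivative (2 * (a t - 1) / bsA t) * b t) (at t)" if t: "0 < t" "t < \<epsilon>" for t
  proof -
    have S: "(s, 0) \<in> ?S" if "0 < s" "s < \<epsilon>" for s using that by simp
    obtain a' where a': "((\<lambda>t. bsA t * x t) has_real_derivative a') (at t)"
      using coefficients_differentiable(1)[OF conn form open_ball t(1) S t(2)] by blast
    obtain b' where b': "((\<lambda>t. bsB t * y t) has_real_derivative b') (at t)"
      using coefficients_differentiable(2)[OF conn form open_ball t(1) S t(2)] by blast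
    note o = instanton_ode[OF inst form open_ball t(1) S[OF t] a' b']
    show "(a has_real_derivative (a t - (a t)\<^sup>2) / bsA t + bsA t * ((b t)\<^sup>2 - a t) / (bsB t)\<^sup>2) (at t)"
      using a' unfolding o(1) by (simp add: a_def[abs_def] b_def)
    show "(b has_real_derivative (2 * (a t - 1) / bsA t) * b t) (at t)"
      using b' unfolding o(2) by (simp add: a_def b_def[abs_def])
  qed
  have contA: "isCont bsA t" and contB: "isCont bsB t" if "0 < t" for t
    using bsA_has_derivative[OF that] bsB_has_derivative[OF that] DERIV_isCont by blast+
  have conta: "isCont a t" if "0 < t" "t < \<epsilon>" for t
    using ode(1)[OF that] DERIV_isCont by blast
  have q: "((\<lambda>t. 2 / t - 1 / bsA t) \<longlongrightarrow> 0) (at_right 0)"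
  proof -
    obtain l where l: "((\<lambda>t. (2 * bsRho (t\<^sup>2) - 1) / t\<^sup>2) \<longlongrightarrow> l) (at_right 0)"
      using bsRho_quotient_limit by blast
    have "((\<lambda>t. t * ((2 * bsRho (t\<^sup>2) - 1) / t\<^sup>2) / bsRho (t\<^sup>2)) \<longlongrightarrow> 0 * l / (1 / 2)) (at_right 0)"
      by (intro tendsto_divide tendsto_mult l bsRho_tendsto tendsto_ident_at) simp
    then have "((\<lambda>t. t * ((2 * bsRho (t\<^sup>2) - 1) / t\<^sup>2) / bsRho (t\<^sup>2)) \<longlongrightarrow> 0) (at_right 0)" by simp
    then show ?thesis
    proof (rule Lim_transform_eventually[OF _ eventually_mono[OF eventually_pos_at_right]])
      fix t :: real assume t: "0 < t"
      define R where "R = bsRho (t\<^sup>2)"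
      have A: "bsA t = t * R" using t by (simp add: bsA_eq_Rho R_def)
      have R: "R \<noteq> 0" using bsA_pos[OF t] A by auto
      show "t * ((2 * bsRho (t\<^sup>2) - 1) / t\<^sup>2) / bsRho (t\<^sup>2) = 2 / t - 1 / bsA t"
        unfolding A R_def[symmetric] using t R by (simp add: field_simps power2_eq_square)
    qed
  qed
  \<comment> \<open>For a = A u one has (a - 1)/A = (u - 2/t) + (2/t - 1/A), and both summands tend
    to 0.\<close>
  have quot: "((\<lambda>t. (bsA t * u t - 1) / bsA t) \<longlongrightarrow> 0) (at_right 0)"
    if "(\<lambda>t. u t - 2 / t) \<in> O[at_right 0](\<lambda>t. t)" for u
  proof -
    have "((\<lambda>t. (u t - 2 / t) + (2 / t - 1 / bsA t)) \<longlongrightarrow> 0 + 0) (at_right 0)"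
      by (intro tendsto_add tendsto_zero_of_bigo that q)
    then have "((\<lambda>t. (u t - 2 / t) + (2 / t - 1 / bsA t)) \<longlongrightarrow> 0) (at_right 0)" by simp
    then show ?thesis
    proof (rule Lim_transform_eventually[OF _ eventually_mono[OF eventually_pos_at_right]])
      fix t :: real assume t: "0 < t"
      show "(u t - 2 / t) + (2 / t - 1 / bsA t) = (bsA t * u t - 1) / bsA t"
        using bsA_pos[OF t] by (simp add: diff_divide_distrib)
    qed
  qed
  have qa: "((\<lambda>t. (a t - 1) / bsA t) \<longlongrightarrow> 0) (at_right 0)"
    unfolding a_def by (rule quot[OF x])
  have qs: "((\<lambda>t. (bsa t - 1) / bsA t) \<longlongrightarrow> 0) (at_right 0)"
    unfolding bsa_def by (rule quot[OF profile_asymptotics])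
  have lim1: "(w \<longlongrightarrow> 1) (at_right 0)" if "((\<lambda>t. (w t - 1) / bsA t) \<longlongrightarrow> 0) (at_right 0)" for w
  proof -
    have "((\<lambda>t. 1 + (w t - 1) / bsA t * bsA t) \<longlongrightarrow> 1 + 0 * 0) (at_right 0)"
      by (intro tendsto_add tendsto_mult tendsto_const that bs_limits)
    then have "((\<lambda>t. 1 + (w t - 1) / bsA t * bsA t) \<longlongrightarrow> 1) (at_right 0)" by simp
    then show ?thesis
    proof (rule Lim_transform_eventually[OF _ eventually_mono[OF eventually_pos_at_right]])
      fix t :: real assume t: "0 < t"
      show "1 + (w t - 1) / bsA t * bsA t = w t" using bsA_pos[OF t] by simp
    qed
  qed
  have b0: "(b \<longlongrightarrow> 0) (at_right 0)"
  proof -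
    \<comment> \<open>The limit at hand is that of B^2, so |b| is written as the root of B^2 times
      |y|.\<close>
    have "((\<lambda>t. sqrt ((bsB t)\<^sup>2) * \<bar>y t\<bar>) \<longlongrightarrow> sqrt (1 / 3) * \<bar>0\<bar>) (at_right 0)"
      by (intro tendsto_mult tendsto_real_sqrt bs_limits(3) tendsto_rabs y)
    then show ?thesis
      by (simp add: b_def[abs_def] abs_mult flip: tendsto_rabs_zero_iff[of b, unfolded b_def[abs_def]])
  qed
  have bz: "b t = 0" if t: "0 < t" "t < \<epsilon>" for t
  proof (rule linear_ode_zero[of \<epsilon> b "\<lambda>t. 2 * (a t - 1) / bsA t" 0])
    have "((\<lambda>t. 2 * ((a t - 1) / bsA t)) \<longlongrightarrow> 2 * 0) (at_right 0)"
      by (intro tendsto_mult tendsto_const qa)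
    then show "((\<lambda>t. 2 * (a t - 1) / bsA t) \<longlongrightarrow> 0) (at_right 0)" by simp
    show "isCont (\<lambda>t. 2 * (a t - 1) / bsA t) t" if "0 < t" "t < \<epsilon>" for t
      using bsA_pos[OF that(1)] by (intro continuous_intros contA conta that) simp
  qed (use ode(2) b0 t in auto)
  \<comment> \<open>The logarithmic derivative 2 A'/A = 1/A - A/B^2 of the factor supplies the
    second 1/A, so that the poles combine into (1 - a)/A + (1 - a0)/A, which tends to 0.\<close>
  define D where "D t = (bsA t)\<^sup>2 * (a t - bsa t)" for t
  define c where "c t = - ((a t - 1) / bsA t) - (bsa t - 1) / bsA t - 2 * bsA t / (bsB t)\<^sup>2" for t
  have "D s1 = 0"
  proof (rule linear_ode_zero[of \<epsilon> D c 0])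
    fix t assume t: "0 < t" "t < \<epsilon>"
    have pos: "0 < bsA t" "0 < bsB t" using t by (simp_all add: bsA_pos bsB_pos)
    have "(D has_real_derivative
        (2 * bsA t * ((1 - (bsA t)\<^sup>2 / (bsB t)\<^sup>2) / 2)) * (a t - bsa t)
        + ((a t - (a t)\<^sup>2) / bsA t + bsA t * ((b t)\<^sup>2 - a t) / (bsB t)\<^sup>2
          - ((bsa t - (bsa t)\<^sup>2) / bsA t - bsA t * bsa t / (bsB t)\<^sup>2)) * (bsA t)\<^sup>2) (at t)"
      unfolding D_def[abs_def]
      by (rule derivative_eq_intros bsA_has_derivative[OF t(1)] bsa_has_derivative[OF t(1)] ode(1)[OF t] refl)+
        simp
    moreover have "(2 * A * ((1 - A\<^sup>2 / B\<^sup>2) / 2)) * (u - w)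
        + ((u - u\<^sup>2) / A + A * (0\<^sup>2 - u) / B\<^sup>2 - ((w - w\<^sup>2) / A - A * w / B\<^sup>2)) * A\<^sup>2
      = (- ((u - 1) / A) - (w - 1) / A - 2 * A / B\<^sup>2) * (A\<^sup>2 * (u - w))" if "0 < A" "0 < B" for A B u w :: real
      using that by (simp add: field_simps power2_eq_square)
    ultimately show "(D has_real_derivative c t * D t) (at t)"
      using pos by (simp only: bz[OF t] c_def D_def)
    show "isCont c t"
      unfolding c_def[abs_def] using pos
      by (intro continuous_intros contA contB conta t DERIV_isCont[OF bsa_has_derivative]) auto
  next
    have "(c \<longlongrightarrow> - 0 - 0 - 2 * 0 / (1 / 3)) (at_right 0)"
      unfolding c_def[abs_def]
      by (intro tendsto_diff tendsto_minus tendsto_divide tendsto_mult tendsto_const qa qs bs_limits) simp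
    then show "(c \<longlongrightarrow> 0) (at_right 0)" by simp
    have "(D \<longlongrightarrow> 0\<^sup>2 * (1 - 1)) (at_right 0)"
      unfolding D_def[abs_def] by (intro tendsto_mult tendsto_power tendsto_diff bs_limits lim1 qa qs)
    then show "(D \<longlongrightarrow> 0) (at_right 0)" by simp
  qed (use assms in auto)
  then show "bsA s1 * x s1 = bsa s1" using bsA_pos[OF assms(2)] by (simp add: D_def a_def)
  show "bsB s1 * y s1 = 0" using bz[OF assms(2,3)] by (simp add: b_def)
qed

text \<open>For p \<noteq> 0 the coefficients decide; at p = 0 both connections are limits of their
  smooth extensions. Comparing with the single globally defined \<open>Alim\<close> yields local
  uniqueness and the global extension together.\<close>

lemma A_lim_eq_Alim:
  assumes lim: "is_A_lim \<epsilon> x y A" and z: "z \<in> P_id (tube \<epsilon>)" and v: "v \<in> T_P z"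
  shows "A z v = Alim z v"
proof -
  let ?S = "ball (0::quat) \<epsilon>"
  have conn: "connection_on (over ?S) A" and form: "has_form (over ?S) x y A" and e: "0 < \<epsilon>"
    using lim by (simp_all add: is_A_lim_def tube_eq_over G2_instanton_def)
  have regular: "A z v = Alim z v"
    if z: "z \<in> P_id (over ?S)" "fst z \<noteq> 0" and v: "v \<in> T_P z" for z v
  proof -
    have n: "0 < norm (fst z)" "norm (fst z) < \<epsilon>" and nz: "fst (snd z) \<noteq> 0"
      using z by (auto simp: P_id_over SU2_nonzero)
    have "A z v = gen (\<lambda>t. bsA t * x t) (\<lambda>t. bsB t * y t) z v"
      by (rule connection_eq_gen[OF conn form z v])
    also have "\<dots> = gen bsa (\<lambda>_. 0) z v"
      unfolding gen_def A_lim_coefficients[OF lim n] ..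
    finally show ?thesis unfolding Alim_eq_gen[OF z(2) nz] .
  qed
  have z': "z \<in> P_id (over ?S)" using z by (simp add: tube_eq_over)
  show ?thesis
  proof (cases "fst z = 0")
    case False
    then show ?thesis by (rule regular[OF z' _ v])
  next
    case True
    define a1 a2 where "a1 = fst (snd z)" and "a2 = snd (snd z)"
    have z_eq: "z = (0, a1, a2)" using True by (simp add: a1_def a2_def prod_eq_iff)
    have a: "a1 \<in> SU2" "a2 \<in> SU2" using z' by (simp_all add: P_id_over a1_def a2_def)
    have op: "open (ext_dom ?S)" by (rule open_ext_dom) simp
    have zW: "z \<in> ext_dom ?S" using a e by (simp add: z_eq ext_dom_def SU2_nonzero)
    have lim0: "((\<lambda>p. ext C (p, a1, a2) v) \<longlongrightarrow> C z v) (at 0)" if "connection_on (over ?S) C" for C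
    proof -
      have "smooth_on (ext_dom ?S) (\<lambda>z. ext C z v)"
        by (rule connection_on_smooth[OF that])
      then have "isCont (\<lambda>z. ext C z v) z"
        using smooth_on_imp_continuous_on continuous_on_eq_continuous_at[OF op] zW by blast
      moreover have "((\<lambda>p. (p, a1, a2)) \<longlongrightarrow> z) (at 0)"
        unfolding z_eq by (intro tendsto_Pair tendsto_const tendsto_ident_at)
      ultimately have "((\<lambda>p. ext C (p, a1, a2) v) \<longlongrightarrow> ext C z v) (at 0)"
        by (rule isCont_tendsto_compose)
      moreover have "ext C z v = C z v"
        by (rule ext_tangent) (use a v in \<open>simp_all add: z_eq\<close>)
      ultimately show ?thesis by simp
    qed
    have "((\<lambda>p. ext A (p, a1, a2) v) \<longlongrightarrow> Alim z v) (at 0)"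
    proof (rule Lim_transform_eventually[OF lim0[OF connection_on_Alim[OF open_ball]]])
      have "\<forall>\<^sub>F p in at 0. p \<in> ball (0::quat) \<epsilon> \<and> p \<noteq> 0"
        using e by (intro eventually_conj eventually_at_in_open') (auto simp: eventually_at_filter)
      then show "\<forall>\<^sub>F p in at 0. ext Alim (p, a1, a2) v = ext A (p, a1, a2) v"
      proof (rule eventually_mono)
        fix p assume p: "p \<in> ball (0::quat) \<epsilon> \<and> p \<noteq> 0"
        have T: "v \<in> T_P (p, a1, a2)" using v by (simp add: T_P_iff z_eq)
        have "A (p, a1, a2) v = Alim (p, a1, a2) v"
          using p a by (intro regular T) (simp_all add: P_id_over)
        then show "ext Alim (p, a1, a2) v = ext A (p, a1, a2) v"
          using a T by (simp add: ext_tangent)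
      qed
    qed
    from tendsto_unique[OF _ lim0[OF conn] this] show ?thesis by simp
  qed
qed

theorem theorem5:
  shows "(\<exists>\<epsilon> x y A. is_A_lim \<epsilon> x y A)
    \<and> (\<forall>\<epsilon> x y A \<epsilon>' x' y' A'. is_A_lim \<epsilon> x y A \<and> is_A_lim \<epsilon>' x' y' A' \<longrightarrow>
        (\<forall>z\<in>P_id (tube (min \<epsilon> \<epsilon>')). \<forall>v\<in>T_P z. A z v = A' z v))
    \<and> (\<forall>\<epsilon> x y A. is_A_lim \<epsilon> x y A \<longrightarrow>
        (\<forall>t\<in>{0<..<\<epsilon>}. x t = bsA t / (1 / 2 * (bsB t ^ 2 - 1 / 3)) \<and> y t = 0) \<and>
        (\<exists>Aext. G2_instanton M Aext
           \<and> has_form M (\<lambda>t. bsA t / (1 / 2 * (bsB t ^ 2 - 1 / 3))) (\<lambda>t. 0) Aext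
           \<and> (\<forall>z\<in>P_id (tube \<epsilon>). \<forall>v\<in>T_P z. Aext z v = A z v)))"
proof (intro conjI allI impI ballI)
  show "\<exists>\<epsilon> x y A. is_A_lim \<epsilon> x y A"
    using is_A_lim_Alim[OF zero_less_one] by (intro exI)
next
  fix \<epsilon> x y A \<epsilon>' x' y' A' z v
  assume lim: "is_A_lim \<epsilon> x y A \<and> is_A_lim \<epsilon>' x' y' A'"
    and z: "z \<in> P_id (tube (min \<epsilon> \<epsilon>'))" and v: "v \<in> T_P z"
  have "z \<in> P_id (tube \<epsilon>)" "z \<in> P_id (tube \<epsilon>')"
    using z by (auto simp: tube_eq_over P_id_over)
  then show "A z v = A' z v" using lim v A_lim_eq_Alim by metis
next
  fix \<epsilon> x y A t
  assume lim: "is_A_lim \<epsilon> x y A" and "t \<in> {0<..<\<epsilon>}"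
  then have t: "0 < t" "t < \<epsilon>" by auto
  have pos: "0 < bsA t" "0 < bsB t" using t by (simp_all add: bsA_pos bsB_pos)
  show "x t = bsA t / (1 / 2 * (bsB t ^ 2 - 1 / 3))"
    using A_lim_coefficients(1)[OF lim t] pos unfolding bsa_def mult_cancel_left by simp
  show "y t = 0" using A_lim_coefficients(2)[OF lim t] pos by simp
next
  fix \<epsilon> x y A
  assume lim: "is_A_lim \<epsilon> x y A"
  show "\<exists>Aext. G2_instanton M Aext
           \<and> has_form M (\<lambda>t. bsA t / (1 / 2 * (bsB t ^ 2 - 1 / 3))) (\<lambda>t. 0) Aext
           \<and> (\<forall>z\<in>P_id (tube \<epsilon>). \<forall>v\<in>T_P z. Aext z v = A z v)"
    using G2_instanton_Alim[of UNIV] has_form_Alim A_lim_eq_Alim[OF lim]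
    by (intro exI[of _ Alim]) (simp add: M_eq_over)
qed

end
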